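(* Let $X$ be a compact connected Riemann surface and let $q,z:X\to\mathbb P^1$ be nonconstant meromorphic maps. Let $\Theta$ be the normalized logarithmic connection form determined by the relative differential morphism $\mathcal Z$ of $q$ and $z$, a meromorphic section of $\mathcal H=\operatorname{Hom}(q^*T\mathbb P^1,z^*T\mathbb P^1)$. Then, with residues understood intrinsically, $$\sum_{p\in X}\operatorname{Res}_p\Theta=2i\,\deg\mathcal H=4i\bigl(\deg z-\deg q\bigr).$$ Equivalently, whenever the dual conformal-net realization is available on the complement of the singular set, $$\sum_{p\in X}\operatorname{Res}_p\left(\frac1H\,\widetilde\omega\,dz-H\,\omega\,dq\right)=4i\bigl(\deg z-\deg q\bigr),$$ where the residue at a singular point means the intrinsic residue of the meromorphic logarithmic connection to which the displayed local conformal form extends.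
   Context: $Tq:TX\to q^*T\mathbb P^1$ and $Tz:TX\to z^*T\mathbb P^1$ are the differentials, and $\mathcal Z=Tz\circ(Tq)^{-1}$, a meromorphic section of $\mathcal H$. In a local frame $E_\alpha$ of $\mathcal H$ write $\mathcal Z=g_\alpha E_\alpha$. The logarithmic connection determined by $\mathcal Z$ has local operators $D_\alpha=d-\alpha_\alpha$ with $\alpha_\alpha=d\log g_\alpha=g_\alpha^{-1}dg_\alpha$, and normalized local forms $\Theta_\alpha=2i\,\alpha_\alpha$, collectively denoted $\Theta$ (these are local connection forms, not necessarily restrictions of one global one-form). If $E_\beta=h_{\alpha\beta}E_\alpha$ then $\alpha_\beta=\alpha_\alpha-d\log h_{\alpha\beta}$. The intrinsic residue $\operatorname{Res}_p\Theta$ is the residue at $p$ of $\Theta_\alpha$ for any nowhere vanishing holomorphic frame $E_\alpha$ of $\mathcal H$ near $p$ (it does not depend on the frame). $\deg q,\deg z$ are the degrees of the maps to $\mathbb P^1$. Dual conformal nets: where $q=q_1+iq_2$ is a local conformal coordinate and $z=z(q)$ is holomorphic with $z_q=dz/dq\neq0$, put $H=|z_q|$ (the conformal factor of the metric $ds^2=H^2(dq_1^2+dq_2^2)$), $\widetilde H=H^{-1}$, $\omega=-\frac{2i}{H}\partial_q\log H$, $\widetilde\omega=-\frac{2i}{\widetilde H}\partial_z\log\widetilde H$, where $\partial_q=\frac12(\partial_{q_1}-i\partial_{q_2})$ and $\partial_z=z_q^{-1}\partial_q$. The form $\frac1H\widetilde\omega\,dz-H\omega\,dq$ is regarded as the local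 form of the connection $\Theta$ in the coordinate frame $\frac{\partial}{\partial z}\otimes dq$ of $\mathcal H$. *)

theory Defs
  imports "HOL-Complex_Analysis.Complex_Analysis"
begin

section \<open>Riemann surfaces\<close>

type_synonym 'a chart = "'a set \<times> ('a \<Rightarrow> complex)"

definition in_chart :: "'a chart \<Rightarrow> ('a \<Rightarrow> 'b) \<Rightarrow> complex \<Rightarrow> 'b" where
  "in_chart c f = f \<circ> inv_into (fst c) (snd c)"

definition chart_deriv :: "'a chart \<Rightarrow> ('a \<Rightarrow> complex) \<Rightarrow> 'a \<Rightarrow> complex" where
  "chart_deriv c f p = deriv (in_chart c f) (snd c p)"

definition complex_chart :: "'a topology \<Rightarrow> 'a chart \<Rightarrow> bool" where
  "complex_chart X c \<longleftrightarrow>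
     openin X (fst c) \<and> open (snd c ` fst c) \<and>
     homeomorphic_map (subtopology X (fst c)) (top_of_set (snd c ` fst c)) (snd c)"

definition holomorphic_transition :: "'a chart \<Rightarrow> 'a chart \<Rightarrow> bool" where
  "holomorphic_transition c d \<longleftrightarrow> in_chart c (snd d) holomorphic_on snd c ` (fst c \<inter> fst d)"

definition riemann_surface :: "'a topology \<Rightarrow> 'a chart set \<Rightarrow> bool" where
  "riemann_surface X A \<longleftrightarrow>
     Hausdorff_space X \<and> \<Union> (fst ` A) = topspace X \<and>
     (\<forall>c\<in>A. complex_chart X c) \<and> (\<forall>c\<in>A. \<forall>d\<in>A. holomorphic_transition c d)"

text \<open>Membership in the maximal atlas generated by \<open>A\<close>.\<close>

definition compatible_chart :: "'a topology \<Rightarrow> 'a chart set \<Rightarrow> 'a chart \<Rightarrow> bool" where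
  "compatible_chart X A c \<longleftrightarrow>
     complex_chart X c \<and> (\<forall>d\<in>A. holomorphic_transition c d \<and> holomorphic_transition d c)"

definition holomorphic_map ::
    "'a topology \<Rightarrow> 'a chart set \<Rightarrow> 'b topology \<Rightarrow> 'b chart set \<Rightarrow> ('a \<Rightarrow> 'b) \<Rightarrow> bool" where
  "holomorphic_map X A Y B f \<longleftrightarrow>
     continuous_map X Y f \<and>
     (\<forall>c\<in>A. \<forall>d\<in>B. in_chart c (snd d \<circ> f) holomorphic_on snd c ` (fst c \<inter> f -` fst d))"

definition nonconstant_on :: "'a set \<Rightarrow> ('a \<Rightarrow> 'b) \<Rightarrow> bool" where
  "nonconstant_on S f \<longleftrightarrow> \<not> (\<exists>y. \<forall>p\<in>S. f p = y)"

definition map_multiplicity ::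
    "'a chart set \<Rightarrow> 'b chart set \<Rightarrow> ('a \<Rightarrow> 'b) \<Rightarrow> 'a \<Rightarrow> int" where
  "map_multiplicity A B f p =
     (THE n. \<forall>c\<in>A. \<forall>d\<in>B. p \<in> fst c \<and> f p \<in> fst d \<longrightarrow>
        zorder (\<lambda>w. in_chart c (snd d \<circ> f) w - snd d (f p)) (snd c p) = n)"

definition map_degree ::
    "'a topology \<Rightarrow> 'a chart set \<Rightarrow> 'b topology \<Rightarrow> 'b chart set \<Rightarrow> ('a \<Rightarrow> 'b) \<Rightarrow> int" where
  "map_degree X A Y B f =
     (THE n. \<forall>y\<in>topspace Y. (\<Sum>p | p \<in> topspace X \<and> f p = y. map_multiplicity A B f p) = n)"


section \<open>The Riemann sphere\<close>

text \<open>The point at infinity is \<^term>\<open>None\<close>; the two charts are \<open>w\<close> and \<open>1 / w\<close>.\<close>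

definition riemann_sphere :: "complex option topology" where
  "riemann_sphere = Alexandroff_compactification euclidean"

definition affine_chart :: "complex option chart" where
  "affine_chart = (range Some, the)"

definition infinity_chart :: "complex option chart" where
  "infinity_chart = (- {Some 0}, \<lambda>y. case y of None \<Rightarrow> 0 | Some w \<Rightarrow> inverse w)"

definition sphere_atlas :: "complex option chart set" where
  "sphere_atlas = {affine_chart, infinity_chart}"


section \<open>Holomorphic line bundles\<close>

text \<open>
  A line bundle is given by local frames \<open>E i\<close> over open patches, with frame change
  \<open>E j = trans i j * E i\<close>. Accordingly a section \<open>s i * E i\<close> satisfies
  \<open>s i = trans i j * s j\<close>.
\<close>

record ('i, 'a) line_bundle =
  frames :: "'i set"
  patch :: "'i \<Rightarrow> 'a set"
  trans :: "'i \<Rightarrow> 'i \<Rightarrow> 'a \<Rightarrow> complex"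

text \<open>The frame of the chart \<open>c\<close> is \<open>\<partial>/\<partial>c\<close>, and \<open>\<partial>/\<partial>d = (\<partial>c/\<partial>d) \<partial>/\<partial>c\<close>.\<close>

definition tangent_bundle :: "'a chart set \<Rightarrow> ('a chart, 'a) line_bundle" where
  "tangent_bundle A =
     \<lparr> frames = A, patch = fst, trans = (\<lambda>c d. chart_deriv d (snd c)) \<rparr>"

definition pullback_bundle ::
    "'a topology \<Rightarrow> ('a \<Rightarrow> 'b) \<Rightarrow> ('i, 'b) line_bundle \<Rightarrow> ('i, 'a) line_bundle" where
  "pullback_bundle X f L =
     \<lparr> frames = frames L, patch = (\<lambda>i. topspace X \<inter> f -` patch L i),
       trans = (\<lambda>i j. trans L i j \<circ> f) \<rparr>"

text \<open>
  The frame with index \<open>(i, k)\<close> is the morphism taking the frame \<open>i\<close> of \<open>L\<close> to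
  the frame \<open>k\<close> of \<open>M\<close>.
\<close>

definition hom_bundle ::
    "('i, 'a) line_bundle \<Rightarrow> ('k, 'a) line_bundle \<Rightarrow> ('i \<times> 'k, 'a) line_bundle" where
  "hom_bundle L M =
     \<lparr> frames = frames L \<times> frames M, patch = (\<lambda>(i, k). patch L i \<inter> patch M k),
       trans = (\<lambda>(i, k) (i', k') p. trans M k k' p / trans L i i' p) \<rparr>"

text \<open>
  Values of meromorphic objects at single points carry no information, since a pole has
  an arbitrary value. Identities between them are therefore required in punctured
  neighbourhoods only.
\<close>

definition meromorphic_fun :: "'a chart set \<Rightarrow> 'a set \<Rightarrow> ('a \<Rightarrow> complex) \<Rightarrow> bool" where
  "meromorphic_fun A U f \<longleftrightarrow> (\<forall>c\<in>A. in_chart c f meromorphic_on snd c ` (fst c \<inter> U))"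

definition meromorphic_section ::
    "'a topology \<Rightarrow> 'a chart set \<Rightarrow> ('i, 'a) line_bundle \<Rightarrow> ('i \<Rightarrow> 'a \<Rightarrow> complex) \<Rightarrow> bool" where
  "meromorphic_section X A L s \<longleftrightarrow>
     (\<forall>i\<in>frames L. meromorphic_fun A (patch L i) (s i)) \<and>
     (\<forall>i\<in>frames L. \<forall>j\<in>frames L. \<forall>p\<in>patch L i \<inter> patch L j.
        \<forall>\<^sub>F x in atin X p. s i x = trans L i j x * s j x)"

text \<open>
  Not identically zero near any point. On a connected surface this says that the section
  is not identically zero.
\<close>

definition nonzero_section ::
    "'a topology \<Rightarrow> ('i, 'a) line_bundle \<Rightarrow> ('i \<Rightarrow> 'a \<Rightarrow> complex) \<Rightarrow> bool" where
  "nonzero_section X L s \<longleftrightarrow>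
     (\<forall>i\<in>frames L. \<forall>p\<in>patch L i. \<exists>\<^sub>F x in atin X p. s i x \<noteq> 0)"

definition section_order ::
    "'a chart set \<Rightarrow> ('i, 'a) line_bundle \<Rightarrow> ('i \<Rightarrow> 'a \<Rightarrow> complex) \<Rightarrow> 'a \<Rightarrow> int" where
  "section_order A L s p =
     (THE n. \<forall>i\<in>frames L. \<forall>c\<in>A. p \<in> patch L i \<and> p \<in> fst c \<longrightarrow>
        zorder (in_chart c (s i)) (snd c p) = n)"

text \<open>The degree of the divisor of any nonzero meromorphic section.\<close>

definition bundle_degree :: "'a topology \<Rightarrow> 'a chart set \<Rightarrow> ('i, 'a) line_bundle \<Rightarrow> int" where
  "bundle_degree X A L =
     (THE d. \<forall>s. meromorphic_section X A L s \<and> nonzero_section X L s \<longrightarrow>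
        (\<Sum>p | p \<in> topspace X \<and> section_order A L s p \<noteq> 0. section_order A L s p) = d)"

definition holomorphic_frame ::
    "'a topology \<Rightarrow> 'a chart set \<Rightarrow> ('i, 'a) line_bundle \<Rightarrow> 'a set \<Rightarrow> ('i \<Rightarrow> 'a \<Rightarrow> complex) \<Rightarrow> bool"
  where
  "holomorphic_frame X A L W e \<longleftrightarrow>
     openin X W \<and>
     (\<forall>i\<in>frames L. \<forall>c\<in>A. in_chart c (e i) holomorphic_on snd c ` (fst c \<inter> patch L i \<inter> W)) \<and>
     (\<forall>i\<in>frames L. \<forall>p\<in>patch L i \<inter> W. e i p \<noteq> 0) \<and>
     (\<forall>i\<in>frames L. \<forall>j\<in>frames L. \<forall>p\<in>patch L i \<inter> patch L j \<inter> W.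
        e i p = trans L i j p * e j p)"


section \<open>Logarithmic connections and their residues\<close>

text \<open>A one-form is given by its coefficients: in the chart \<open>c\<close> it is \<open>\<eta> c dc\<close>.\<close>

type_synonym 'a one_form = "'a chart \<Rightarrow> 'a \<Rightarrow> complex"

definition differential_form :: "('a \<Rightarrow> complex) \<Rightarrow> 'a one_form" where
  "differential_form f c p = chart_deriv c f p"

definition dlog :: "('a \<Rightarrow> complex) \<Rightarrow> 'a one_form" where
  "dlog g c p = differential_form g c p / g p"

definition logarithmic_form ::
    "'a topology \<Rightarrow> 'a chart set \<Rightarrow> 'a set \<Rightarrow> 'a one_form \<Rightarrow> bool" where
  "logarithmic_form X A U \<eta> \<longleftrightarrow>
     (\<forall>c\<in>A. meromorphic_fun A (U \<inter> fst c) (\<eta> c)) \<and>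
     (\<forall>c\<in>A. \<forall>d\<in>A. \<forall>p\<in>U \<inter> fst c \<inter> fst d.
        \<forall>\<^sub>F x in atin X p. \<eta> d x = \<eta> c x * chart_deriv d (snd c) x) \<and>
     (\<forall>c\<in>A. \<forall>p\<in>U \<inter> fst c.
        \<exists>l. (\<lambda>w. (w - snd c p) * in_chart c (\<eta> c) w) \<midarrow>snd c p\<rightarrow> l)"

text \<open>The operators are \<open>d - \<alpha> i\<close> in the frames \<open>E i\<close>.\<close>

definition logarithmic_connection ::
    "'a topology \<Rightarrow> 'a chart set \<Rightarrow> ('i, 'a) line_bundle \<Rightarrow> ('i \<Rightarrow> 'a one_form) \<Rightarrow> bool" where
  "logarithmic_connection X A L \<alpha> \<longleftrightarrow>
     (\<forall>i\<in>frames L. logarithmic_form X A (patch L i) (\<alpha> i)) \<and>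
     (\<forall>i\<in>frames L. \<forall>j\<in>frames L. \<forall>c\<in>A. \<forall>p\<in>patch L i \<inter> patch L j \<inter> fst c.
        \<forall>\<^sub>F x in atin X p. \<alpha> j c x = \<alpha> i c x - dlog (trans L i j) c x)"

definition section_connection :: "('i \<Rightarrow> 'a \<Rightarrow> complex) \<Rightarrow> 'i \<Rightarrow> 'a one_form" where
  "section_connection s i = dlog (s i)"

definition normalized :: "'a one_form \<Rightarrow> 'a one_form" where
  "normalized \<eta> c p = 2 * \<i> * \<eta> c p"

text \<open>
  The connection form in the frame \<open>e i * E i\<close>. Where \<open>\<alpha>\<close> is a connection it does
  not depend on \<open>i\<close>.
\<close>

definition form_in_frame ::
    "('i \<Rightarrow> 'a one_form) \<Rightarrow> ('i \<Rightarrow> 'a \<Rightarrow> complex) \<Rightarrow> 'i \<Rightarrow> 'a one_form" where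
  "form_in_frame \<alpha> e i c p = \<alpha> i c p - dlog (e i) c p"

definition normalized_residue ::
    "'a topology \<Rightarrow> 'a chart set \<Rightarrow> ('i, 'a) line_bundle \<Rightarrow> ('i \<Rightarrow> 'a one_form) \<Rightarrow> 'a \<Rightarrow> complex"
  where
  "normalized_residue X A L \<alpha> p =
     (THE r. \<forall>W e. holomorphic_frame X A L W e \<and> p \<in> W \<longrightarrow>
        (\<forall>i\<in>frames L. \<forall>c\<in>A. p \<in> patch L i \<and> p \<in> fst c \<longrightarrow>
           residue (in_chart c (normalized (form_in_frame \<alpha> e i) c)) (snd c p) = r))"


section \<open>The relative differential morphism\<close>

text \<open>
  Morphisms of line bundles are sections of the Hom bundle: the coefficient \<open>a (i, k)\<close>
  says that the frame \<open>i\<close> is sent to \<open>a (i, k)\<close> times the frame \<open>k\<close>.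
\<close>

definition map_differential :: "('a \<Rightarrow> 'b) \<Rightarrow> 'a chart \<times> 'b chart \<Rightarrow> 'a \<Rightarrow> complex" where
  "map_differential f = (\<lambda>(c, d). chart_deriv c (snd d \<circ> f))"

definition inverse_morphism :: "('i \<times> 'k \<Rightarrow> 'a \<Rightarrow> complex) \<Rightarrow> 'k \<times> 'i \<Rightarrow> 'a \<Rightarrow> complex" where
  "inverse_morphism a = (\<lambda>(k, i) p. inverse (a (i, k) p))"

text \<open>\<open>M\<close> is the bundle in the middle; any of its frames at \<open>p\<close> gives the same value.\<close>

definition compose_morphism ::
    "('j, 'a) line_bundle \<Rightarrow> ('j \<times> 'k \<Rightarrow> 'a \<Rightarrow> complex) \<Rightarrow> ('i \<times> 'j \<Rightarrow> 'a \<Rightarrow> complex) \<Rightarrow>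
       'i \<times> 'k \<Rightarrow> 'a \<Rightarrow> complex" where
  "compose_morphism M b a =
     (\<lambda>(i, k) p. let j = (SOME j. j \<in> frames M \<and> p \<in> patch M j) in b (j, k) p * a (i, j) p)"

definition relative_bundle ::
    "'a topology \<Rightarrow> ('a \<Rightarrow> complex option) \<Rightarrow> ('a \<Rightarrow> complex option) \<Rightarrow>
       (complex option chart \<times> complex option chart, 'a) line_bundle" where
  "relative_bundle X q z =
     hom_bundle (pullback_bundle X q (tangent_bundle sphere_atlas))
                (pullback_bundle X z (tangent_bundle sphere_atlas))"

definition relative_differential ::
    "'a chart set \<Rightarrow> ('a \<Rightarrow> complex option) \<Rightarrow> ('a \<Rightarrow> complex option) \<Rightarrow>
       complex option chart \<times> complex option chart \<Rightarrow> 'a \<Rightarrow> complex" where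
  "relative_differential A q z =
     compose_morphism (tangent_bundle A) (map_differential z) (inverse_morphism (map_differential q))"


section \<open>Dual conformal nets\<close>

text \<open>The operator \<open>(\<partial>\<^sub>1 - i \<partial>\<^sub>2) / 2\<close> in the real coordinates of the complex plane.\<close>

definition wirtinger :: "(complex \<Rightarrow> complex) \<Rightarrow> complex \<Rightarrow> complex" where
  "wirtinger f w =
     (vector_derivative (\<lambda>t::real. f (w + of_real t)) (at 0)
      - \<i> * vector_derivative (\<lambda>t::real. f (w + \<i> * of_real t)) (at 0)) / 2"

definition net_factor :: "(complex \<Rightarrow> complex) \<Rightarrow> complex \<Rightarrow> real" where
  "net_factor f w = cmod (deriv f w)"

definition dual_net_factor :: "(complex \<Rightarrow> complex) \<Rightarrow> complex \<Rightarrow> real" where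
  "dual_net_factor f w = inverse (net_factor f w)"

definition net_omega :: "(complex \<Rightarrow> complex) \<Rightarrow> complex \<Rightarrow> complex" where
  "net_omega f w =
     - (2 * \<i> / of_real (net_factor f w)) * wirtinger (\<lambda>v. of_real (ln (net_factor f v))) w"

text \<open>Here \<open>\<partial>\<^sub>z = \<partial>\<^sub>q / z\<^sub>q\<close>; the argument \<open>w\<close> is the value of \<open>q\<close>.\<close>

definition dual_net_omega :: "(complex \<Rightarrow> complex) \<Rightarrow> complex \<Rightarrow> complex" where
  "dual_net_omega f w =
     - (2 * \<i> / of_real (dual_net_factor f w)) *
       (inverse (deriv f w) * wirtinger (\<lambda>v. of_real (ln (dual_net_factor f v))) w)"

text \<open>The function \<open>z = z(q)\<close> on a domain \<open>U\<close> where \<open>q\<close> is a coordinate.\<close>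

definition net_function ::
    "('a \<Rightarrow> complex option) \<Rightarrow> ('a \<Rightarrow> complex option) \<Rightarrow> 'a set \<Rightarrow> complex \<Rightarrow> complex" where
  "net_function q z U = in_chart (U, the \<circ> q) (the \<circ> z)"

definition net_domain ::
    "'a topology \<Rightarrow> 'a chart set \<Rightarrow> ('a \<Rightarrow> complex option) \<Rightarrow> ('a \<Rightarrow> complex option) \<Rightarrow> 'a set \<Rightarrow> bool"
  where
  "net_domain X A q z U \<longleftrightarrow>
     None \<notin> q ` U \<and> None \<notin> z ` U \<and> compatible_chart X A (U, the \<circ> q) \<and>
     net_function q z U holomorphic_on (the \<circ> q) ` U \<and>
     (\<forall>w\<in>(the \<circ> q) ` U. deriv (net_function q z U) w \<noteq> 0)"

definition net_form ::
    "('a \<Rightarrow> complex option) \<Rightarrow> ('a \<Rightarrow> complex option) \<Rightarrow> 'a set \<Rightarrow> 'a one_form" where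
  "net_form q z U c p =
     (let f = net_function q z U; w = the (q p); H = complex_of_real (net_factor f w) in
        1 / H * dual_net_omega f w * differential_form (the \<circ> z) c p
        - H * net_omega f w * differential_form (the \<circ> q) c p)"

definition net_realization ::
    "'a topology \<Rightarrow> 'a chart set \<Rightarrow> ('a \<Rightarrow> complex option) \<Rightarrow> ('a \<Rightarrow> complex option) \<Rightarrow> 'a set \<Rightarrow> bool"
  where
  "net_realization X A q z S \<longleftrightarrow>
     S \<subseteq> topspace X \<and> finite S \<and>
     (\<forall>p\<in>topspace X - S. \<exists>U. p \<in> U \<and> U \<subseteq> topspace X - S \<and> net_domain X A q z U)"

text \<open>
  The index \<open>(affine_chart, affine_chart)\<close> is the coordinate frame \<open>\<partial>/\<partial>z \<otimes> dq\<close>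
  of the relative bundle. The connection extends the net form from the complement
  of \<open>S\<close>.
\<close>

definition extends_net_form ::
    "'a topology \<Rightarrow> 'a chart set \<Rightarrow> ('a \<Rightarrow> complex option) \<Rightarrow> ('a \<Rightarrow> complex option) \<Rightarrow> 'a set \<Rightarrow>
       (complex option chart \<times> complex option chart \<Rightarrow> 'a one_form) \<Rightarrow> bool" where
  "extends_net_form X A q z S \<alpha> \<longleftrightarrow>
     logarithmic_connection X A (relative_bundle X q z) \<alpha> \<and>
     (\<forall>U. U \<subseteq> topspace X - S \<and> net_domain X A q z U \<longrightarrow>
        (\<forall>p\<in>U. \<forall>c\<in>A. p \<in> fst c \<longrightarrow>
           normalized (\<alpha> (affine_chart, affine_chart)) c p = net_form q z U c p))"

end

theory Submission
  imports Defs
begin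

text \<open>
  The connection determined by a meromorphic section \<open>s\<close> has the form \<open>d log s\<close> in a holomorphic
  frame, and the residue of a logarithmic derivative is an order. So the normalized residue at \<open>p\<close> is
  \<open>2 \<i>\<close> times the order of the section at \<open>p\<close>, and the sum of the residues is \<open>2 \<i>\<close> times the degree of
  the divisor of the section (\<open>normalized_residue_section_connection\<close>).

  Everything else is a comparison of divisors, which rests on a single global fact: the orders of a
  nonzero meromorphic function \<open>f\<close> on a compact connected surface sum to zero (\<open>sum_orders_eq_0\<close>). The
  proof needs neither integration over the surface nor a triangulation. The functions
  \<open>(1 - t) f + t\<close> join \<open>f\<close> to the constant \<open>1\<close>. By the theorem of Rouche the total order of the zeros
  and poles in a small disc is locally constant in \<open>t\<close> (\<open>zorder_pencil_constant\<close>), and compactness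
  makes the total order on the surface locally constant in \<open>t\<close>.

  The fact is used twice. Applied to \<open>F - a\<close> for a map \<open>F\<close> to the sphere, it shows that the fibres over
  \<open>a\<close> and over infinity have the same number of points counted with multiplicity, so the degree of \<open>F\<close> is
  well defined and is its number of poles (\<open>fiber_sum_constant\<close>). Applied to the quotient of two
  sections, it shows that the degree of a line bundle may be computed from any section. For the
  relative bundle the coordinate frame \<open>\<partial>/\<partial>z \<otimes> dq\<close> is such a section. Since \<open>\<partial>/\<partial>w\<close> has a double zero at
  infinity on the sphere, its divisor is twice the polar divisor of \<open>z\<close> minus twice that of \<open>q\<close>, and the
  degree is \<open>2 (deg z - deg q)\<close> (\<open>sum_orders_relative_section\<close>).

  For the dual conformal nets a local computation shows that the net form equals \<open>2 \<i> d log (dz/dq)\<close>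
  (\<open>dual_net_coefficients\<close>), which is the normalized form of the connection in the coordinate frame. A
  logarithmic connection with these values off a finite set agrees in a punctured neighbourhood of
  every point with the one determined by the relative differential
  (\<open>logarithmic_connection_determined\<close>), and therefore has the same residues.
\<close>

section \<open>Meromorphic functions of one variable\<close>

lemma meromorphic_at_dichotomy:
  assumes "f meromorphic_on {w}"
  shows "(\<forall>\<^sub>F x in at w. f x = 0) \<or> (\<forall>\<^sub>F x in at w. f x \<noteq> 0)"
  using assms not_essential_frequently_0_imp_eventually_0[of f w]
  by (auto simp: meromorphic_at_iff frequently_def)

lemma meromorphic_eventually_analytic:
  assumes "f meromorphic_on {w}"
  shows "\<forall>\<^sub>F x in at w. f analytic_on {x}"
  using assms by (auto simp: meromorphic_at_iff isolated_singularity_at_altdef)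

text \<open>
  Since \<open>deriv T w \<noteq> 0\<close>, the function \<open>T - T w\<close> has a simple zero at \<open>w\<close>, so composition
  with \<open>T\<close> multiplies orders by one. This makes the order of a function independent of the chart.
\<close>

lemma zorder_compose_locally_injective:
  assumes "f meromorphic_on {T w}" "\<forall>\<^sub>F x in at (T w). f x \<noteq> 0"
    and T: "T analytic_on {w}" "deriv T w \<noteq> 0"
  shows "zorder (\<lambda>x. f (T x)) w = zorder f (T w)"
proof -
  obtain S where S: "open S" "w \<in> S" "T holomorphic_on S"
    using T(1) analytic_at by blast
  have z1: "zorder (\<lambda>x. T x - T w) w = 1"
  proof (rule zorder_zero_eqI[of _ S])
    show "(deriv ^^ nat 1) (\<lambda>x. T x - T w) w \<noteq> 0"
    proof -
      have "T field_differentiable at w"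
        using T(1) analytic_on_imp_differentiable_at by blast
      then show ?thesis using T(2) by (simp add: deriv_diff)
    qed
  qed (use S in \<open>auto intro!: holomorphic_intros\<close>)
  have ne: "\<forall>\<^sub>F x in at w. T x \<noteq> T w"
  proof -
    have "\<not> (\<forall>\<^sub>F x in at w. T x - T w = 0)"
    proof
      assume "\<forall>\<^sub>F x in at w. T x - T w = 0"
      then have "\<forall>\<^sub>F x in nhds w. T x = T w"
        by (auto simp: eventually_at_filter elim: eventually_mono)
      then have "deriv T w = deriv (\<lambda>_. T w) w"
        by (intro deriv_cong_ev) auto
      then show False using T(2) by simp
    qed
    moreover have "(\<lambda>x. T x - T w) meromorphic_on {w}"
      using T(1) by (intro analytic_on_imp_meromorphic_on analytic_intros)
    ultimately show ?thesis using meromorphic_at_dichotomy by fastforce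
  qed
  have "zorder (f \<circ> T) w = zorder f (T w) * zorder (\<lambda>x. T x - T w) w"
    using assms ne by (intro zorder_compose') (auto simp: meromorphic_at_iff)
  then show ?thesis using z1 by (simp add: o_def)
qed

text \<open>
  With \<open>f x = h x * (x - w) powi n\<close> and \<open>h w \<noteq> 0\<close> the logarithmic derivative is
  \<open>deriv h x / h x + n / (x - w)\<close>, whose first summand is holomorphic.
\<close>

lemma logarithmic_derivative_normal_form:
  assumes "f meromorphic_on {w}" "\<forall>\<^sub>F x in at w. f x \<noteq> 0"
  obtains k S where "open S" "w \<in> S" "k holomorphic_on S" "k w = of_int (zorder f w)"
    "\<And>x. x \<in> S - {w} \<Longrightarrow> deriv f x / f x = k x / (x - w)"
proof -
  define n where "n = zorder f w"
  define h where "h = zor_poly f w"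
  have "\<exists>\<^sub>F x in at w. f x \<noteq> 0" using assms(2) by (simp add: eventually_frequently)
  then obtain r where r: "r > 0" "h holomorphic_on cball w r" "h w \<noteq> 0"
      "\<And>x. x \<in> cball w r - {w} \<Longrightarrow> f x = h x * (x - w) powi n \<and> h x \<noteq> 0"
    using zorder_exist[of f w] assms unfolding n_def h_def meromorphic_at_iff by blast
  have hol: "h holomorphic_on ball w r"
    using r(2) by (rule holomorphic_on_subset) auto
  define k where "k = (\<lambda>x. deriv h x / h x * (x - w) + of_int n)"
  show ?thesis
  proof (rule that[of "ball w r" k])
    have "h x \<noteq> 0" if "x \<in> ball w r" for x using r(3) r(4)[of x] that by (cases "x = w") auto
    then show "k holomorphic_on ball w r"
      unfolding k_def by (intro holomorphic_intros holomorphic_deriv hol) auto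
    show "k w = of_int (zorder f w)" by (simp add: k_def n_def)
    fix x assume x: "x \<in> ball w r - {w}"
    have "(h has_field_derivative deriv h x) (at x)"
      using hol x by (intro holomorphic_derivI[of _ "ball w r"]) auto
    then have "((\<lambda>x. h x * (x - w) powi n) has_field_derivative
        (deriv h x * (x - w) powi n + h x * (of_int n * (x - w) powi (n - 1)))) (at x)"
      using x by (auto intro!: derivative_eq_intros)
    moreover have "\<forall>\<^sub>F y in nhds x. f y = h y * (y - w) powi n"
    proof -
      have "\<forall>\<^sub>F y in nhds x. y \<in> ball w r - {w}"
        using x by (intro eventually_nhds_in_open) auto
      then show ?thesis by eventually_elim (use r(4) in auto)
    qed
    ultimately have "(f has_field_derivative
        (deriv h x * (x - w) powi n + h x * (of_int n * (x - w) powi (n - 1)))) (at x)"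
      by (subst DERIV_cong_ev) auto
    then have "deriv f x = deriv h x * (x - w) powi n + h x * (of_int n * (x - w) powi (n - 1))"
      by (rule DERIV_imp_deriv)
    moreover have "f x = h x * (x - w) powi n" "h x \<noteq> 0" "x - w \<noteq> 0" using r(4)[of x] x by auto
    moreover have "(a * P + b * (N * (P / u))) / (b * P) = (a / b * u + N) / u"
      if "b \<noteq> 0" "u \<noteq> 0" "P \<noteq> 0" for a b P N u :: complex
      using that by (simp add: field_simps)
    ultimately show "deriv f x / f x = k x / (x - w)"
      by (simp add: k_def power_int_diff)
  qed (use r in auto)
qed

lemma residue_logarithmic_derivative:
  assumes "f meromorphic_on {w}" "\<forall>\<^sub>F x in at w. f x \<noteq> 0"
  shows "residue (\<lambda>x. a * (deriv f x / f x)) w = a * of_int (zorder f w)"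
    and "(\<lambda>x. (x - w) * (deriv f x / f x)) \<midarrow>w\<rightarrow> of_int (zorder f w)"
proof -
  obtain k S where k: "open S" "w \<in> S" "k holomorphic_on S" "k w = of_int (zorder f w)"
    "\<And>x. x \<in> S - {w} \<Longrightarrow> deriv f x / f x = k x / (x - w)"
    using logarithmic_derivative_normal_form[OF assms] by (metis (no_types))
  have ev: "\<forall>\<^sub>F x in at w. x \<in> S - {w}"
    using k(1,2) eventually_at_in_open by blast
  have "residue (\<lambda>x. a * (deriv f x / f x)) w = residue (\<lambda>x. (a * k x) / (x - w)) w"
    by (intro residue_cong eventually_mono[OF ev]) (auto simp: k(5))
  also have "\<dots> = a * k w"
    using k(1-3) by (intro residue_simple holomorphic_intros)
  finally show "residue (\<lambda>x. a * (deriv f x / f x)) w = a * of_int (zorder f w)" using k by simp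
  have "k \<midarrow>w\<rightarrow> k w"
    using k by (metis continuous_on_eq_continuous_at holomorphic_on_imp_continuous_on isContD)
  moreover have "\<forall>\<^sub>F x in at w. k x = (x - w) * (deriv f x / f x)"
    using ev by eventually_elim (use k(5) in auto)
  ultimately show "(\<lambda>x. (x - w) * (deriv f x / f x)) \<midarrow>w\<rightarrow> of_int (zorder f w)"
    using k(4) by (auto intro: Lim_transform_eventually)
qed

text \<open>
  Locally \<open>ln (cmod g)\<close> is the real part of a branch of \<open>log g\<close>, so its derivative in the
  direction \<open>u\<close> is \<open>Re (u * g' / g)\<close>. Combining the directions \<open>1\<close> and \<open>\<i>\<close> gives half of the
  complex derivative of \<open>log g\<close>.
\<close>

lemma wirtinger_ln_cmod:
  assumes "g analytic_on {w}" "g w \<noteq> 0"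
  shows "wirtinger (\<lambda>v. of_real (ln (cmod (g v)))) w = deriv g w / (2 * g w)"
proof -
  have dg: "(g has_field_derivative deriv g w) (at w)"
    using assms(1) analytic_on_imp_differentiable_at DERIV_deriv_iff_field_differentiable by blast
  have dir: "vector_derivative (\<lambda>t::real. complex_of_real (ln (cmod (g (w + u * of_real t))))) (at 0)
       = of_real (Re (u * deriv g w / g w))" for u
  proof -
    have "((\<lambda>t::real. g (w + u * of_real t)) has_vector_derivative (u * deriv g w)) (at 0)"
      using dg by (auto intro!: derivative_eq_intros field_vector_diff_chain_at[of "\<lambda>t. w + u * of_real t" u 0 g, unfolded o_def])
    then have d1: "((\<lambda>t::real. g (w + u * of_real t)) has_derivative (\<lambda>h. h *\<^sub>R (u * deriv g w))) (at 0)"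
      by (simp add: has_vector_derivative_def)
    have "((\<lambda>t::real. norm (g (w + u * of_real t))) has_derivative
        (\<lambda>h. sgn (g w) \<bullet> (h *\<^sub>R (u * deriv g w)))) (at 0)"
      using has_derivative_compose[OF d1, of norm "\<lambda>h. h \<bullet> sgn (g w)"] has_derivative_norm[of "g w"] assms(2)
      by (simp add: inner_commute)
    then have "((\<lambda>t::real. norm (g (w + u * of_real t))) has_real_derivative
        (sgn (g w) \<bullet> (u * deriv g w))) (at 0)"
      by (simp add: has_field_derivative_def mult.commute[of _ "(sgn (g w) \<bullet> (u * deriv g w))"] mult_commute_abs)
    then have "((\<lambda>t::real. ln (norm (g (w + u * of_real t)))) has_real_derivative
        (inverse (norm (g w)) * (sgn (g w) \<bullet> (u * deriv g w)))) (at 0)"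
      using assms(2) by (auto intro!: derivative_eq_intros simp: divide_inverse mult_ac)
    also have "inverse (norm (g w)) * (sgn (g w) \<bullet> (u * deriv g w)) = Re (u * deriv g w / g w)"
    proof -
      have "inverse (norm (g w)) * (sgn (g w) \<bullet> (u * deriv g w)) = (g w \<bullet> (u * deriv g w)) / (norm (g w))\<^sup>2"
        by (simp add: sgn_div_norm power2_eq_square divide_simps)
      also have "\<dots> = Re (u * deriv g w / g w)"
        by (simp add: inner_complex_def Re_divide cmod_power2 algebra_simps)
      finally show ?thesis .
    qed
    finally have "((\<lambda>t::real. complex_of_real (ln (cmod (g (w + u * of_real t))))) has_vector_derivative
        of_real (Re (u * deriv g w / g w))) (at 0)"
      by (metis has_real_derivative_iff_has_vector_derivative has_vector_derivative_of_real)
    then show ?thesis by (rule vector_derivative_at)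
  qed
  have "wirtinger (\<lambda>v. of_real (ln (cmod (g v)))) w
      = (of_real (Re (deriv g w / g w)) - \<i> * of_real (Re (\<i> * deriv g w / g w))) / 2"
    using dir[of 1] dir[of \<i>] by (simp add: wirtinger_def)
  also have "\<dots> = deriv g w / g w / 2"
  proof -
    have "Re (\<i> * deriv g w / g w) = - Im (deriv g w / g w)"
      by (metis Re_i_times times_divide_eq_right)
    then have "of_real (Re (deriv g w / g w)) - \<i> * of_real (Re (\<i> * deriv g w / g w)) = deriv g w / g w"
      by (simp only: complex_eq_iff) simp
    then show ?thesis by simp
  qed
  finally show ?thesis by (simp add: field_simps)
qed

text \<open>
  The zeros and poles of \<open>g t = (1 - t) f + t\<close> in a small disc move with \<open>t\<close>, but their total
  order does not change. After multiplication by a power of \<open>w - w0\<close> that clears the pole of \<open>f\<close>,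
  the pencil becomes holomorphic for all \<open>t\<close> at once, and the theorem of Rouche counts its zeros. The
  pole order of \<open>f\<close>, rather than that of \<open>g t0\<close>, has to be cleared: for \<open>t\<close> near \<open>1\<close> the pole of
  \<open>f\<close> is accompanied by nearby zeros, with which it cancels at \<open>t = 1\<close>. The last conclusion concerns
  points where nothing can cancel: there all orders are nonnegative and sum to zero.
\<close>

lemma zorder_pencil_constant:
  fixes f :: "complex \<Rightarrow> complex" and t0 :: real
  defines "g \<equiv> \<lambda>(t::real) w. (1 - of_real t) * f w + of_real t"
  assumes mero: "f meromorphic_on {w0}" and nonconst: "\<And>a. \<forall>\<^sub>F w in at w0. f w \<noteq> a" and "e > 0"
  obtains r \<delta> where "0 < r" "r < e" "\<delta> > 0"
    "\<And>t. \<bar>t - t0\<bar> < \<delta> \<Longrightarrow> finite {w \<in> ball w0 r. zorder (g t) w \<noteq> 0}"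
    "\<And>t. \<bar>t - t0\<bar> < \<delta> \<Longrightarrow>
       (\<Sum>w | w \<in> ball w0 r \<and> zorder (g t) w \<noteq> 0. zorder (g t) w) = zorder (g t0) w0"
    "\<And>t w. \<bar>t - t0\<bar> < \<delta> \<Longrightarrow> 0 \<le> zorder f w0 \<Longrightarrow> zorder (g t0) w0 = 0 \<Longrightarrow> w \<in> ball w0 r \<Longrightarrow>
       zorder (g t) w = 0"
proof -
  define m where "m = zorder f w0"
  define n where "n = nat (- m)"
  define p where "p = zor_poly f w0"
  have "\<exists>\<^sub>F x in at w0. f x \<noteq> 0" using nonconst[of 0] by (simp add: eventually_frequently)
  then obtain r1 where r1: "r1 > 0" "p holomorphic_on cball w0 r1"
      "\<And>x. x \<in> cball w0 r1 - {w0} \<Longrightarrow> f x = p x * (x - w0) powi m \<and> p x \<noteq> 0"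
    using zorder_exist[of f w0] mero unfolding m_def p_def meromorphic_at_iff by blast
  define h where "h = (\<lambda>w. p w * (w - w0) ^ nat m)"
  \<comment> \<open>On the punctured disc \<open>f = h / (w - w0) ^ n\<close> and \<open>g t = G t / (w - w0) ^ n\<close>.\<close>
  define G where "G = (\<lambda>(t::real) w. (1 - of_real t) * h w + of_real t * (w - w0) ^ n)"
  have hol_h: "h holomorphic_on ball w0 r1"
    unfolding h_def by (intro holomorphic_intros holomorphic_on_subset[OF r1(2)]) auto
  have hol_G: "G t holomorphic_on ball w0 r1" for t
    unfolding G_def by (intro holomorphic_intros hol_h)
  have g_eq: "g t w = G t w / (w - w0) ^ n" if "w \<in> ball w0 r1 - {w0}" for t w
  proof -
    have "(w - w0) powi m = (w - w0) ^ nat m / (w - w0) ^ n"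
      by (cases "m \<ge> 0") (auto simp: n_def power_int_def field_simps)
    then have "f w = h w / (w - w0) ^ n" using r1(3)[of w] that by (auto simp: h_def)
    then show ?thesis using that by (simp add: g_def G_def field_simps)
  qed
  have g_ne: "\<forall>\<^sub>F w in at w0. g t w \<noteq> 0" for t
  proof (cases "t = 1")
    case False
    show ?thesis using nonconst[of "- of_real t / (1 - of_real t)"]
    proof eventually_elim
      case (elim w)
      have "(1 - complex_of_real t) \<noteq> 0" using False by (metis eq_iff_diff_eq_0 of_real_1 of_real_eq_iff)
      then show ?case using elim by (auto simp: g_def field_simps add_eq_0_iff)
    qed
  qed (simp add: g_def)
  have in_ball: "\<forall>\<^sub>F w in at w0. w \<in> ball w0 r1 - {w0}"
    using r1(1) eventually_at_in_open[of "ball w0 r1" w0] by simp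
  have G_ne: "\<forall>\<^sub>F w in at w0. G t w \<noteq> 0" for t
    using g_ne[of t] in_ball by eventually_elim (use g_eq in auto)
  obtain r0 where r0: "r0 > 0" "\<And>w. w \<noteq> w0 \<Longrightarrow> dist w w0 < r0 \<Longrightarrow> G t0 w \<noteq> 0"
    using G_ne[of t0] by (auto simp: eventually_at)
  \<comment> \<open>On the circle of radius \<open>r\<close> about \<open>w0\<close>, the function \<open>G t0\<close> has no zeros.\<close>
  define r where "r = min (min r0 r1) e / 2"
  have r: "0 < r" "r < e" "r < r1" "r < r0" using r0 r1 \<open>e > 0\<close> by (auto simp: r_def)
  define r2 where "r2 = (r + r1) / 2"
  have r2: "r < r2" "r2 < r1" using r by (auto simp: r2_def)
  have nz: "\<exists>w\<in>ball w0 r1. G t w \<noteq> 0" for t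
    using eventually_happens[OF eventually_conj[OF G_ne[of t] in_ball]] by auto
  have fin: "finite {w \<in> ball w0 r2. G t w = 0}" for t
  proof -
    have "finite {w \<in> cball w0 r2. G t w = 0}"
    proof (cases "G t constant_on ball w0 r1")
      case True
      then have "G t w \<noteq> 0" if "w \<in> cball w0 r2" for w
        using nz[of t] r2 that unfolding constant_on_def by force
      then show ?thesis by (auto intro: finite_subset[of _ "{}"])
    next
      case False
      then show ?thesis
        using r2 by (intro holomorphic_compact_finite_zeros[of _ "ball w0 r1"] hol_G) auto
    qed
    then show ?thesis by (rule finite_subset[rotated]) auto
  qed
  have freq: "\<exists>\<^sub>F x in at w. G t x \<noteq> 0" if "w \<in> ball w0 r2" for t w
  proof -
    have "\<forall>\<^sub>F x in at w. x \<in> ball w0 r2 - {w}"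
      using that by (intro eventually_at_in_open) auto
    moreover have "\<forall>\<^sub>F x in at w. x \<notin> {w \<in> ball w0 r2. G t w = 0} - {w}"
    proof -
      have "open (- ({w \<in> ball w0 r2. G t w = 0} - {w}))" using fin[of t] finite_imp_closed by (meson finite_Diff open_Compl)
      then show ?thesis
        by (smt (verit, ccfv_SIG) ComplD ComplI DiffD2 eventually_at_topological insertCI)
    qed
    ultimately have "\<forall>\<^sub>F x in at w. G t x \<noteq> 0" by eventually_elim auto
    then show ?thesis by (simp add: eventually_frequently)
  qed
  have anG: "G t analytic_on {w}" if "w \<in> ball w0 r1" for t w
    using hol_G[of t] that analytic_at by (metis open_ball)
  have ord_g: "zorder (g t) w = zorder (G t) w - (if w = w0 then int n else 0)"
    if w: "w \<in> ball w0 r" for t w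
  proof -
    have w': "w \<in> ball w0 r1" "w \<in> ball w0 r2" using w r r2 by auto
    have "\<forall>\<^sub>F x in at w. x \<in> ball w0 r1 - {w0}"
    proof (cases "w = w0")
      case False
      then show ?thesis using w' by (intro eventually_at_in_open') auto
    qed (use in_ball in simp)
    then have "\<forall>\<^sub>F x in at w. g t x = G t x / (x - w0) ^ n"
      by eventually_elim (use g_eq in auto)
    then have "zorder (g t) w = zorder (\<lambda>x. G t x / (x - w0) ^ n) w"
      by (intro zorder_cong refl)
    also have "\<dots> = zorder (G t) w - zorder (\<lambda>x. (x - w0) ^ n) w"
    proof (rule zorder_divide)
      show "G t meromorphic_on {w}" using anG[OF w'(1)] by (rule analytic_on_imp_meromorphic_on)
      show "(\<lambda>x. (x - w0) ^ n) meromorphic_on {w}" by (intro meromorphic_intros)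
      have "\<forall>\<^sub>F x in at w. x \<noteq> w0" 
        by (cases "w = w0") (auto intro: eventually_neq_at_within)
      then have "\<forall>\<^sub>F x in at w. (x - w0) ^ n \<noteq> 0" by eventually_elim auto
      then show "\<exists>\<^sub>F x in at w. (x - w0) ^ n \<noteq> 0" by (simp add: eventually_frequently)
    qed (use freq w' in auto)
    also have "zorder (\<lambda>x. (x - w0) ^ n) w = (if w = w0 then int n else 0)"
    proof (cases "w = w0")
      case True
      then show ?thesis by (auto intro!: zorder_eqI[of UNIV _ "\<lambda>_. 1"])
    next
      case False
      then show ?thesis by (auto intro!: zorder_eq_0I analytic_intros)
    qed
    finally show ?thesis .
  qed
  have ord_G0: "zorder (G t) w = 0 \<longleftrightarrow> G t w \<noteq> 0" "zorder (G t) w \<ge> 0" if "w \<in> ball w0 r2" for t w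
    using that freq[OF that, of t] anG[of w t] r2 zorder_eq_0_iff zorder_ge_0 by auto
  define Zs where "Zs = (\<lambda>t. {w \<in> ball w0 r. G t w = 0})"
  have finZ: "finite (Zs t)" for t
    using fin[of t] r2 by (auto simp: Zs_def elim!: finite_subset[rotated])
  have total: "finite {w \<in> ball w0 r. zorder (g t) w \<noteq> 0}"
      "(\<Sum>w | w \<in> ball w0 r \<and> zorder (g t) w \<noteq> 0. zorder (g t) w) = (\<Sum>w\<in>Zs t. zorder (G t) w) - int n" for t
  proof -
    have sub: "{w \<in> ball w0 r. zorder (g t) w \<noteq> 0} \<subseteq> insert w0 (Zs t)"
      using ord_g[of _ t] ord_G0(1)[of _ t] r2 by (auto simp: Zs_def)
    then show "finite {w \<in> ball w0 r. zorder (g t) w \<noteq> 0}"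
      using finZ finite_subset by blast
    have w0: "w0 \<in> ball w0 r" using r by auto
    have "(\<Sum>w | w \<in> ball w0 r \<and> zorder (g t) w \<noteq> 0. zorder (g t) w)
        = (\<Sum>w\<in>insert w0 (Zs t). zorder (g t) w)"
      using sub finZ w0 by (intro sum.mono_neutral_left) (auto simp: Zs_def)
    also have "\<dots> = (\<Sum>w\<in>insert w0 (Zs t). zorder (G t) w - (if w = w0 then int n else 0))"
      using ord_g w0 by (intro sum.cong refl) (auto simp: Zs_def)
    also have "\<dots> = (\<Sum>w\<in>insert w0 (Zs t). zorder (G t) w) - int n"
      using finZ by (simp add: sum_subtractf)
    also have "(\<Sum>w\<in>insert w0 (Zs t). zorder (G t) w) = (\<Sum>w\<in>Zs t. zorder (G t) w)"
      using finZ w0 ord_G0(1)[of w0 t] r r2 by (intro sum.mono_neutral_right) (auto simp: Zs_def)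
    finally show "(\<Sum>w | w \<in> ball w0 r \<and> zorder (g t) w \<noteq> 0. zorder (g t) w) = (\<Sum>w\<in>Zs t. zorder (G t) w) - int n" .
  qed
  define k where "k = (\<lambda>w. (w - w0) ^ n - h w)"
  have G_diff: "G t w = G t0 w + of_real (t - t0) * k w" for t w
    by (simp add: G_def k_def algebra_simps)
  have cont: "continuous_on (sphere w0 r) k" "continuous_on (sphere w0 r) (G t0)"
    unfolding k_def using r
    by (intro continuous_intros holomorphic_on_imp_continuous_on holomorphic_on_subset[OF hol_h] 
        holomorphic_on_subset[OF hol_G]; auto)+
  obtain M where M: "\<And>w. w \<in> sphere w0 r \<Longrightarrow> norm (k w) \<le> M" "M > 0"
    using compact_continuous_image[OF cont(1) compact_sphere, THEN compact_imp_bounded]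
    unfolding bounded_pos by blast
  obtain c where c: "c > 0" "\<And>w. w \<in> sphere w0 r \<Longrightarrow> norm (G t0 w) \<ge> c"
  proof -
    have "\<exists>x\<in>sphere w0 r. \<forall>y\<in>sphere w0 r. norm (G t0 x) \<le> norm (G t0 y)"
      using r cont(2) by (intro continuous_attains_inf) (auto intro!: continuous_intros)
    then obtain x where x: "x \<in> sphere w0 r" "\<And>y. y \<in> sphere w0 r \<Longrightarrow> norm (G t0 x) \<le> norm (G t0 y)"
      by blast
    show ?thesis
      by (rule that[of "norm (G t0 x)"]) (use x r r0(2)[of x] in \<open>auto simp: dist_commute\<close>)
  qed
  \<comment> \<open>For \<open>\<bar>t - t0\<bar> < \<delta>\<close> the perturbation \<open>(t - t0) k\<close> is smaller than \<open>G t0\<close> on the circle.\<close>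
  define \<delta> where "\<delta> = c / M"
  have count: "(\<Sum>w\<in>Zs t. zorder (G t) w) = (\<Sum>w\<in>Zs t0. zorder (G t0) w)" if t: "\<bar>t - t0\<bar> < \<delta>" for t
  proof -
    let ?\<gamma> = "circlepath w0 r" and ?s = "ball w0 r2"
    have small: "cmod (G t0 w) > cmod (of_real (t - t0) * k w)" if "w \<in> sphere w0 r" for w
    proof -
      have "cmod (of_real (t - t0) * k w) \<le> \<bar>t - t0\<bar> * M"
        using M(1)[OF that] by (simp add: norm_mult mult_left_mono del: of_real_diff)
      also have "\<dots> < c" using t M(2) by (simp add: \<delta>_def field_simps)
      finally show ?thesis using c(2)[OF that] by simp
    qed
    have rou: "(\<Sum>p | p \<in> ?s \<and> G t0 p + of_real (t - t0) * k p = 0.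
          winding_number ?\<gamma> p * zorder (\<lambda>p. G t0 p + of_real (t - t0) * k p) p) =
        (\<Sum>p | p \<in> ?s \<and> G t0 p = 0. winding_number ?\<gamma> p * zorder (G t0) p)"
    proof (rule Rouche_theorem)
      show "finite {p \<in> ?s. G t0 p + of_real (t - t0) * k p = 0}"
        using fin[of t] by (simp add: G_diff[of t])
      show "\<forall>z. z \<notin> ball w0 r2 \<longrightarrow> winding_number (circlepath w0 r) z = 0"
        using r r2 by (intro allI impI winding_number_zero_outside[of _ "cball w0 r"]) auto
    qed (use r r2 small fin[of t0] in \<open>auto simp: k_def intro!: holomorphic_intros 
           holomorphic_on_subset[OF hol_G] holomorphic_on_subset[OF hol_h]\<close>)
    have nsph: "G t p \<noteq> 0" if "p \<in> sphere w0 r" "\<bar>t - t0\<bar> < \<delta>" 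
      "cmod (G t0 p) > cmod (of_real (t - t0) * k p)" for p t
      using that by (metis G_diff add_eq_0_iff less_irrefl norm_minus_cancel)
    have res: "(\<Sum>p | p \<in> ?s \<and> G t' p = 0. winding_number ?\<gamma> p * zorder (G t') p)
        = of_int (\<Sum>w\<in>Zs t'. zorder (G t') w)" if "\<And>p. p \<in> sphere w0 r \<Longrightarrow> G t' p \<noteq> 0" for t'
    proof -
      have "(\<Sum>p | p \<in> ?s \<and> G t' p = 0. winding_number ?\<gamma> p * zorder (G t') p)
        = (\<Sum>p \<in> Zs t'. winding_number ?\<gamma> p * zorder (G t') p)"
      proof (rule sum.mono_neutral_right[OF fin])
        show "\<forall>i\<in>{p \<in> ?s. G t' p = 0} - Zs t'. winding_number ?\<gamma> i * of_int (zorder (G t') i) = 0"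
        proof
          fix p assume p: "p \<in> {p \<in> ?s. G t' p = 0} - Zs t'"
          then have "p \<notin> cball w0 r" using that[of p] by (auto simp: Zs_def)
          then have "winding_number ?\<gamma> p = 0"
            using r by (intro winding_number_zero_outside[of _ "cball w0 r"]) auto
          then show "winding_number ?\<gamma> p * of_int (zorder (G t') p) = 0" by simp
        qed
      qed (use r2 in \<open>auto simp: Zs_def\<close>)
      also have "\<dots> = (\<Sum>p \<in> Zs t'. of_int (zorder (G t') p))"
      proof (rule sum.cong[OF refl])
        fix p assume "p \<in> Zs t'"
        then have "winding_number ?\<gamma> p = 1"
          by (intro winding_number_circlepath) (auto simp: Zs_def dist_norm norm_minus_commute)
        then show "winding_number ?\<gamma> p * of_int (zorder (G t') p) = of_int (zorder (G t') p)" by simp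
      qed
      finally show ?thesis by simp
    qed
    have "complex_of_int (\<Sum>w\<in>Zs t. zorder (G t) w) = of_int (\<Sum>w\<in>Zs t0. zorder (G t0) w)"
    proof -
      have "G t p \<noteq> 0" if "p \<in> sphere w0 r" for p
        using nsph[OF that t small[OF that]] .
      moreover have "G t0 p \<noteq> 0" if "p \<in> sphere w0 r" for p
        using that c by fastforce
      moreover have "(\<Sum>p | p \<in> ?s \<and> G t p = 0. winding_number ?\<gamma> p * zorder (G t) p)
          = (\<Sum>p | p \<in> ?s \<and> G t0 p = 0. winding_number ?\<gamma> p * zorder (G t0) p)"
      proof -
        have "G t = (\<lambda>p. G t0 p + of_real (t - t0) * k p)" using G_diff by blast
        then show ?thesis using rou by simp
      qed
      ultimately show ?thesis
        using res[of t] res[of t0] by metis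
    qed
    then show ?thesis by (simp only: of_int_eq_iff)
  qed
  have base: "(\<Sum>w\<in>Zs t0. zorder (G t0) w) - int n = zorder (g t0) w0"
  proof -
    have "w = w0" if "w \<in> Zs t0" for w
      using that r0(2)[of w] r by (cases "w = w0") (auto simp: Zs_def dist_commute)
    then have "Zs t0 \<subseteq> {w0}" by auto
    then have "(\<Sum>w\<in>Zs t0. zorder (G t0) w) = zorder (G t0) w0"
    proof (cases "w0 \<in> Zs t0")
      case True
      then have "Zs t0 = {w0}" using \<open>Zs t0 \<subseteq> {w0}\<close> by auto
      then show ?thesis by simp
    next
      case False
      then have "Zs t0 = {}" using \<open>Zs t0 \<subseteq> {w0}\<close> by auto
      moreover have "zorder (G t0) w0 = 0"
        using False ord_G0(1)[of w0 t0] r r2 by (simp add: Zs_def)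
      ultimately show ?thesis by simp
    qed
    then show ?thesis using ord_g[of w0 t0] r by simp
  qed
  show ?thesis
  proof (rule that[of r \<delta>])
    show "\<delta> > 0" using c M by (simp add: \<delta>_def)
    fix t assume t: "\<bar>t - t0\<bar> < \<delta>"
    show "(\<Sum>w | w \<in> ball w0 r \<and> zorder (g t) w \<noteq> 0. zorder (g t) w) = zorder (g t0) w0"
      using total(2)[of t] count[OF t] base by simp
    fix w assume "0 \<le> zorder f w0" "zorder (g t0) w0 = 0" and w: "w \<in> ball w0 r"
    then have n: "n = 0" "(\<Sum>w\<in>Zs t. zorder (G t) w) = 0"
      using base count[OF t] by (auto simp: n_def m_def)
    then have "\<forall>w\<in>Zs t. zorder (G t) w = 0"
      using finZ[of t] ord_G0(2)[of _ t] r2 by (subst (asm) sum_nonneg_eq_0_iff) (auto simp: Zs_def)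
    then have "zorder (G t) w = 0"
      using w ord_G0(1)[of w t] r2 by (cases "G t w = 0") (auto simp: Zs_def)
    then show "zorder (g t) w = 0" using ord_g[OF w, of t] n by simp
  qed (use r total in auto)
qed

section \<open>Charts and germs on a Riemann surface\<close>

abbreviation chart_point :: "'a chart \<Rightarrow> complex \<Rightarrow> 'a" where
  "chart_point c \<equiv> inv_into (fst c) (snd c)"

lemma in_chart_eq: "in_chart c f w = f (chart_point c w)"
  by (simp add: in_chart_def)

lemma complex_chart_facts:
  assumes "complex_chart X c"
  shows "openin X (fst c)" "fst c \<subseteq> topspace X" "open (snd c ` fst c)" "inj_on (snd c) (fst c)"
proof -
  show o: "openin X (fst c)" "open (snd c ` fst c)" using assms by (auto simp: complex_chart_def)
  show s: "fst c \<subseteq> topspace X" using o openin_subset by blast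
  have "inj_on (snd c) (topspace (subtopology X (fst c)))"
    using assms by (auto simp: complex_chart_def homeomorphic_eq_everything_map)
  then show "inj_on (snd c) (fst c)" using s by (simp add: Int_absorb1)
qed

lemma chart_point_apply [simp]:
  assumes "complex_chart X c" "p \<in> fst c"
  shows "chart_point c (snd c p) = p"
  using complex_chart_facts(4)[OF assms(1)] assms(2) by simp

lemma in_chart_apply:
  assumes "complex_chart X c" "p \<in> fst c"
  shows "in_chart c f (snd c p) = f p"
  using assms by (simp add: in_chart_eq)

lemma open_chart_image:
  assumes "complex_chart X c" "openin X U"
  shows "open (snd c ` (fst c \<inter> U))"
proof -
  have "openin (subtopology X (fst c)) (fst c \<inter> U)"
    using assms(2) by (metis inf_commute openin_subtopology_Int)
  then have "openin (top_of_set (snd c ` fst c)) (snd c ` (fst c \<inter> U))"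
    using assms(1) unfolding complex_chart_def
    by (meson homeomorphic_imp_open_map open_map_def)
  then show ?thesis
    using complex_chart_facts(3)[OF assms(1)] by (simp add: openin_open_eq)
qed

lemma openin_chart_vimage:
  assumes "complex_chart X c" "open V"
  shows "openin X {p \<in> fst c. snd c p \<in> V}"
proof -
  have "continuous_map (subtopology X (fst c)) (top_of_set (snd c ` fst c)) (snd c)"
    using assms(1) unfolding complex_chart_def by (simp add: homeomorphic_imp_continuous_map)
  then have "openin (subtopology X (fst c)) {p \<in> topspace (subtopology X (fst c)). snd c p \<in> snd c ` fst c \<inter> V}"
    using assms(2) by (intro openin_continuous_map_preimage) auto
  also have "{p \<in> topspace (subtopology X (fst c)). snd c p \<in> snd c ` fst c \<inter> V} = {p \<in> fst c. snd c p \<in> V}"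
    using complex_chart_facts(2)[OF assms(1)] by auto
  finally show ?thesis
    using complex_chart_facts(1)[OF assms(1)] openin_trans_full by blast
qed

text \<open>
  Germs of functions on the surface are studied as germs of functions of one complex variable
  through this translation and its punctured version below.
\<close>

lemma eventually_nhdsin_chart:
  assumes "complex_chart X c" "p \<in> fst c"
  shows "(\<forall>\<^sub>F x in nhdsin X p. P x) \<longleftrightarrow> (\<forall>\<^sub>F w in nhds (snd c p). P (chart_point c w))"
proof
  have p: "p \<in> topspace X" using assms complex_chart_facts by blast
  {
    assume "\<forall>\<^sub>F x in nhdsin X p. P x"
    then obtain U where U: "openin X U" "p \<in> U" "\<forall>x\<in>U. P x"
      using p by (auto simp: eventually_nhdsin)
    have "\<forall>w\<in>snd c ` (fst c \<inter> U). P (chart_point c w)" using U assms by auto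
    then show "\<forall>\<^sub>F w in nhds (snd c p). P (chart_point c w)"
      using open_chart_image[OF assms(1) U(1)] U(2) assms(2) by (auto simp: eventually_nhds)
  next
    assume "\<forall>\<^sub>F w in nhds (snd c p). P (chart_point c w)"
    then obtain V where V: "open V" "snd c p \<in> V" "\<forall>w\<in>V. P (chart_point c w)"
      by (auto simp: eventually_nhds)
    have "\<forall>x\<in>{p \<in> fst c. snd c p \<in> V}. P x" using V assms by force
    then show "\<forall>\<^sub>F x in nhdsin X p. P x"
      using openin_chart_vimage[OF assms(1) V(1)] V(2) assms(2) by (auto simp: eventually_nhdsin)
  }
qed

lemma eventually_atin_nhdsin:
  "(\<forall>\<^sub>F x in atin X p. P x) \<longleftrightarrow> (\<forall>\<^sub>F x in nhdsin X p. x \<noteq> p \<longrightarrow> P x)"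
  by (auto simp: eventually_atin eventually_nhdsin)

lemma eventually_atin_chart:
  assumes "complex_chart X c" "p \<in> fst c"
  shows "(\<forall>\<^sub>F x in atin X p. P x) \<longleftrightarrow> (\<forall>\<^sub>F w in at (snd c p). P (chart_point c w))"
proof -
  have "\<forall>\<^sub>F w in nhds (snd c p). w \<in> snd c ` fst c"
    using complex_chart_facts(3)[OF assms(1)] assms(2) by (intro eventually_nhds_in_open) auto
  then have "\<forall>\<^sub>F w in nhds (snd c p). chart_point c w \<noteq> p \<longleftrightarrow> w \<noteq> snd c p"
    by eventually_elim (use assms in auto)
  then have "(\<forall>\<^sub>F w in nhds (snd c p). chart_point c w \<noteq> p \<longrightarrow> P (chart_point c w)) \<longleftrightarrow>
      (\<forall>\<^sub>F w in nhds (snd c p). w \<noteq> snd c p \<longrightarrow> P (chart_point c w))"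
    by (intro eventually_subst) (auto elim: eventually_mono)
  then show ?thesis
    by (simp add: eventually_atin_nhdsin eventually_nhdsin_chart[OF assms] eventually_at_filter)
qed

lemma eventually_nhdsin_imp_atin:
  "\<forall>\<^sub>F x in nhdsin X p. P x \<Longrightarrow> \<forall>\<^sub>F x in atin X p. P x"
  by (auto simp: eventually_atin_nhdsin elim: eventually_mono)

lemma eventually_nhdsin_in_open:
  "openin X U \<Longrightarrow> p \<in> U \<Longrightarrow> \<forall>\<^sub>F x in nhdsin X p. x \<in> U"
  by (auto simp: eventually_nhdsin)

lemma eventually_nhdsin_self:
  "p \<in> topspace X \<Longrightarrow> \<forall>\<^sub>F x in nhdsin X p. P x \<Longrightarrow> P p"
  by (auto simp: eventually_nhdsin)

lemma eventually_nhdsinI: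
  "\<forall>\<^sub>F x in atin X p. P x \<Longrightarrow> P p \<Longrightarrow> \<forall>\<^sub>F x in nhdsin X p. P x"
  unfolding eventually_atin_nhdsin by (erule eventually_mono) auto

text \<open>
  The transition between two charts has an inverse of the same kind; the chain rule applied to their
  composition shows that its derivative does not vanish. The charts are merely compatible, because
  the coordinate of a conformal net need not belong to the atlas.
\<close>

lemma transition_facts:
  assumes c: "complex_chart X c" and d: "complex_chart X d"
    and cd: "holomorphic_transition c d" and dc: "holomorphic_transition d c"
    and p: "p \<in> fst c" "p \<in> fst d"
  shows transition_analytic: "in_chart d (snd c) analytic_on {snd d p}"
    and transition_deriv_nonzero: "deriv (in_chart d (snd c)) (snd d p) \<noteq> 0"
    and in_chart_change: "\<forall>\<^sub>F w in nhds (snd d p). in_chart d f w = in_chart c f (in_chart d (snd c) w)"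
proof -
  have an: "in_chart d (snd c) analytic_on {snd d p}"
    if "complex_chart X d" "complex_chart X c" "holomorphic_transition d c" "p \<in> fst c" "p \<in> fst d" for c d
    using that open_chart_image[of X d "fst c"] complex_chart_facts(1)[of X c]
    unfolding holomorphic_transition_def analytic_at by (metis IntI imageI)
  show an1: "in_chart d (snd c) analytic_on {snd d p}" using an assms by blast
  have an2: "in_chart c (snd d) analytic_on {snd c p}" using an assms by blast
  have comp: "\<forall>\<^sub>F w in nhds (snd d p). chart_point d w \<in> fst c \<and> w \<in> snd d ` fst d"
  proof (intro eventually_conj)
    show "\<forall>\<^sub>F w in nhds (snd d p). chart_point d w \<in> fst c"
      using eventually_nhdsin_in_open[OF complex_chart_facts(1)[OF c] p(1)] eventually_nhdsin_chart[OF d p(2)]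
      by simp
    show "\<forall>\<^sub>F w in nhds (snd d p). w \<in> snd d ` fst d"
      using complex_chart_facts(3)[OF d] p(2) by (intro eventually_nhds_in_open) auto
  qed
  then show "\<forall>\<^sub>F w in nhds (snd d p). in_chart d f w = in_chart c f (in_chart d (snd c) w)"
    by eventually_elim (use c in \<open>simp add: in_chart_eq\<close>)
  have "\<forall>\<^sub>F w in nhds (snd d p). (in_chart c (snd d) \<circ> in_chart d (snd c)) w = w"
    using comp by eventually_elim (use c d in \<open>auto simp: in_chart_eq\<close>)
  then have "deriv (in_chart c (snd d) \<circ> in_chart d (snd c)) (snd d p) = deriv (\<lambda>w. w) (snd d p)"
    by (intro deriv_cong_ev) auto
  moreover have "deriv (in_chart c (snd d) \<circ> in_chart d (snd c)) (snd d p) =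
      deriv (in_chart c (snd d)) (in_chart d (snd c) (snd d p)) * deriv (in_chart d (snd c)) (snd d p)"
    using an1 an2 in_chart_apply[OF d p(2), of "snd c"]
    by (intro deriv_chain) (auto intro: analytic_on_imp_differentiable_at)
  ultimately show "deriv (in_chart d (snd c)) (snd d p) \<noteq> 0" by auto
qed

text \<open>
  Quantifying over all charts at \<open>p\<close> avoids a choice; by compatibility of the charts any single
  one decides these properties.
\<close>

definition holomorphic_at :: "'a chart set \<Rightarrow> ('a \<Rightarrow> complex) \<Rightarrow> 'a \<Rightarrow> bool" where
  "holomorphic_at A f p \<longleftrightarrow> (\<forall>c\<in>A. p \<in> fst c \<longrightarrow> in_chart c f analytic_on {snd c p})"

definition meromorphic_at :: "'a chart set \<Rightarrow> ('a \<Rightarrow> complex) \<Rightarrow> 'a \<Rightarrow> bool" where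
  "meromorphic_at A f p \<longleftrightarrow> (\<forall>c\<in>A. p \<in> fst c \<longrightarrow> in_chart c f meromorphic_on {snd c p})"

definition order_at :: "'a chart set \<Rightarrow> ('a \<Rightarrow> complex) \<Rightarrow> 'a \<Rightarrow> int" where
  "order_at A f p = zorder (in_chart (SOME c. c \<in> A \<and> p \<in> fst c) f) (snd (SOME c. c \<in> A \<and> p \<in> fst c) p)"

lemma meromorphic_fun_iff: "meromorphic_fun A U f \<longleftrightarrow> (\<forall>p\<in>U. meromorphic_at A f p)"
  unfolding meromorphic_fun_def meromorphic_at_def
  by (subst meromorphic_on_meromorphic_at) auto

locale surface =
  fixes X :: "'a topology" and A :: "'a chart set"
  assumes surface: "riemann_surface X A"
begin

lemma chart: "c \<in> A \<Longrightarrow> complex_chart X c"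
  using surface by (simp add: riemann_surface_def)

lemma transition: "c \<in> A \<Longrightarrow> d \<in> A \<Longrightarrow> holomorphic_transition c d"
  using surface by (simp add: riemann_surface_def)

lemma Hausdorff: "Hausdorff_space X"
  using surface by (simp add: riemann_surface_def)

lemma ex_chart: "p \<in> topspace X \<Longrightarrow> \<exists>c\<in>A. p \<in> fst c"
  using surface by (auto simp: riemann_surface_def)

lemma in_topspace: "c \<in> A \<Longrightarrow> p \<in> fst c \<Longrightarrow> p \<in> topspace X"
  using chart complex_chart_facts by blast

lemma atin_nontrivial: "p \<in> topspace X \<Longrightarrow> atin X p \<noteq> bot"
  using ex_chart[of p] eventually_atin_chart[OF chart, of _ p "\<lambda>_. False"]
  by (metis at_neq_bot eventually_False)

lemma eventually_frequently_atin:
  "p \<in> topspace X \<Longrightarrow> \<forall>\<^sub>F x in atin X p. P x \<Longrightarrow> \<exists>\<^sub>F x in atin X p. P x"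
  using atin_nontrivial eventually_frequently by blast

lemma eventually_atin_in_open:
  assumes "openin X U" "p \<in> U"
  shows "\<forall>\<^sub>F x in atin X p. x \<in> U - {p}"
  using assms by (auto simp: eventually_atin)

text \<open>Points are closed, so a punctured neighbourhood is a neighbourhood of each of its points.\<close>

lemma eventually_atin_eventually_nhdsin:
  assumes "\<forall>\<^sub>F x in atin X p. P x" "p \<in> topspace X"
  shows "\<forall>\<^sub>F x in atin X p. \<forall>\<^sub>F y in nhdsin X x. P y"
proof -
  obtain U where U: "openin X U" "p \<in> U" "\<forall>x\<in>U - {p}. P x"
    using assms by (auto simp: eventually_atin)
  have "openin X (U - {p})"
    using U(1) assms(2) Hausdorff by (meson Hausdorff_imp_t1_space closedin_t1_singleton openin_diff)
  then show ?thesis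
    using U by (auto simp: eventually_atin eventually_nhdsin)
qed

lemma eventually_atin_eventually_atin:
  assumes "\<forall>\<^sub>F x in atin X p. P x" "p \<in> topspace X"
  shows "\<forall>\<^sub>F x in atin X p. \<forall>\<^sub>F y in atin X x. P y"
  using eventually_atin_eventually_nhdsin[OF assms]
  by (auto elim!: eventually_mono intro: eventually_nhdsin_imp_atin)

text \<open>
  The topological core of the identity theorem: a property whose germ is decided at every point
  is decided uniformly on a connected surface.
\<close>

lemma connected_dichotomy:
  assumes conn: "connected_space X"
    and dich: "\<And>p. p \<in> topspace X \<Longrightarrow> (\<forall>\<^sub>F x in atin X p. P x) \<or> (\<forall>\<^sub>F x in atin X p. \<not> P x)"
  shows "(\<forall>p\<in>topspace X. \<forall>\<^sub>F x in atin X p. P x) \<or> (\<forall>p\<in>topspace X. \<forall>\<^sub>F x in atin X p. \<not> P x)"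
proof -
  define S where "S = (\<lambda>Q. {p \<in> topspace X. \<forall>\<^sub>F x in atin X p. Q x})"
  have op: "openin X (S Q)" for Q
  proof (subst openin_subopen, intro ballI)
    fix p assume "p \<in> S Q"
    then have p: "p \<in> topspace X" and ev: "\<forall>\<^sub>F x in atin X p. Q x" by (auto simp: S_def)
    have "\<forall>\<^sub>F x in nhdsin X p. \<forall>\<^sub>F y in atin X x. Q y"
      using eventually_atin_eventually_atin[OF ev p] ev by (rule eventually_nhdsinI)
    then obtain U where "openin X U" "p \<in> U" "\<forall>x\<in>U. \<forall>\<^sub>F y in atin X x. Q y"
      using p by (auto simp: eventually_nhdsin)
    then show "\<exists>T. openin X T \<and> p \<in> T \<and> T \<subseteq> S Q"
      using openin_subset by (intro exI[of _ U]) (auto simp: S_def)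
  qed
  have "S P \<inter> S (\<lambda>x. \<not> P x) = {}"
  proof -
    have False if "p \<in> topspace X" "\<forall>\<^sub>F x in atin X p. P x" "\<forall>\<^sub>F x in atin X p. \<not> P x" for p
      using eventually_frequently_atin[OF that(1,2)] that(3) by (simp add: frequently_def)
    then show ?thesis by (auto simp: S_def)
  qed
  moreover have "topspace X \<subseteq> S P \<union> S (\<lambda>x. \<not> P x)" using dich by (auto simp: S_def)
  ultimately have "S P = {} \<or> S (\<lambda>x. \<not> P x) = {}"
    using conn op unfolding connected_space_def by blast
  then show ?thesis using dich by (auto simp: S_def)
qed

text \<open>
  A subset of a compact surface without accumulation points is finite. This is what makes zeros,
  poles and fibres finite.
\<close>

lemma compact_finite_exceptions:
  assumes "compact_space X" and ev: "\<And>p. p \<in> topspace X \<Longrightarrow> \<forall>\<^sub>F x in atin X p. \<not> P x"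
  shows "finite {p \<in> topspace X. P p}"
proof -
  have "\<forall>p\<in>topspace X. \<exists>U. openin X U \<and> p \<in> U \<and> (\<forall>x\<in>U - {p}. \<not> P x)"
    using ev by (auto simp: eventually_atin)
  then obtain U where U: "\<And>p. p \<in> topspace X \<Longrightarrow> openin X (U p) \<and> p \<in> U p \<and> (\<forall>x\<in>U p - {p}. \<not> P x)"
    by metis
  have "topspace X \<subseteq> \<Union> (U ` topspace X)" using U by auto
  then obtain \<F> where F: "finite \<F>" "\<F> \<subseteq> U ` topspace X" "topspace X \<subseteq> \<Union> \<F>"
    using assms(1) U unfolding compact_space_alt by (metis (no_types, lifting) imageE)
  then obtain T where T: "finite T" "T \<subseteq> topspace X" "\<F> = U ` T"
    by (meson finite_subset_image)
  have "{p \<in> topspace X. P p} \<subseteq> T"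
  proof
    fix p assume p: "p \<in> {p \<in> topspace X. P p}"
    then obtain x where x: "x \<in> T" "p \<in> U x" using F(3) T(3) by auto
    then have "x = p" using U[of x] T(2) p by blast
    then show "p \<in> T" using x by simp
  qed
  then show ?thesis using T(1) finite_subset by blast
qed

lemma in_chart_eventually_eq:
  assumes "c \<in> A" "p \<in> fst c" "\<forall>\<^sub>F x in atin X p. f x = g x"
  shows "\<forall>\<^sub>F w in at (snd c p). in_chart c f w = in_chart c g w"
  using assms eventually_atin_chart[OF chart[OF assms(1)] assms(2)] by (simp add: in_chart_eq)

lemma chart_change:
  assumes "c \<in> A" "d \<in> A" "p \<in> fst c" "p \<in> fst d"
  shows "in_chart d (snd c) analytic_on {snd d p}"
    "deriv (in_chart d (snd c)) (snd d p) \<noteq> 0"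
    "in_chart d (snd c) (snd d p) = snd c p"
    "\<forall>\<^sub>F w in nhds (snd d p). in_chart d f w = in_chart c f (in_chart d (snd c) w)"
    "\<forall>\<^sub>F w in at (snd d p). in_chart d f w = in_chart c f (in_chart d (snd c) w)"
proof -
  note ass = chart[OF assms(1)] chart[OF assms(2)] transition[OF assms(1,2)] transition[OF assms(2,1)] assms(3,4)
  show "in_chart d (snd c) analytic_on {snd d p}" "deriv (in_chart d (snd c)) (snd d p) \<noteq> 0"
    using transition_facts[OF ass] by auto
  show "in_chart d (snd c) (snd d p) = snd c p" by (rule in_chart_apply[OF ass(2,6)])
  show ev: "\<forall>\<^sub>F w in nhds (snd d p). in_chart d f w = in_chart c f (in_chart d (snd c) w)"
    by (rule in_chart_change[OF ass])
  then show "\<forall>\<^sub>F w in at (snd d p). in_chart d f w = in_chart c f (in_chart d (snd c) w)"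
    by (auto simp: eventually_at_filter elim: eventually_mono)
qed

lemma holomorphic_atI:
  assumes "c \<in> A" "p \<in> fst c" "in_chart c f analytic_on {snd c p}"
  shows "holomorphic_at A f p"
  unfolding holomorphic_at_def
proof (intro ballI impI)
  fix d assume d: "d \<in> A" "p \<in> fst d"
  note ch = chart_change[OF assms(1) d(1) assms(2) d(2)]
  have "in_chart c f \<circ> in_chart d (snd c) analytic_on {snd d p}"
    using ch assms by (intro analytic_on_compose) auto
  then show "in_chart d f analytic_on {snd d p}"
    using analytic_at_cong[OF ch(4) refl] by (simp add: o_def)
qed

lemma meromorphic_atI:
  assumes "c \<in> A" "p \<in> fst c" "in_chart c f meromorphic_on {snd c p}"
  shows "meromorphic_at A f p"
  unfolding meromorphic_at_def
proof (intro ballI impI)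
  fix d assume d: "d \<in> A" "p \<in> fst d"
  note ch = chart_change[OF assms(1) d(1) assms(2) d(2)]
  have "(\<lambda>w. in_chart c f (in_chart d (snd c) w)) meromorphic_on {snd d p}"
    using ch assms by (intro meromorphic_on_compose[OF assms(3)]) auto
  then show "in_chart d f meromorphic_on {snd d p}"
    using meromorphic_on_cong[of "{snd d p}" "in_chart d f"
        "\<lambda>w. in_chart c f (in_chart d (snd c) w)" "{snd d p}"] ch(5) by auto
qed

lemma order_at_eq:
  assumes "meromorphic_at A f p" "\<forall>\<^sub>F x in atin X p. f x \<noteq> 0" "c \<in> A" "p \<in> fst c"
  shows "order_at A f p = zorder (in_chart c f) (snd c p)"
proof -
  define d where "d = (SOME d. d \<in> A \<and> p \<in> fst d)"
  have d: "d \<in> A" "p \<in> fst d" using someI[of "\<lambda>d. d \<in> A \<and> p \<in> fst d" c] assms unfolding d_def by blast+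
  note ch = chart_change[OF assms(3) d(1) assms(4) d(2)]
  have "zorder (in_chart d f) (snd d p) = zorder (\<lambda>w. in_chart c f (in_chart d (snd c) w)) (snd d p)"
    using ch(5) by (intro zorder_cong) auto
  also have "\<dots> = zorder (in_chart c f) (in_chart d (snd c) (snd d p))"
  proof (rule zorder_compose_locally_injective)
    show "in_chart c f meromorphic_on {in_chart d (snd c) (snd d p)}"
      using assms by (simp add: ch(3) meromorphic_at_def)
    show "\<forall>\<^sub>F w in at (in_chart d (snd c) (snd d p)). in_chart c f w \<noteq> 0"
      unfolding ch(3)
      using assms(2) unfolding eventually_atin_chart[OF chart[OF assms(3)] assms(4)] in_chart_eq .
  qed (use ch in auto)
  finally show ?thesis by (simp add: order_at_def d_def[symmetric] ch(3))
qed

lemma holomorphic_imp_meromorphic_at: "holomorphic_at A f p \<Longrightarrow> meromorphic_at A f p"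
  by (auto simp: holomorphic_at_def meromorphic_at_def intro: analytic_on_imp_meromorphic_on)

lemma holomorphic_at_cong:
  assumes "holomorphic_at A g p" "\<forall>\<^sub>F x in nhdsin X p. f x = g x"
  shows "holomorphic_at A f p"
  unfolding holomorphic_at_def
proof (intro ballI impI)
  fix c assume c: "c \<in> A" "p \<in> fst c"
  have "\<forall>\<^sub>F w in nhds (snd c p). in_chart c f w = in_chart c g w"
    using assms(2) unfolding eventually_nhdsin_chart[OF chart[OF c(1)] c(2)] in_chart_eq .
  then show "in_chart c f analytic_on {snd c p}"
    using assms(1) c analytic_at_cong[OF _ refl] by (auto simp: holomorphic_at_def)
qed

lemma meromorphic_at_cong:
  assumes "\<forall>\<^sub>F x in atin X p. f x = g x"
  shows "meromorphic_at A f p \<longleftrightarrow> meromorphic_at A g p"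
  unfolding meromorphic_at_def using in_chart_eventually_eq[OF _ _ assms]
  by (intro ball_cong imp_cong meromorphic_on_cong) auto

lemma order_at_cong:
  assumes "\<forall>\<^sub>F x in atin X p. f x = g x" "p \<in> topspace X"
  shows "order_at A f p = order_at A g p"
proof -
  have "(SOME d. d \<in> A \<and> p \<in> fst d) \<in> A \<and> p \<in> fst (SOME d. d \<in> A \<and> p \<in> fst d)"
    using ex_chart[OF assms(2)] someI_ex[of "\<lambda>d. d \<in> A \<and> p \<in> fst d"] by blast
  then show ?thesis
    unfolding order_at_def by (intro zorder_cong in_chart_eventually_eq assms(1)) auto
qed

lemma holomorphic_at_const: "holomorphic_at A (\<lambda>_. a) p"
  by (simp add: holomorphic_at_def in_chart_def o_def)

lemma meromorphic_at_const: "meromorphic_at A (\<lambda>_. a) p"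
  by (intro holomorphic_imp_meromorphic_at holomorphic_at_const)

lemma meromorphic_at_algebra:
  assumes "meromorphic_at A f p" "meromorphic_at A g p"
  shows "meromorphic_at A (\<lambda>x. f x + g x) p" "meromorphic_at A (\<lambda>x. f x - g x) p"
    "meromorphic_at A (\<lambda>x. f x * g x) p" "meromorphic_at A (\<lambda>x. f x / g x) p"
  using assms by (auto simp: meromorphic_at_def in_chart_def o_def intro!: meromorphic_intros)

lemma holomorphic_at_algebra:
  assumes "holomorphic_at A f p" "holomorphic_at A g p"
  shows "holomorphic_at A (\<lambda>x. f x - g x) p" "holomorphic_at A (\<lambda>x. f x * g x) p"
  using assms by (auto simp: holomorphic_at_def in_chart_def o_def intro!: analytic_intros)

lemma holomorphic_at_divide:
  assumes "holomorphic_at A f p" "holomorphic_at A g p" "g p \<noteq> 0"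
  shows "holomorphic_at A (\<lambda>x. f x / g x) p"
  unfolding holomorphic_at_def
proof (intro ballI impI)
  fix c assume c: "c \<in> A" "p \<in> fst c"
  have "(\<lambda>w. in_chart c f w / in_chart c g w) analytic_on {snd c p}"
    using assms c in_chart_apply[OF chart[OF c(1)] c(2), of g]
    by (intro analytic_on_divide) (auto simp: holomorphic_at_def)
  then show "in_chart c (\<lambda>x. f x / g x) analytic_on {snd c p}" by (simp add: in_chart_def o_def)
qed

text \<open>
  The local identity theorem, which feeds \<open>connected_dichotomy\<close>.
\<close>

lemma meromorphic_at_cases:
  assumes "meromorphic_at A f p" "p \<in> topspace X"
  shows "(\<forall>\<^sub>F x in atin X p. f x = 0) \<or> (\<forall>\<^sub>F x in atin X p. f x \<noteq> 0)"
proof -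
  obtain c where c: "c \<in> A" "p \<in> fst c" using ex_chart assms by blast
  then show ?thesis
    using meromorphic_at_dichotomy[of "in_chart c f" "snd c p"] assms(1)
    by (auto simp: meromorphic_at_def eventually_atin_chart[OF chart c(2)] in_chart_eq)
qed

lemma meromorphic_at_eventually_holomorphic:
  assumes "meromorphic_at A f p" "p \<in> topspace X"
  shows "\<forall>\<^sub>F x in atin X p. holomorphic_at A f x"
proof -
  obtain c where c: "c \<in> A" "p \<in> fst c" using ex_chart assms by blast
  have "\<forall>\<^sub>F w in at (snd c p). in_chart c f analytic_on {w}"
    using assms c by (intro meromorphic_eventually_analytic) (auto simp: meromorphic_at_def)
  moreover have "\<forall>\<^sub>F w in at (snd c p). w \<in> snd c ` fst c"
    using complex_chart_facts(3)[OF chart[OF c(1)]] c by (intro eventually_at_in_open') auto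
  ultimately have "\<forall>\<^sub>F w in at (snd c p). holomorphic_at A f (chart_point c w)"
  proof eventually_elim
    case (elim w)
    then show ?case using c chart[OF c(1)] by (intro holomorphic_atI[of c]) auto
  qed
  then show ?thesis by (simp add: eventually_atin_chart[OF chart c(2)] c)
qed

lemma holomorphic_at_tendsto:
  assumes "holomorphic_at A f p" "p \<in> topspace X"
  shows "(f \<longlongrightarrow> f p) (atin X p)"
proof -
  obtain c where c: "c \<in> A" "p \<in> fst c" using ex_chart assms by blast
  have "isCont (in_chart c f) (snd c p)"
    using assms c by (auto simp: holomorphic_at_def intro: analytic_at_imp_isCont)
  then have "(in_chart c f \<longlongrightarrow> f p) (at (snd c p))"
    using in_chart_apply[OF chart[OF c(1)] c(2), of f] by (simp add: isCont_def)
  then show ?thesis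
    by (simp add: tendsto_def eventually_atin_chart[OF chart c(2)] c in_chart_eq)
qed

lemma order_at_nonvanishing:
  assumes "holomorphic_at A f p" "f p \<noteq> 0" "p \<in> topspace X"
  shows "order_at A f p = 0" "\<forall>\<^sub>F x in atin X p. f x \<noteq> 0"
proof -
  show ne: "\<forall>\<^sub>F x in atin X p. f x \<noteq> 0"
    using holomorphic_at_tendsto[OF assms(1,3)] assms(2) tendsto_imp_eventually_ne by blast
  obtain c where c: "c \<in> A" "p \<in> fst c" using ex_chart assms by blast
  have "zorder (in_chart c f) (snd c p) = 0"
    using assms c in_chart_apply[OF chart[OF c(1)] c(2), of f]
    by (intro zorder_eq_0I) (auto simp: holomorphic_at_def)
  then show "order_at A f p = 0"
    using order_at_eq[OF holomorphic_imp_meromorphic_at[OF assms(1)] ne c] by simp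
qed

lemma eventually_order_zero:
  assumes "meromorphic_at A f p" "\<forall>\<^sub>F x in atin X p. f x \<noteq> 0" "p \<in> topspace X"
  shows "\<forall>\<^sub>F x in atin X p. order_at A f x = 0"
  using meromorphic_at_eventually_holomorphic[OF assms(1,3)] assms(2) 
    eventually_atin_in_open[OF openin_topspace assms(3)]
  by eventually_elim (auto intro: order_at_nonvanishing)

lemma order_at_algebra:
  assumes "meromorphic_at A f p" "\<forall>\<^sub>F x in atin X p. f x \<noteq> 0"
    "meromorphic_at A g p" "\<forall>\<^sub>F x in atin X p. g x \<noteq> 0" "p \<in> topspace X"
  shows "order_at A (\<lambda>x. f x * g x) p = order_at A f p + order_at A g p"
    "order_at A (\<lambda>x. f x / g x) p = order_at A f p - order_at A g p"
proof -
  obtain c where c: "c \<in> A" "p \<in> fst c" using ex_chart assms by blast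
  have ne: "\<forall>\<^sub>F x in atin X p. f x * g x \<noteq> 0" "\<forall>\<^sub>F x in atin X p. f x / g x \<noteq> 0"
    using assms(2,4) by (eventually_elim; auto)+
  have fr: "\<exists>\<^sub>F w in at (snd c p). in_chart c f w \<noteq> 0" "\<exists>\<^sub>F w in at (snd c p). in_chart c g w \<noteq> 0"
    using assms(2,4) c
    by (auto simp: eventually_atin_chart[OF chart c(2)] in_chart_eq intro!: eventually_frequently)
  have m: "in_chart c f meromorphic_on {snd c p}" "in_chart c g meromorphic_on {snd c p}"
    using assms c by (auto simp: meromorphic_at_def)
  show "order_at A (\<lambda>x. f x * g x) p = order_at A f p + order_at A g p"
    using zorder_mult[OF m(1) fr(1) m(2) fr(2)]
      order_at_eq[OF meromorphic_at_algebra(3)[OF assms(1,3)] ne(1) c]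
      order_at_eq[OF assms(1,2) c] order_at_eq[OF assms(3,4) c]
    by (simp add: in_chart_def o_def)
  show "order_at A (\<lambda>x. f x / g x) p = order_at A f p - order_at A g p"
    using zorder_divide[OF m(1) fr(1) m(2) fr(2)]
      order_at_eq[OF meromorphic_at_algebra(4)[OF assms(1,3)] ne(2) c]
      order_at_eq[OF assms(1,2) c] order_at_eq[OF assms(3,4) c]
    by (simp add: in_chart_def o_def)
qed

end

section \<open>The degree of a principal divisor\<close>

locale compact_surface = surface +
  assumes compact: "compact_space X" and connected: "connected_space X"
begin

lemma finite_orders:
  assumes "\<And>p. p \<in> topspace X \<Longrightarrow> meromorphic_at A f p"
    "\<And>p. p \<in> topspace X \<Longrightarrow> \<forall>\<^sub>F x in atin X p. f x \<noteq> 0"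
  shows "finite {p \<in> topspace X. order_at A f p \<noteq> 0}"
proof (rule compact_finite_exceptions[OF compact])
  fix p assume p: "p \<in> topspace X"
  show "\<forall>\<^sub>F x in atin X p. \<not> order_at A f x \<noteq> 0"
    using eventually_order_zero[OF assms(1)[OF p] assms(2)[OF p] p] by simp
qed

text \<open>
  The finitely many zeros and poles of \<open>g t0\<close>, together with the poles of \<open>f\<close>, lie in disjoint
  discs on which the total order is locally constant in \<open>t\<close>. The complement of the discs is compact
  and carries no zeros or poles for \<open>t = t0\<close>, hence none for \<open>t\<close> near \<open>t0\<close>.
\<close>

lemma pencil_total_order_locally_constant:
  fixes f :: "'a \<Rightarrow> complex" and t0 :: real
  defines "g \<equiv> \<lambda>(t::real) x. (1 - of_real t) * f x + of_real t"
  assumes mero: "\<And>p. p \<in> topspace X \<Longrightarrow> meromorphic_at A f p"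
    and nonconst: "\<And>p a. p \<in> topspace X \<Longrightarrow> \<forall>\<^sub>F x in atin X p. f x \<noteq> a"
  shows "\<exists>\<delta>>0. \<forall>t. \<bar>t - t0\<bar> < \<delta> \<longrightarrow>
    (\<Sum>p | p \<in> topspace X \<and> order_at A (g t) p \<noteq> 0. order_at A (g t) p) =
    (\<Sum>p | p \<in> topspace X \<and> order_at A (g t0) p \<noteq> 0. order_at A (g t0) p)"
proof -
  have merog: "meromorphic_at A (g t) p" if "p \<in> topspace X" for t p
    unfolding g_def by (intro meromorphic_at_algebra meromorphic_at_const mero that)
  have nzg: "\<forall>\<^sub>F x in atin X p. g t x \<noteq> 0" if "p \<in> topspace X" for t p
  proof (cases "t = 1")
    case False
    show ?thesis using nonconst[OF that, of "- of_real t / (1 - of_real t)"]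
    proof eventually_elim
      case (elim w)
      have "(1 - complex_of_real t) \<noteq> 0" using False by (metis eq_iff_diff_eq_0 of_real_1 of_real_eq_iff)
      then show ?case using elim by (auto simp: g_def field_simps add_eq_0_iff)
    qed
  qed (simp add: g_def)
  have nzf: "\<forall>\<^sub>F x in atin X p. f x \<noteq> 0" if "p \<in> topspace X" for p using nonconst that by simp
  define S where "S = (\<lambda>t. {p \<in> topspace X. order_at A (g t) p \<noteq> 0})"
  have finS: "finite (S t)" for t
    unfolding S_def using merog nzg by (rule finite_orders)
  \<comment> \<open>Poles of \<open>f\<close> count as special also where \<open>g t0\<close> has none, which happens for \<open>t0 = 1\<close>.\<close>
  define Z where "Z = S t0 \<union> {p \<in> topspace X. order_at A f p < 0}"
  have finZ: "finite Z"
    using finS finite_orders[OF mero nzf] unfolding Z_def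
    by (auto elim!: finite_subset[rotated])
  have Ztop: "Z \<subseteq> topspace X" by (auto simp: Z_def S_def)
  \<comment> \<open>Inside any neighbourhood of \<open>p\<close> there is a disc on which the total order stays the same.\<close>
  have local: "\<exists>V \<delta>. openin X V \<and> p \<in> V \<and> V \<subseteq> W \<and> \<delta> > 0 \<and> (\<forall>t. \<bar>t - t0\<bar> < \<delta> \<longrightarrow>
      (\<Sum>x\<in>V \<inter> S t. order_at A (g t) x) = order_at A (g t0) p \<and> (p \<notin> Z \<longrightarrow> V \<inter> S t = {}))"
    if W: "openin X W" "p \<in> W" for p W
  proof -
    have p: "p \<in> topspace X" using W openin_subset by blast
    obtain c where c: "c \<in> A" "p \<in> fst c" using ex_chart p by blast
    note cc = chart[OF c(1)]
    have "open (snd c ` (fst c \<inter> W))" by (rule open_chart_image[OF cc W(1)])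
    then obtain e where e: "e > 0" "ball (snd c p) e \<subseteq> snd c ` (fst c \<inter> W)"
      using c W(2) openE by blast
    define F where "F = in_chart c f"
    have G: "in_chart c (g t) = (\<lambda>w. (1 - of_real t) * F w + of_real t)" for t
      by (simp add: F_def g_def in_chart_def o_def)
    have "F meromorphic_on {snd c p}" using mero[OF p] c by (simp add: F_def meromorphic_at_def)
    moreover have "\<forall>\<^sub>F w in at (snd c p). F w \<noteq> a" for a
      using nonconst[OF p, of a] unfolding F_def in_chart_eq eventually_atin_chart[OF cc c(2)] .
    ultimately obtain r \<delta> where r: "0 < r" "r < e" "\<delta> > 0"
      and fin: "\<And>t. \<bar>t - t0\<bar> < \<delta> \<Longrightarrow> finite {w \<in> ball (snd c p) r. zorder (in_chart c (g t)) w \<noteq> 0}"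
      and total: "\<And>t. \<bar>t - t0\<bar> < \<delta> \<Longrightarrow>
       (\<Sum>w | w \<in> ball (snd c p) r \<and> zorder (in_chart c (g t)) w \<noteq> 0. zorder (in_chart c (g t)) w)
         = zorder (in_chart c (g t0)) (snd c p)"
      and zero: "\<And>t w. \<bar>t - t0\<bar> < \<delta> \<Longrightarrow> 0 \<le> zorder F (snd c p) \<Longrightarrow>
        zorder (in_chart c (g t0)) (snd c p) = 0 \<Longrightarrow> w \<in> ball (snd c p) r \<Longrightarrow> zorder (in_chart c (g t)) w = 0"
      by (rule zorder_pencil_constant[where f = F and ?w0.0 = "snd c p" and e = e and ?t0.0 = t0,
            folded G, OF _ _ e(1)]) (rule that; assumption)
    define V where "V = {x \<in> fst c. snd c x \<in> ball (snd c p) r}"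
    have V: "openin X V" "p \<in> V" 
      unfolding V_def using c r by (auto intro!: openin_chart_vimage[OF cc] simp del: mem_ball)
    have img: "snd c ` V = ball (snd c p) r"
    proof
      show "ball (snd c p) r \<subseteq> snd c ` V"
      proof
        fix w assume w: "w \<in> ball (snd c p) r"
        then have "w \<in> ball (snd c p) e" using r(2) by simp
        then obtain x where "x \<in> fst c" "w = snd c x" using e(2) by blast
        then show "w \<in> snd c ` V" using w by (auto simp: V_def)
      qed
    qed (auto simp: V_def)
    have inj: "inj_on (snd c) V"
      using complex_chart_facts(4)[OF cc] by (rule inj_on_subset) (auto simp: V_def)
    have Vt: "x \<in> topspace X" "x \<in> fst c" if "x \<in> V" for x
      using that complex_chart_facts(2)[OF cc] by (auto simp: V_def)
    have VW: "V \<subseteq> W"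
    proof
      fix x assume x: "x \<in> V"
      then have "snd c x \<in> ball (snd c p) e" using r by (auto simp: V_def)
      then obtain y where y: "y \<in> fst c" "y \<in> W" "snd c x = snd c y" using e(2) by blast
      then have "x = y" using complex_chart_facts(4)[OF cc] Vt[OF x] by (auto dest: inj_onD)
      then show "x \<in> W" using y by simp
    qed
    have ord: "order_at A (g t) x = zorder (in_chart c (g t)) (snd c x)" if "x \<in> V" for t x
      using Vt[OF that] by (intro order_at_eq merog nzg c(1)) auto
    have *: "(\<Sum>x\<in>V \<inter> S t. order_at A (g t) x) = order_at A (g t0) p \<and> (p \<notin> Z \<longrightarrow> V \<inter> S t = {})"
      if t: "\<bar>t - t0\<bar> < \<delta>" for t
    proof
      have "snd c ` (V \<inter> S t) = {w \<in> ball (snd c p) r. zorder (in_chart c (g t)) w \<noteq> 0}"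
        using ord Vt unfolding img[symmetric] S_def by auto
      moreover have "inj_on (snd c) (V \<inter> S t)" using inj by (rule inj_on_subset) auto
      then have "(\<Sum>x\<in>V \<inter> S t. zorder (in_chart c (g t)) (snd c x)) =
          (\<Sum>w\<in>snd c ` (V \<inter> S t). zorder (in_chart c (g t)) w)"
        by (simp add: sum.reindex)
      ultimately have "(\<Sum>x\<in>V \<inter> S t. zorder (in_chart c (g t)) (snd c x)) = zorder (in_chart c (g t0)) (snd c p)"
        using total[OF t] by simp
      then show "(\<Sum>x\<in>V \<inter> S t. order_at A (g t) x) = order_at A (g t0) p"
        using ord V(2) by simp
      show "p \<notin> Z \<longrightarrow> V \<inter> S t = {}"
      proof
        assume "p \<notin> Z"
        then have "0 \<le> zorder F (snd c p)" "zorder (in_chart c (g t0)) (snd c p) = 0"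
          using p order_at_eq[OF mero[OF p] nzf[OF p] c] ord[OF V(2)] by (auto simp: Z_def S_def F_def)
        then have "order_at A (g t) x = 0" if "x \<in> V" for x
          using zero[OF t, of "snd c x"] ord[OF that, of t] that by (simp add: V_def)
        then show "V \<inter> S t = {}" by (auto simp: S_def)
      qed
    qed
    show ?thesis using V VW r(3) * by (intro exI[of _ V] exI[of _ \<delta>]) simp
  qed
  \<comment> \<open>The finitely many special points have pairwise disjoint neighbourhoods.\<close>
  obtain U where U: "\<And>p. p \<in> Z \<Longrightarrow> openin X (U p) \<and> p \<in> U p"
      "\<And>p p'. p \<in> Z \<Longrightarrow> p' \<in> Z \<Longrightarrow> p \<noteq> p' \<Longrightarrow> U p \<inter> U p' = {}"
  proof -
    have "\<forall>p p'. \<exists>N. p \<in> Z \<longrightarrow> p' \<in> Z \<longrightarrow> p \<noteq> p' \<longrightarrow> 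
        openin X (fst N) \<and> openin X (snd N) \<and> p \<in> fst N \<and> p' \<in> snd N \<and> fst N \<inter> snd N = {}"
    proof (intro allI)
      fix p p'
      show "\<exists>N. p \<in> Z \<longrightarrow> p' \<in> Z \<longrightarrow> p \<noteq> p' \<longrightarrow> 
        openin X (fst N) \<and> openin X (snd N) \<and> p \<in> fst N \<and> p' \<in> snd N \<and> fst N \<inter> snd N = {}"
      proof (cases "p \<in> Z \<and> p' \<in> Z \<and> p \<noteq> p'")
        case True
        then have "p \<in> topspace X" "p' \<in> topspace X" "p \<noteq> p'" using Ztop by auto
        then obtain B C where "openin X B" "openin X C" "p \<in> B" "p' \<in> C" "disjnt B C"
          using Hausdorff[unfolded Hausdorff_space_def, rule_format, of p p'] by metis
        then show ?thesis by (intro exI[of _ "(B, C)"]) (auto simp: disjnt_def)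
      qed auto
    qed
    from this[unfolded choice_iff] obtain N where N: "\<And>p p'. p \<in> Z \<Longrightarrow> p' \<in> Z \<Longrightarrow> p \<noteq> p' \<Longrightarrow>
        openin X (fst (N p p')) \<and> openin X (snd (N p p')) \<and> p \<in> fst (N p p') \<and> p' \<in> snd (N p p')
          \<and> fst (N p p') \<inter> snd (N p p') = {}"
      by blast
    define U where "U = (\<lambda>p. topspace X \<inter> (\<Inter>p'\<in>Z - {p}. fst (N p p') \<inter> snd (N p' p)))"
    show ?thesis
    proof (rule that[of U])
      fix p assume p: "p \<in> Z"
      have "openin X (\<Inter> (insert (topspace X) ((\<lambda>p'. fst (N p p') \<inter> snd (N p' p)) ` (Z - {p}))))"
        using finZ N p by (intro openin_Inter) (auto intro!: openin_Int)
      also have "\<Inter> (insert (topspace X) ((\<lambda>p'. fst (N p p') \<inter> snd (N p' p)) ` (Z - {p}))) = U p"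
        by (simp add: U_def)
      finally show "openin X (U p) \<and> p \<in> U p" using N p Ztop by (auto simp: U_def)
    next
      fix p p' assume "p \<in> Z" "p' \<in> Z" "p \<noteq> p'"
      then show "U p \<inter> U p' = {}" using N[of p p'] unfolding U_def by fastforce
    qed
  qed
  have "\<forall>p\<in>Z. \<exists>V \<delta>. openin X V \<and> p \<in> V \<and> V \<subseteq> U p \<and> \<delta> > 0 \<and> (\<forall>t. \<bar>t - t0\<bar> < \<delta> \<longrightarrow>
      (\<Sum>x\<in>V \<inter> S t. order_at A (g t) x) = order_at A (g t0) p)"
  proof
    fix p assume p: "p \<in> Z"
    from local[OF U(1)[OF p, THEN conjunct1] U(1)[OF p, THEN conjunct2]] obtain V \<delta> where "openin X V \<and> p \<in> V \<and> V \<subseteq> U p \<and> \<delta> > 0 \<and>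
        (\<forall>t. \<bar>t - t0\<bar> < \<delta> \<longrightarrow>
          (\<Sum>x\<in>V \<inter> S t. order_at A (g t) x) = order_at A (g t0) p \<and> (p \<notin> Z \<longrightarrow> V \<inter> S t = {}))"
      by (elim exE) (rule that)
    then show "\<exists>V \<delta>. openin X V \<and> p \<in> V \<and> V \<subseteq> U p \<and> \<delta> > 0 \<and> (\<forall>t. \<bar>t - t0\<bar> < \<delta> \<longrightarrow>
        (\<Sum>x\<in>V \<inter> S t. order_at A (g t) x) = order_at A (g t0) p)"
      by (intro exI[of _ V] exI[of _ \<delta>]) simp
  qed
  from this[unfolded bchoice_iff] obtain V \<delta> where "\<forall>p\<in>Z. openin X (V p) \<and> p \<in> V p \<and> V p \<subseteq> U p \<and>
      \<delta> p > 0 \<and> (\<forall>t. \<bar>t - t0\<bar> < \<delta> p \<longrightarrow> (\<Sum>x\<in>V p \<inter> S t. order_at A (g t) x) = order_at A (g t0) p)"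
    by (elim exE) (rule that)
  then have V: "\<And>p. p \<in> Z \<Longrightarrow> openin X (V p) \<and> p \<in> V p \<and> V p \<subseteq> U p \<and> \<delta> p > (0::real)"
    and sumV: "\<And>p t. p \<in> Z \<Longrightarrow> \<bar>t - t0\<bar> < \<delta> p \<Longrightarrow> (\<Sum>x\<in>V p \<inter> S t. order_at A (g t) x) = order_at A (g t0) p"
    by simp_all
  define K where "K = topspace X - \<Union> (V ` Z)"
  have "compactin X K"
  proof -
    have "openin X (\<Union> (V ` Z))" using V by (intro openin_Union) auto
    then show ?thesis
      unfolding K_def using compact closedin_compact_space by (metis closedin_diff closedin_topspace)
  qed
  have "\<forall>p\<in>K. \<exists>W \<epsilon>. openin X W \<and> p \<in> W \<and> \<epsilon> > 0 \<and> (\<forall>t. \<bar>t - t0\<bar> < \<epsilon> \<longrightarrow> W \<inter> S t = {})"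
  proof
    fix p assume p: "p \<in> K"
    then have "p \<notin> Z" "p \<in> topspace X" using V by (auto simp: K_def)
    then show "\<exists>W \<epsilon>. openin X W \<and> p \<in> W \<and> \<epsilon> > 0 \<and> (\<forall>t. \<bar>t - t0\<bar> < \<epsilon> \<longrightarrow> W \<inter> S t = {})"
    proof -
      from local[OF openin_topspace \<open>p \<in> topspace X\<close>] obtain V \<delta> where
        "openin X V \<and> p \<in> V \<and> V \<subseteq> topspace X \<and> \<delta> > 0 \<and> (\<forall>t. \<bar>t - t0\<bar> < \<delta> \<longrightarrow>
          (\<Sum>x\<in>V \<inter> S t. order_at A (g t) x) = order_at A (g t0) p \<and> (p \<notin> Z \<longrightarrow> V \<inter> S t = {}))"
        by (elim exE) (rule that)
      then show ?thesis using \<open>p \<notin> Z\<close> by (intro exI[of _ V] exI[of _ \<delta>]) simp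
    qed
  qed
  from this[unfolded bchoice_iff] obtain W \<epsilon> where "\<forall>p\<in>K. openin X (W p) \<and> p \<in> W p \<and> \<epsilon> p > 0 \<and>
      (\<forall>t. \<bar>t - t0\<bar> < \<epsilon> p \<longrightarrow> W p \<inter> S t = {})"
    by (elim exE) (rule that)
  then have W: "\<And>p. p \<in> K \<Longrightarrow> openin X (W p) \<and> p \<in> W p \<and> \<epsilon> p > (0::real)"
    and emptyW: "\<And>p t. p \<in> K \<Longrightarrow> \<bar>t - t0\<bar> < \<epsilon> p \<Longrightarrow> W p \<inter> S t = {}"
    by simp_all
  obtain \<F> where F: "finite \<F>" "\<F> \<subseteq> W ` K" "K \<subseteq> \<Union> \<F>"
  proof -
    have "\<forall>B\<in>W ` K. openin X B" "K \<subseteq> \<Union> (W ` K)" using W by auto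
    then show thesis using \<open>compactin X K\<close> that unfolding compactin_def by meson
  qed
  obtain T where T: "finite T" "T \<subseteq> K" "\<F> = W ` T"
    using F by (meson finite_subset_image)
  define d where "d = Min (insert 1 (\<delta> ` Z \<union> \<epsilon> ` T))"
  have d: "d > 0" "\<And>p. p \<in> Z \<Longrightarrow> d \<le> \<delta> p" "\<And>p. p \<in> T \<Longrightarrow> d \<le> \<epsilon> p"
    using finZ T V W unfolding d_def by (auto simp: subset_iff)
  have total: "(\<Sum>p\<in>S t. order_at A (g t) p) = (\<Sum>p\<in>Z. order_at A (g t0) p)" if t: "\<bar>t - t0\<bar> < d" for t
  proof -
    have "S t \<subseteq> \<Union> (V ` Z)"
    proof
      fix x assume x: "x \<in> S t"
      show "x \<in> \<Union> (V ` Z)"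
      proof (rule ccontr)
        assume "x \<notin> \<Union> (V ` Z)"
        then have "x \<in> K" using x by (auto simp: K_def S_def)
        then obtain p where p: "p \<in> T" "x \<in> W p" using F(3) T(3) by auto
        then show False using emptyW[of p t] d(3)[of p] t T(2) x by auto
      qed
    qed
    then have "S t = (\<Union>p\<in>Z. V p \<inter> S t)" by auto
    then have "(\<Sum>p\<in>S t. order_at A (g t) p) = (\<Sum>x\<in>(\<Union>p\<in>Z. V p \<inter> S t). order_at A (g t) x)" by simp
    also have "\<dots> = (\<Sum>p\<in>Z. \<Sum>x\<in>V p \<inter> S t. order_at A (g t) x)"
      using finZ finS V U(2) by (intro sum.UNION_disjoint) (auto, blast)
    also have "\<dots> = (\<Sum>p\<in>Z. order_at A (g t0) p)"
      using sumV d(2) t by (intro sum.cong refl) fastforce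
    finally show ?thesis .
  qed
  show ?thesis
    using d(1) total total[of t0] unfolding S_def by (intro exI[of _ d]) auto
qed

text \<open>
  Deform \<open>f\<close> to the constant function \<open>1\<close> along \<open>(1 - t) f + t\<close>. If \<open>f\<close> is not constant, no member
  of this family vanishes identically, so its total order is a locally constant function of the real
  parameter \<open>t\<close>, hence the same at \<open>t = 0\<close>, where it belongs to \<open>f\<close>, and at \<open>t = 1\<close>, where it is
  zero.
\<close>

theorem sum_orders_eq_0:
  assumes mero: "\<And>p. p \<in> topspace X \<Longrightarrow> meromorphic_at A f p"
    and nz: "\<And>p. p \<in> topspace X \<Longrightarrow> \<forall>\<^sub>F x in atin X p. f x \<noteq> 0"
  shows "(\<Sum>p | p \<in> topspace X \<and> order_at A f p \<noteq> 0. order_at A f p) = 0"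
proof (cases "\<forall>a. \<forall>p\<in>topspace X. \<forall>\<^sub>F x in atin X p. f x \<noteq> a")
  case True
  define D where "D = (\<lambda>t::real. \<Sum>p | p \<in> topspace X \<and> order_at A (\<lambda>x. (1 - of_real t) * f x + of_real t) p \<noteq> 0.
    order_at A (\<lambda>x. (1 - of_real t) * f x + of_real t) p)"
  have "D constant_on UNIV"
  proof (rule locally_constant_imp_constant)
    fix t0 :: real
    have "\<exists>\<delta>>0. \<forall>t. \<bar>t - t0\<bar> < \<delta> \<longrightarrow> D t = D t0"
      unfolding D_def by (rule pencil_total_order_locally_constant) (use True mero in blast)+
    then obtain \<delta> where \<delta>: "\<delta> > 0" "\<And>t. \<bar>t - t0\<bar> < \<delta> \<Longrightarrow> D t = D t0" by blast
    have "D x = D t0" if "x \<in> ball t0 \<delta>" for x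
      using that by (intro \<delta>(2)) (simp add: dist_real_def abs_minus_commute)
    moreover have "openin (top_of_set UNIV) (ball t0 \<delta>)" "t0 \<in> ball t0 \<delta>" using \<delta>(1) by simp_all
    ultimately show "\<exists>T. openin (top_of_set UNIV) T \<and> t0 \<in> T \<and> (\<forall>x\<in>T. D x = D t0)"
      by blast
  qed simp
  then have "D 0 = D 1" unfolding constant_on_def by (metis UNIV_I)
  moreover have "D 1 = 0"
    using order_at_nonvanishing(1)[OF holomorphic_at_const, of 1] by (simp add: D_def)
  ultimately show ?thesis by (simp add: D_def)
next
  case False
  then obtain a p where a: "p \<in> topspace X" "\<not> (\<forall>\<^sub>F x in atin X p. f x \<noteq> a)" by blast
  have "(\<forall>\<^sub>F x in atin X p. f x = a) \<or> (\<forall>\<^sub>F x in atin X p. f x \<noteq> a)" if "p \<in> topspace X" for p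
    using meromorphic_at_cases[OF meromorphic_at_algebra(2)[OF mero meromorphic_at_const], of p a] that by simp
  then have eq: "\<forall>p\<in>topspace X. \<forall>\<^sub>F x in atin X p. f x = a"
    using connected_dichotomy[OF connected, of "\<lambda>x. f x = a"] a by blast
  have "a \<noteq> 0"
  proof
    assume "a = 0"
    have "\<exists>\<^sub>F x in atin X p. f x = a" using eventually_frequently_atin[OF a(1)] eq a(1) by blast
    then show False using nz[OF a(1)] \<open>a = 0\<close> by (simp add: frequently_def)
  qed
  have "order_at A f p = 0" if "p \<in> topspace X" for p
    using order_at_cong[of f "\<lambda>_. a" p] eq that order_at_nonvanishing(1)[OF holomorphic_at_const \<open>a \<noteq> 0\<close>]
    by auto
  then show ?thesis by simp
qed

end

section \<open>Logarithmic derivatives on a surface\<close>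

context surface
begin

lemma chart_deriv_change:
  assumes "c \<in> A" "d \<in> A" "p \<in> fst c" "p \<in> fst d" "holomorphic_at A f p"
  shows "chart_deriv d f p = chart_deriv c f p * chart_deriv d (snd c) p"
proof -
  note ch = chart_change[OF assms(1-4)]
  have "deriv (in_chart d f) (snd d p) = deriv (in_chart c f \<circ> in_chart d (snd c)) (snd d p)"
    using ch(4)[of f] by (intro deriv_cong_ev) auto
  also have "\<dots> = deriv (in_chart c f) (in_chart d (snd c) (snd d p)) * deriv (in_chart d (snd c)) (snd d p)"
    using ch assms by (intro deriv_chain)
      (auto simp: holomorphic_at_def intro: analytic_on_imp_differentiable_at)
  finally show ?thesis by (simp add: chart_deriv_def ch(3))
qed

lemma chart_deriv_cong:
  assumes "c \<in> A" "p \<in> fst c" "\<forall>\<^sub>F x in nhdsin X p. f x = g x"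
  shows "chart_deriv c f p = chart_deriv c g p"
  unfolding chart_deriv_def
proof (rule deriv_cong_ev[OF _ refl])
  show "\<forall>\<^sub>F w in nhds (snd c p). in_chart c f w = in_chart c g w"
    using assms(3) unfolding eventually_nhdsin_chart[OF chart[OF assms(1)] assms(2)] in_chart_eq .
qed

lemma dlog_cong:
  assumes "c \<in> A" "p \<in> fst c" "\<forall>\<^sub>F x in nhdsin X p. f x = g x"
  shows "dlog f c p = dlog g c p"
  using chart_deriv_cong[OF assms] eventually_nhdsin_self[OF in_topspace[OF assms(1,2)] assms(3)]
  by (simp add: dlog_def differential_form_def)

lemma dlog_mult:
  assumes "c \<in> A" "p \<in> fst c" "holomorphic_at A f p" "holomorphic_at A g p" "f p \<noteq> 0" "g p \<noteq> 0"
  shows "dlog (\<lambda>x. f x * g x) c p = dlog f c p + dlog g c p"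
proof -
  note [simp] = in_chart_apply[OF chart[OF assms(1)] assms(2)]
  have "deriv (\<lambda>w. in_chart c f w * in_chart c g w) (snd c p) =
      in_chart c f (snd c p) * deriv (in_chart c g) (snd c p) + deriv (in_chart c f) (snd c p) * in_chart c g (snd c p)"
    using assms by (intro deriv_mult) (auto simp: holomorphic_at_def intro: analytic_on_imp_differentiable_at)
  then have "chart_deriv c (\<lambda>x. f x * g x) p = f p * chart_deriv c g p + chart_deriv c f p * g p"
    by (simp add: chart_deriv_def) (simp add: in_chart_def o_def)
  then show ?thesis using assms by (simp add: dlog_def differential_form_def field_simps)
qed

lemma in_chart_dlog:
  assumes "c \<in> A" "p \<in> fst c"
  shows "\<forall>\<^sub>F w in nhds (snd c p). in_chart c (dlog f c) w = deriv (in_chart c f) w / in_chart c f w"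
proof -
  have "\<forall>\<^sub>F w in nhds (snd c p). w \<in> snd c ` fst c"
    using complex_chart_facts(3)[OF chart[OF assms(1)]] assms(2) by (intro eventually_nhds_in_open) auto
  then show ?thesis
    by eventually_elim
      (use chart[OF assms(1)] in \<open>auto simp: in_chart_eq dlog_def differential_form_def chart_deriv_def\<close>)
qed

lemma in_chart_dlog_at:
  assumes "c \<in> A" "p \<in> fst c"
  shows "\<forall>\<^sub>F w in at (snd c p). in_chart c (dlog f c) w = deriv (in_chart c f) w / in_chart c f w"
  using in_chart_dlog[OF assms, of f] by (auto simp: eventually_at_filter elim: eventually_mono)

lemma meromorphic_at_dlog:
  assumes "c \<in> A" "p \<in> fst c" "meromorphic_at A f p"
  shows "meromorphic_at A (dlog f c) p"
proof (rule meromorphic_atI[OF assms(1,2)])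
  have "(\<lambda>w. deriv (in_chart c f) w / in_chart c f w) meromorphic_on {snd c p}"
    using assms by (auto simp: meromorphic_at_def intro!: meromorphic_intros)
  then show "in_chart c (dlog f c) meromorphic_on {snd c p}"
    using meromorphic_on_cong[of "{snd c p}" "in_chart c (dlog f c)"
        "\<lambda>w. deriv (in_chart c f) w / in_chart c f w" "{snd c p}"] in_chart_dlog_at[OF assms(1,2)] by auto
qed

text \<open>
  The pole of \<open>df / f\<close> is simple at every zero and pole of \<open>f\<close>, and the chain rule gives its
  behaviour under a change of chart.
\<close>

lemma logarithmic_form_dlog:
  assumes U: "openin X U" and mero: "\<And>p. p \<in> U \<Longrightarrow> meromorphic_at A f p"
    and nz: "\<And>p. p \<in> U \<Longrightarrow> \<forall>\<^sub>F x in atin X p. f x \<noteq> 0"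
  shows "logarithmic_form X A U (dlog f)"
  unfolding logarithmic_form_def
proof (intro conjI ballI)
  fix c assume c: "c \<in> A"
  show "meromorphic_fun A (U \<inter> fst c) (dlog f c)"
    using meromorphic_at_dlog[OF c] mero by (auto simp: meromorphic_fun_iff)
  {
    fix d p assume d: "d \<in> A" "p \<in> U \<inter> fst c \<inter> fst d"
    then have p: "p \<in> topspace X" using U openin_subset by blast
    have "openin X (fst c \<inter> fst d)" using c d chart complex_chart_facts by blast
    then have "\<forall>\<^sub>F x in atin X p. x \<in> fst c \<inter> fst d - {p}" using d by (intro eventually_atin_in_open) auto
    moreover have "\<forall>\<^sub>F x in atin X p. holomorphic_at A f x"
      using meromorphic_at_eventually_holomorphic[OF mero p] d by blast
    ultimately show "\<forall>\<^sub>F x in atin X p. dlog f d x = dlog f c x * chart_deriv d (snd c) x"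
    proof eventually_elim
      case (elim x)
      then show ?case using chart_deriv_change[OF c d(1), of x f] by (simp add: dlog_def differential_form_def)
    qed
  next
    fix p assume p: "p \<in> U \<inter> fst c"
    have "in_chart c f meromorphic_on {snd c p}" using mero[of p] p c by (auto simp: meromorphic_at_def)
    moreover have "\<forall>\<^sub>F w in at (snd c p). in_chart c f w \<noteq> 0"
      using nz[of p] p eventually_atin_chart[OF chart[OF c], of p] by (simp add: in_chart_eq)
    ultimately have "(\<lambda>w. (w - snd c p) * (deriv (in_chart c f) w / in_chart c f w)) \<midarrow>snd c p\<rightarrow>
        of_int (zorder (in_chart c f) (snd c p))"
      by (rule residue_logarithmic_derivative(2))
    moreover have "\<forall>\<^sub>F w in at (snd c p). (w - snd c p) * (deriv (in_chart c f) w / in_chart c f w) =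
        (w - snd c p) * in_chart c (dlog f c) w"
      using in_chart_dlog_at[OF c, of p f] p by (auto elim: eventually_mono)
    ultimately show "\<exists>l. (\<lambda>w. (w - snd c p) * in_chart c (dlog f c) w) \<midarrow>snd c p\<rightarrow> l"
      by (blast intro: Lim_transform_eventually)
  }
qed

lemma eventually_atin_notin_finite:
  assumes "finite S" "p \<in> topspace X"
  shows "\<forall>\<^sub>F x in atin X p. x \<notin> S"
proof -
  have "closedin X (topspace X \<inter> (S - {p}))"
    using assms Hausdorff by (intro closedin_Hausdorff_finite) auto
  then have "openin X (topspace X - topspace X \<inter> (S - {p}))" by auto
  then have "\<forall>\<^sub>F x in atin X p. x \<in> topspace X - topspace X \<inter> (S - {p}) - {p}"
    using assms(2) by (intro eventually_atin_in_open) auto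
  then show ?thesis by eventually_elim auto
qed

end

section \<open>Sections and connections of a holomorphic line bundle\<close>

text \<open>
  The last two conditions say that the frame changes form a holomorphic cocycle; it follows that
  \<open>trans L i i = 1\<close> on the patch of \<open>i\<close>.
\<close>

definition holomorphic_line_bundle :: "'a topology \<Rightarrow> 'a chart set \<Rightarrow> ('i, 'a) line_bundle \<Rightarrow> bool" where
  "holomorphic_line_bundle X A L \<longleftrightarrow>
     (\<forall>i\<in>frames L. openin X (patch L i)) \<and>
     (\<forall>p\<in>topspace X. \<exists>i\<in>frames L. p \<in> patch L i) \<and>
     (\<forall>i\<in>frames L. \<forall>j\<in>frames L. \<forall>p\<in>patch L i \<inter> patch L j.
        holomorphic_at A (trans L i j) p \<and> trans L i j p \<noteq> 0) \<and>
     (\<forall>i\<in>frames L. \<forall>j\<in>frames L. \<forall>k\<in>frames L. \<forall>p\<in>patch L i \<inter> patch L j \<inter> patch L k.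
        trans L i k p = trans L i j p * trans L j k p)"

locale bundle_surface = surface +
  fixes L :: "('i, 'a) line_bundle"
  assumes holomorphic_L: "holomorphic_line_bundle X A L"
begin

lemma open_patch: "i \<in> frames L \<Longrightarrow> openin X (patch L i)"
  and ex_frame: "p \<in> topspace X \<Longrightarrow> \<exists>i\<in>frames L. p \<in> patch L i"
  and trans_holomorphic: "i \<in> frames L \<Longrightarrow> j \<in> frames L \<Longrightarrow> p \<in> patch L i \<Longrightarrow> p \<in> patch L j \<Longrightarrow>
    holomorphic_at A (trans L i j) p"
  and trans_nonzero: "i \<in> frames L \<Longrightarrow> j \<in> frames L \<Longrightarrow> p \<in> patch L i \<Longrightarrow> p \<in> patch L j \<Longrightarrow>
    trans L i j p \<noteq> 0"
  and trans_cocycle: "i \<in> frames L \<Longrightarrow> j \<in> frames L \<Longrightarrow> k \<in> frames L \<Longrightarrow>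
    p \<in> patch L i \<Longrightarrow> p \<in> patch L j \<Longrightarrow> p \<in> patch L k \<Longrightarrow> trans L i k p = trans L i j p * trans L j k p"
  using holomorphic_L unfolding holomorphic_line_bundle_def by blast+

lemma patch_in_topspace: "i \<in> frames L \<Longrightarrow> p \<in> patch L i \<Longrightarrow> p \<in> topspace X"
  using open_patch openin_subset by blast

lemma eventually_patch:
  assumes "i \<in> frames L" "p \<in> patch L i"
  shows "\<forall>\<^sub>F x in atin X p. x \<in> patch L i"
  using eventually_atin_in_open[OF open_patch assms(2)] assms(1) by (auto elim: eventually_mono)

lemma section_meromorphic_at:
  assumes "meromorphic_section X A L s" "i \<in> frames L" "p \<in> patch L i"
  shows "meromorphic_at A (s i) p"
  using assms by (auto simp: meromorphic_section_def meromorphic_fun_iff)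

lemma section_frame_change:
  assumes "meromorphic_section X A L s" "i \<in> frames L" "j \<in> frames L" "p \<in> patch L i" "p \<in> patch L j"
  shows "\<forall>\<^sub>F x in atin X p. s i x = trans L i j x * s j x"
  using assms by (auto simp: meromorphic_section_def)

lemma section_eventually_nonzero:
  assumes "meromorphic_section X A L s" "nonzero_section X L s" "i \<in> frames L" "p \<in> patch L i"
  shows "\<forall>\<^sub>F x in atin X p. s i x \<noteq> 0"
  using meromorphic_at_cases[OF section_meromorphic_at[OF assms(1,3,4)] patch_in_topspace[OF assms(3,4)]]
    assms(2-4) by (auto simp: nonzero_section_def frequently_def)

text \<open>
  The frame change is holomorphic without zeros, hence contributes nothing to the order.
\<close>

lemma section_order_frame_independent:
  assumes "meromorphic_section X A L s" "nonzero_section X L s"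
    "i \<in> frames L" "j \<in> frames L" "p \<in> patch L i" "p \<in> patch L j"
  shows "order_at A (s i) p = order_at A (s j) p"
proof -
  note p = patch_in_topspace[OF assms(3,5)]
  note t = trans_holomorphic[OF assms(3-6)] trans_nonzero[OF assms(3-6)]
  have "order_at A (s i) p = order_at A (\<lambda>x. trans L i j x * s j x) p"
    using section_frame_change[OF assms(1,3-6)] p by (rule order_at_cong)
  also have "\<dots> = order_at A (trans L i j) p + order_at A (s j) p"
    using holomorphic_imp_meromorphic_at[OF t(1)] order_at_nonvanishing(2)[OF t p]
      section_meromorphic_at[OF assms(1,4,6)] section_eventually_nonzero[OF assms(1,2,4,6)] p
    by (rule order_at_algebra)
  finally show ?thesis using order_at_nonvanishing(1)[OF t p] by simp
qed

lemma section_order_eq: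
  assumes "meromorphic_section X A L s" "nonzero_section X L s" "i \<in> frames L" "p \<in> patch L i"
  shows "section_order A L s p = order_at A (s i) p"
proof -
  have z: "zorder (in_chart c (s j)) (snd c p) = order_at A (s i) p"
    if "j \<in> frames L" "c \<in> A" "p \<in> patch L j" "p \<in> fst c" for j c
    using order_at_eq[OF section_meromorphic_at[OF assms(1) that(1,3)]
        section_eventually_nonzero[OF assms(1,2) that(1,3)] that(2,4)]
      section_order_frame_independent[OF assms(1,2,3) that(1) assms(4) that(3)] by simp
  obtain c where c: "c \<in> A" "p \<in> fst c" using ex_chart patch_in_topspace assms by blast
  show ?thesis unfolding section_order_def
    by (rule the_equality) (use z c assms(3,4) in blast)+
qed

text \<open>
  Applying \<open>dlog\<close> to \<open>s i = trans L i j * s j\<close> turns the frame change of the section into that of the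
  connection.
\<close>

lemma section_connection_logarithmic:
  assumes "meromorphic_section X A L s" "nonzero_section X L s"
  shows "logarithmic_connection X A L (section_connection s)"
  unfolding logarithmic_connection_def section_connection_def
proof (intro conjI ballI)
  fix i assume i: "i \<in> frames L"
  show "logarithmic_form X A (patch L i) (dlog (s i))"
    using open_patch[OF i] section_meromorphic_at[OF assms(1) i] section_eventually_nonzero[OF assms i]
    by (rule logarithmic_form_dlog)
  fix j c p assume j: "j \<in> frames L" and c: "c \<in> A" and p': "p \<in> patch L i \<inter> patch L j \<inter> fst c"
  then have p: "p \<in> patch L i" "p \<in> patch L j" "p \<in> fst c" "p \<in> topspace X" 
    using patch_in_topspace by auto
  have ev1: "\<forall>\<^sub>F x in atin X p. \<forall>\<^sub>F y in nhdsin X x. s i y = trans L i j y * s j y"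
    using eventually_atin_eventually_nhdsin[OF section_frame_change[OF assms(1) i j p(1,2)] p(4)] .
  have ev2: "\<forall>\<^sub>F x in atin X p. x \<in> fst c - {p}"
    using complex_chart_facts(1)[OF chart[OF c]] p(3) by (rule eventually_atin_in_open)
  show "\<forall>\<^sub>F x in atin X p. dlog (s j) c x = dlog (s i) c x - dlog (trans L i j) c x"
    using ev1 ev2 eventually_patch[OF i p(1)] eventually_patch[OF j p(2)]
      section_eventually_nonzero[OF assms j p(2)]
      meromorphic_at_eventually_holomorphic[OF section_meromorphic_at[OF assms(1) j p(2)] p(4)]
  proof eventually_elim
    case (elim x)
    then have "dlog (s i) c x = dlog (\<lambda>y. trans L i j y * s j y) c x" using c by (intro dlog_cong) auto
    also have "\<dots> = dlog (trans L i j) c x + dlog (s j) c x"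
      using elim trans_holomorphic[OF i j] trans_nonzero[OF i j] c by (intro dlog_mult) auto
    finally show ?case by simp
  qed
qed

text \<open>
  By the cocycle condition, \<open>E k\<close> has the coefficients \<open>trans L i k\<close> in the frames \<open>E i\<close>.
  Hence holomorphic frames exist near every point, without which the intrinsic residue would not be
  determined.
\<close>

lemma holomorphic_frame_of_index:
  assumes "k \<in> frames L"
  shows "holomorphic_frame X A L (patch L k) (\<lambda>i. trans L i k)"
  unfolding holomorphic_frame_def
proof (intro conjI ballI)
  fix i c assume i: "i \<in> frames L" and c: "c \<in> A"
  have "in_chart c (trans L i k) analytic_on {w}" if "w \<in> snd c ` (fst c \<inter> patch L i \<inter> patch L k)" for w
    using that trans_holomorphic[OF i assms] c by (auto simp: holomorphic_at_def)
  then have "in_chart c (trans L i k) analytic_on snd c ` (fst c \<inter> patch L i \<inter> patch L k)"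
    by (subst analytic_on_analytic_at) auto
  then show "in_chart c (trans L i k) holomorphic_on snd c ` (fst c \<inter> patch L i \<inter> patch L k)"
    by (rule analytic_imp_holomorphic)
next
  fix i j p assume "i \<in> frames L" "j \<in> frames L" "p \<in> patch L i \<inter> patch L j \<inter> patch L k"
  then show "trans L i k p = trans L i j p * trans L j k p"
    using assms by (intro trans_cocycle) auto
qed (use assms open_patch trans_nonzero in auto)

lemma holomorphic_frame_at:
  assumes "holomorphic_frame X A L W e" "p \<in> W" "i \<in> frames L" "p \<in> patch L i"
  shows "holomorphic_at A (e i) p" "e i p \<noteq> 0"
proof -
  show "e i p \<noteq> 0" using assms unfolding holomorphic_frame_def by blast
  obtain c where c: "c \<in> A" "p \<in> fst c" using ex_chart patch_in_topspace assms by blast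
  have "openin X W" using assms(1) unfolding holomorphic_frame_def by blast
  then have "openin X (patch L i \<inter> W)" using assms(3) open_patch by blast
  then have "open (snd c ` (fst c \<inter> (patch L i \<inter> W)))" by (rule open_chart_image[OF chart[OF c(1)]])
  moreover have "in_chart c (e i) holomorphic_on snd c ` (fst c \<inter> (patch L i \<inter> W))"
    using assms c unfolding holomorphic_frame_def by (metis Int_assoc)
  ultimately show "holomorphic_at A (e i) p"
    using assms c analytic_at by (intro holomorphic_atI[OF c]) blast
qed

text \<open>
  In a holomorphic frame \<open>e\<close> the section has the coefficient \<open>s i / e i\<close>, and the connection form is
  its logarithmic derivative. The residue of a logarithmic derivative is the order, and dividing by
  the zero-free \<open>e i\<close> does not change the order.
\<close>

lemma normalized_residue_section_connection:
  assumes sec: "meromorphic_section X A L s" "nonzero_section X L s" and p: "p \<in> topspace X"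
  shows "normalized_residue X A L (section_connection s) p = 2 * \<i> * of_int (section_order A L s p)"
proof -
  have res: "residue (in_chart c (normalized (form_in_frame (section_connection s) e i) c)) (snd c p)
      = 2 * \<i> * of_int (section_order A L s p)"
    if e: "holomorphic_frame X A L W e" "p \<in> W" and i: "i \<in> frames L" "p \<in> patch L i"
      and c: "c \<in> A" "p \<in> fst c" for W e i c
  proof -
    note he = holomorphic_frame_at[OF e i]
    note me = holomorphic_imp_meromorphic_at[OF he(1)] order_at_nonvanishing(2)[OF he p]
    note ms = section_meromorphic_at[OF sec(1) i] section_eventually_nonzero[OF sec i]
    define g where "g = (\<lambda>x. s i x / e i x)"
    have g: "meromorphic_at A g p" unfolding g_def by (rule meromorphic_at_algebra[OF ms(1) me(1)])
    have gnz: "\<forall>\<^sub>F x in atin X p. g x \<noteq> 0"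
      using me(2) ms(2) by eventually_elim (simp add: g_def)
    have "\<forall>\<^sub>F x in atin X p. x \<in> fst c - {p}"
      using complex_chart_facts(1)[OF chart[OF c(1)]] c(2) by (rule eventually_atin_in_open)
    moreover have "\<forall>\<^sub>F x in atin X p. \<forall>\<^sub>F y in nhdsin X x. s i y = g y * e i y"
    proof (rule eventually_atin_eventually_nhdsin[OF _ p])
      show "\<forall>\<^sub>F y in atin X p. s i y = g y * e i y"
        using me(2) by eventually_elim (simp add: g_def)
    qed
    ultimately have "\<forall>\<^sub>F x in atin X p.
        normalized (form_in_frame (section_connection s) e i) c x = 2 * \<i> * dlog g c x"
      using meromorphic_at_eventually_holomorphic[OF g p] 
        meromorphic_at_eventually_holomorphic[OF me(1) p] gnz me(2)
    proof eventually_elim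
      case (elim x)
      then have "dlog (s i) c x = dlog (\<lambda>y. g y * e i y) c x" using c by (intro dlog_cong) auto
      also have "\<dots> = dlog g c x + dlog (e i) c x" using elim c by (intro dlog_mult) auto
      finally show ?case by (simp add: normalized_def form_in_frame_def section_connection_def)
    qed
    from in_chart_eventually_eq[OF c this]
    have "\<forall>\<^sub>F w in at (snd c p). in_chart c (normalized (form_in_frame (section_connection s) e i) c) w
        = 2 * \<i> * (deriv (in_chart c g) w / in_chart c g w)"
      using in_chart_dlog_at[OF c, of g] by eventually_elim (simp add: in_chart_eq)
    then have "residue (in_chart c (normalized (form_in_frame (section_connection s) e i) c)) (snd c p)
        = residue (\<lambda>w. 2 * \<i> * (deriv (in_chart c g) w / in_chart c g w)) (snd c p)"
      by (intro residue_cong) auto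
    also have "\<dots> = 2 * \<i> * of_int (zorder (in_chart c g) (snd c p))"
    proof (rule residue_logarithmic_derivative(1))
      show "in_chart c g meromorphic_on {snd c p}" using g c by (simp add: meromorphic_at_def)
      show "\<forall>\<^sub>F w in at (snd c p). in_chart c g w \<noteq> 0"
        using gnz unfolding eventually_atin_chart[OF chart[OF c(1)] c(2)] in_chart_eq .
    qed
    also have "zorder (in_chart c g) (snd c p) = order_at A g p" using order_at_eq[OF g gnz c] by simp
    also have "\<dots> = order_at A (s i) p"
      using order_at_algebra(2)[OF ms me p] order_at_nonvanishing(1)[OF he p] by (simp add: g_def)
    also have "\<dots> = section_order A L s p" using section_order_eq[OF sec i] by simp
    finally show ?thesis .
  qed
  obtain k where k: "k \<in> frames L" "p \<in> patch L k" using ex_frame p by blast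
  obtain c where c: "c \<in> A" "p \<in> fst c" using ex_chart p by blast
  show ?thesis unfolding normalized_residue_def
  proof (rule the_equality)
    fix r assume "\<forall>W e. holomorphic_frame X A L W e \<and> p \<in> W \<longrightarrow>
      (\<forall>i\<in>frames L. \<forall>c\<in>A. p \<in> patch L i \<and> p \<in> fst c \<longrightarrow>
         residue (in_chart c (normalized (form_in_frame (section_connection s) e i) c)) (snd c p) = r)"
    then show "r = 2 * \<i> * of_int (section_order A L s p)"
      using res[OF holomorphic_frame_of_index[OF k(1)] k(2) k c] holomorphic_frame_of_index[OF k(1)] k c
      by metis
  qed (use res in blast)
qed

lemma normalized_residue_cong:
  assumes "\<And>i c. i \<in> frames L \<Longrightarrow> c \<in> A \<Longrightarrow> p \<in> patch L i \<Longrightarrow> p \<in> fst c \<Longrightarrow>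
    \<forall>\<^sub>F x in atin X p. \<alpha> i c x = \<beta> i c x"
  shows "normalized_residue X A L \<alpha> p = normalized_residue X A L \<beta> p"
proof -
  have "residue (in_chart c (normalized (form_in_frame \<alpha> e i) c)) (snd c p) =
        residue (in_chart c (normalized (form_in_frame \<beta> e i) c)) (snd c p)"
    if "i \<in> frames L" "c \<in> A" "p \<in> patch L i \<and> p \<in> fst c" for e i c
  proof (intro residue_cong in_chart_eventually_eq refl)
    show "\<forall>\<^sub>F x in atin X p. normalized (form_in_frame \<alpha> e i) c x = normalized (form_in_frame \<beta> e i) c x"
      using assms[of i c] that by (auto simp: normalized_def form_in_frame_def elim: eventually_mono)
  qed (use that in auto)
  then show ?thesis
    unfolding normalized_residue_def by (simp cong: imp_cong ball_cong)
qed

text \<open>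
  The difference of the two coefficients in the frame \<open>i\<close> is meromorphic at \<open>p\<close>, so it either
  vanishes near \<open>p\<close> or has no zeros near \<open>p\<close>. Points close to \<open>p\<close> lie outside the finite set \<open>S\<close>;
  there the two connections agree in the frame \<open>k\<close>, hence in the frame \<open>i\<close>, which excludes the second
  case. The point \<open>p\<close> itself may lie outside the patch of \<open>k\<close>.
\<close>

lemma logarithmic_connection_determined:
  assumes \<alpha>: "logarithmic_connection X A L \<alpha>" and \<beta>: "logarithmic_connection X A L \<beta>"
    and k: "k \<in> frames L" and S: "finite S" "topspace X - S \<subseteq> patch L k"
    and eq: "\<And>c x. c \<in> A \<Longrightarrow> x \<in> fst c \<Longrightarrow> x \<notin> S \<Longrightarrow> \<alpha> k c x = \<beta> k c x"
    and i: "i \<in> frames L" "p \<in> patch L i" and c: "c \<in> A" "p \<in> fst c"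
  shows "\<forall>\<^sub>F x in atin X p. \<alpha> i c x = \<beta> i c x"
proof -
  note p = patch_in_topspace[OF i]
  define d where "d = (\<lambda>x. \<alpha> i c x - \<beta> i c x)"
  have "meromorphic_at A (\<alpha> i c) p" "meromorphic_at A (\<beta> i c) p"
    using \<alpha> \<beta> i c unfolding logarithmic_connection_def logarithmic_form_def meromorphic_fun_iff by blast+
  then have "meromorphic_at A d p" unfolding d_def by (rule meromorphic_at_algebra)
  then consider "\<forall>\<^sub>F x in atin X p. d x = 0" | "\<forall>\<^sub>F x in atin X p. d x \<noteq> 0"
    using meromorphic_at_cases p by blast
  then show ?thesis
  proof cases
    case 1
    then show ?thesis by (simp add: d_def)
  next
    case 2
    have "\<forall>\<^sub>F x in atin X p. x \<in> fst c - {p}"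
      using complex_chart_facts(1)[OF chart[OF c(1)]] c(2) by (rule eventually_atin_in_open)
    then have "\<forall>\<^sub>F x in atin X p. False"
      using eventually_atin_eventually_atin[OF 2 p] eventually_patch[OF i] 
        eventually_atin_notin_finite[OF S(1) p]
    proof eventually_elim
      case (elim x)
      then have x: "x \<in> topspace X" "x \<in> patch L k" "x \<in> patch L i" "x \<in> fst c"
        using patch_in_topspace[OF i(1)] S(2) by auto
      have ev: "\<forall>\<^sub>F y in atin X x. y \<in> fst c - {x}"
        using complex_chart_facts(1)[OF chart[OF c(1)]] x(4) by (rule eventually_atin_in_open)
      have "\<forall>\<^sub>F y in atin X x. \<alpha> i c y = \<alpha> k c y - dlog (trans L k i) c y"
        using \<alpha> k i(1) c(1) x unfolding logarithmic_connection_def by blast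
      moreover have "\<forall>\<^sub>F y in atin X x. \<beta> i c y = \<beta> k c y - dlog (trans L k i) c y"
        using \<beta> k i(1) c(1) x unfolding logarithmic_connection_def by blast
      ultimately have "\<forall>\<^sub>F y in atin X x. d y = 0"
        using ev eventually_atin_notin_finite[OF S(1) x(1)]
        by eventually_elim (use eq[OF c(1)] in \<open>simp add: d_def\<close>)
      with elim(2) have "\<forall>\<^sub>F y in atin X x. False" by eventually_elim simp
      then show ?case using atin_nontrivial[OF x(1)] by simp
    qed
    then show ?thesis using atin_nontrivial[OF p] by simp
  qed
qed

text \<open>
  At a point outside the patch of \<open>k\<close> the coefficient \<open>s k\<close> need not be meromorphic: a section is
  constrained only up to isolated points of each patch, and wrong values may accumulate at the
  boundary of the patch. Replacing every value by the limit removes them.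
\<close>

lemma section_limit_in_frame:
  assumes sec: "meromorphic_section X A L s" and k: "k \<in> frames L" 
    and j: "j \<in> frames L" "p \<in> patch L j" and ev: "\<forall>\<^sub>F x in atin X p. x \<in> patch L k"
  shows "\<forall>\<^sub>F x in atin X p. Lim (atin X x) (s k) = trans L k j x * s j x"
proof -
  note p = patch_in_topspace[OF j]
  show ?thesis
    using ev eventually_patch[OF j] 
      meromorphic_at_eventually_holomorphic[OF section_meromorphic_at[OF sec j] p]
  proof eventually_elim
    case (elim x)
    note x = patch_in_topspace[OF k elim(1)]
    have "((\<lambda>y. trans L k j y * s j y) \<longlongrightarrow> trans L k j x * s j x) (atin X x)"
      using holomorphic_at_tendsto[OF trans_holomorphic[OF k j(1) elim(1,2)] x]
        holomorphic_at_tendsto[OF elim(3) x] by (rule tendsto_mult)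
    moreover have "\<forall>\<^sub>F y in atin X x. trans L k j y * s j y = s k y"
      using section_frame_change[OF sec k j(1) elim(1,2)] by eventually_elim simp
    ultimately have "(s k \<longlongrightarrow> trans L k j x * s j x) (atin X x)" by (rule Lim_transform_eventually)
    then show ?case using atin_nontrivial[OF x] by (intro tendsto_Lim)
  qed
qed

end

locale compact_bundle_surface = bundle_surface + compact_surface
begin

text \<open>
  Let \<open>E k\<close> be a frame defined off a discrete set. It is a meromorphic section of \<open>L\<close>, and \<open>m\<close> is its
  divisor. The quotient of \<open>s\<close> by \<open>E k\<close> is a meromorphic function on the whole surface, whose orders
  sum to zero; therefore the divisors of \<open>s\<close> and of \<open>E k\<close> have the same degree.
\<close>

theorem sum_section_orders:
  assumes sec: "meromorphic_section X A L s" "nonzero_section X L s" and k: "k \<in> frames L"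
    and dense: "\<And>p. p \<in> topspace X \<Longrightarrow> \<forall>\<^sub>F x in atin X p. x \<in> patch L k"
    and frame_order: "\<And>p. p \<in> topspace X \<Longrightarrow> \<exists>j\<in>frames L. p \<in> patch L j \<and>
      meromorphic_at A (trans L k j) p \<and> order_at A (trans L k j) p = - m p"
  shows "finite {p \<in> topspace X. section_order A L s p \<noteq> 0}"
    and "(\<Sum>p | p \<in> topspace X \<and> section_order A L s p \<noteq> 0. section_order A L s p)
      = (\<Sum>p | p \<in> topspace X \<and> m p \<noteq> 0. m p)"
proof -
  \<comment> \<open>The quotient of \<open>s\<close> by \<open>E k\<close>, with its values repaired.\<close>
  define f where "f = (\<lambda>x. Lim (atin X x) (s k))"
  have f: "meromorphic_at A f p \<and> (\<forall>\<^sub>F x in atin X p. f x \<noteq> 0) \<and>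
      order_at A f p = section_order A L s p - m p \<and> (\<forall>\<^sub>F x in atin X p. section_order A L s x = 0)"
    if p: "p \<in> topspace X" for p
  proof -
    obtain j where j: "j \<in> frames L" "p \<in> patch L j" and
      t: "meromorphic_at A (trans L k j) p" "order_at A (trans L k j) p = - m p"
      using frame_order[OF p] by blast
    have lim: "\<forall>\<^sub>F x in atin X p. f x = trans L k j x * s j x"
      unfolding f_def using section_limit_in_frame[OF sec(1) k j dense[OF p]] .
    note sj = section_meromorphic_at[OF sec(1) j] section_eventually_nonzero[OF sec j]
    have tnz: "\<forall>\<^sub>F x in atin X p. trans L k j x \<noteq> 0"
      using dense[OF p] eventually_patch[OF j] by eventually_elim (rule trans_nonzero[OF k j(1)])
    have "\<forall>\<^sub>F x in atin X p. section_order A L s x = 0"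
      using eventually_order_zero[OF sj p] eventually_patch[OF j]
      by eventually_elim (simp add: section_order_eq[OF sec j(1)])
    moreover have "order_at A f p = section_order A L s p - m p"
      using order_at_cong[OF lim p] order_at_algebra(1)[OF t(1) tnz sj p] t(2) section_order_eq[OF sec j] by simp
    moreover have "meromorphic_at A f p"
      using meromorphic_at_cong[OF lim] meromorphic_at_algebra(3)[OF t(1) sj(1)] by simp
    moreover have "\<forall>\<^sub>F x in atin X p. f x \<noteq> 0" using lim tnz sj(2) by eventually_elim simp
    ultimately show ?thesis by blast
  qed
  let ?F = "{p \<in> topspace X. order_at A f p \<noteq> 0}" and ?S = "{p \<in> topspace X. section_order A L s p \<noteq> 0}"
    and ?M = "{p \<in> topspace X. m p \<noteq> 0}"
  have finF: "finite ?F" using f by (intro finite_orders) auto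
  show finS: "finite ?S" using f by (intro compact_finite_exceptions[OF compact]) auto
  have "?M \<subseteq> ?F \<union> ?S" using f by auto
  then have finM: "finite ?M" using finF finS finite_subset by blast
  define T where "T = ?F \<union> ?S \<union> ?M"
  have T: "finite T" "T \<subseteq> topspace X" using finF finS finM by (auto simp: T_def)
  have "0 = (\<Sum>p\<in>?F. order_at A f p)" using sum_orders_eq_0[of f] f by simp
  also have "\<dots> = (\<Sum>p\<in>T. order_at A f p)"
    by (intro sum.mono_neutral_left T(1)) (auto simp: T_def)
  also have "\<dots> = (\<Sum>p\<in>T. section_order A L s p - m p)"
    using f T(2) by (intro sum.cong) auto
  also have "\<dots> = (\<Sum>p\<in>T. section_order A L s p) - (\<Sum>p\<in>T. m p)" by (rule sum_subtractf)
  also have "(\<Sum>p\<in>T. section_order A L s p) = (\<Sum>p\<in>?S. section_order A L s p)"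
    by (intro sum.mono_neutral_right T(1)) (auto simp: T_def)
  also have "(\<Sum>p\<in>T. m p) = (\<Sum>p\<in>?M. m p)"
    by (intro sum.mono_neutral_right T(1)) (auto simp: T_def)
  finally show "(\<Sum>p\<in>?S. section_order A L s p) = (\<Sum>p\<in>?M. m p)" by simp
qed

end

section \<open>Holomorphic maps to the Riemann sphere\<close>

lemma sphere_chart_simps [simp]:
  "fst affine_chart = range Some" "snd affine_chart = the"
  "fst infinity_chart = - {Some 0}" "snd infinity_chart None = 0" "snd infinity_chart (Some w) = inverse w"
  by (auto simp: affine_chart_def infinity_chart_def)

lemma topspace_riemann_sphere [simp]: "topspace riemann_sphere = UNIV"
  by (auto simp: riemann_sphere_def) (metis not_None_eq rangeI)

lemma sphere_atlas_cases:
  assumes "d \<in> sphere_atlas"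
  obtains "d = affine_chart" | "d = infinity_chart"
  using assms by (auto simp: sphere_atlas_def)

lemma in_sphere_atlas [simp]: "affine_chart \<in> sphere_atlas" "infinity_chart \<in> sphere_atlas"
  by (auto simp: sphere_atlas_def)

lemma affine_neq_infinity [simp]: "affine_chart \<noteq> infinity_chart" "infinity_chart \<noteq> affine_chart"
proof -
  have "None \<notin> fst affine_chart" "None \<in> fst infinity_chart" by auto
  then show "affine_chart \<noteq> infinity_chart" "infinity_chart \<noteq> affine_chart" by metis+
qed

lemma openin_sphere_chart:
  assumes "d \<in> sphere_atlas"
  shows "openin riemann_sphere (fst d)"
  using assms
proof (cases rule: sphere_atlas_cases)
  case 1
  have "openin (Alexandroff_compactification euclidean) (Some ` (UNIV :: complex set))"
    by (subst openin_Alexandroff_compactification_image_Some) simp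
  then show ?thesis unfolding 1 riemann_sphere_def sphere_chart_simps .
next
  case 2
  have "- {Some 0} = insert None (Some ` (topspace euclidean - {0 :: complex}))"
    by (auto simp: image_iff)
  moreover have "compactin euclidean {0 :: complex}" "closedin euclidean {0 :: complex}"
    by auto
  ultimately show ?thesis
    unfolding 2 riemann_sphere_def openin_Alexandroff_compactification sphere_chart_simps
    by (intro disjI2 exI[of _ "{0}"] conjI)
qed

lemma sphere_chart_cover: "\<exists>d\<in>sphere_atlas. y \<in> fst d"
  by (cases y) (auto simp: sphere_atlas_def)

lemma inj_on_sphere_chart:
  assumes "d \<in> sphere_atlas"
  shows "inj_on (snd d) (fst d)"
  using assms
proof (cases rule: sphere_atlas_cases)
  case 2
  have "x = y" if "x \<noteq> Some 0" "y \<noteq> Some 0" "snd infinity_chart x = snd infinity_chart y" for x y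
    using that by (cases x; cases y) auto
  then show ?thesis using 2 by (auto simp: inj_on_def)
qed (auto simp: inj_on_def)

lemma in_sphere_chart_apply:
  assumes "d \<in> sphere_atlas" "y \<in> fst d"
  shows "in_chart d f (snd d y) = f y"
  using inj_on_sphere_chart assms by (simp add: in_chart_eq)

text \<open>
  The two coordinates of the sphere are inverse to each other; all properties of the frame changes of
  its tangent bundle come from this relation.
\<close>

lemma sphere_chart_product:
  assumes "d \<in> sphere_atlas" "e \<in> sphere_atlas" "d \<noteq> e" "y \<in> fst d" "y \<in> fst e"
  shows "snd d y * snd e y = 1"
  using assms by (cases y) (auto simp: sphere_atlas_def)

lemma sphere_transition:
  assumes "d \<in> sphere_atlas" "e \<in> sphere_atlas" "y \<in> fst d" "y \<in> fst e"
  shows "\<forall>\<^sub>F w in nhds (snd e y). in_chart e (snd d) w = (if d = e then w else inverse w)"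
proof (cases "d = e")
  case True
  have "in_chart e (snd e) w = w" for w
    using assms(2)
  proof (cases rule: sphere_atlas_cases)
    case 1
    have "w \<in> snd affine_chart ` fst affine_chart" by (auto intro: image_eqI[of _ _ "Some w"])
    then show ?thesis unfolding 1 in_chart_eq by (rule f_inv_into_f)
  next
    case 2
    have "w \<in> snd infinity_chart ` fst infinity_chart"
      by (cases "w = 0") (auto intro: image_eqI[of _ _ None] image_eqI[of _ _ "Some (inverse w)"])
    then show ?thesis unfolding 2 in_chart_eq by (rule f_inv_into_f)
  qed
  then show ?thesis using True by simp
next
  case False
  have "snd e y \<noteq> 0" using sphere_chart_product[OF assms(1,2) False assms(3,4)] by auto
  then have "\<forall>\<^sub>F w in nhds (snd e y). w \<in> - {0}" by (intro eventually_nhds_in_open) auto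
  then show ?thesis
  proof eventually_elim
    case (elim w)
    define y' where "y' = (if e = affine_chart then Some w else Some (inverse w))"
    have "y' \<in> fst e" "snd e y' = w" "snd d y' = inverse w"
      using assms(1,2) False elim by (auto simp: y'_def sphere_atlas_def)
    then show ?case using in_sphere_chart_apply[OF assms(2), of y' "snd d"] False by simp
  qed
qed

lemma sphere_transition_deriv:
  assumes "d \<in> sphere_atlas" "e \<in> sphere_atlas" "y \<in> fst d" "y \<in> fst e"
  shows "chart_deriv e (snd d) y = (if d = e then 1 else - 1 / (snd e y)\<^sup>2)"
    and "in_chart e (snd d) field_differentiable at (snd e y)"
proof -
  have nz: "snd e y \<noteq> 0" if "d \<noteq> e"
    using sphere_chart_product[OF assms(1,2) that assms(3,4)] by auto
  have "((\<lambda>w. if d = e then w else inverse w) has_field_derivative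
      (if d = e then 1 else - 1 / (snd e y)\<^sup>2)) (at (snd e y))"
    using nz by (auto intro!: derivative_eq_intros simp: power2_eq_square field_simps)
  then have "(in_chart e (snd d) has_field_derivative
      (if d = e then 1 else - 1 / (snd e y)\<^sup>2)) (at (snd e y))"
    using DERIV_cong_ev[OF refl sphere_transition[OF assms] refl] by blast
  then show "chart_deriv e (snd d) y = (if d = e then 1 else - 1 / (snd e y)\<^sup>2)"
    "in_chart e (snd d) field_differentiable at (snd e y)"
    by (auto simp: chart_deriv_def field_differentiable_def intro: DERIV_imp_deriv)
qed

locale sphere_map = surface +
  fixes F :: "'a \<Rightarrow> complex option"
  assumes holomorphic_F: "holomorphic_map X A riemann_sphere sphere_atlas F"
begin

lemma openin_vimage_chart:
  assumes "d \<in> sphere_atlas"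
  shows "openin X (topspace X \<inter> F -` fst d)"
proof -
  have "continuous_map X riemann_sphere F" using holomorphic_F by (simp add: holomorphic_map_def)
  then have "openin X {x \<in> topspace X. F x \<in> fst d}"
    using openin_sphere_chart[OF assms] by (rule openin_continuous_map_preimage)
  moreover have "topspace X \<inter> F -` fst d = {x \<in> topspace X. F x \<in> fst d}" by auto
  ultimately show ?thesis by simp
qed

lemma eventually_in_chart:
  assumes "d \<in> sphere_atlas" "p \<in> topspace X" "F p \<in> fst d"
  shows "\<forall>\<^sub>F x in nhdsin X p. F x \<in> fst d"
proof -
  have "\<forall>\<^sub>F x in nhdsin X p. x \<in> topspace X \<inter> F -` fst d"
    by (rule eventually_nhdsin_in_open[OF openin_vimage_chart[OF assms(1)]]) (use assms(2,3) in simp)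
  then show ?thesis by eventually_elim simp
qed

lemma coordinate_holomorphic:
  assumes "d \<in> sphere_atlas" "p \<in> topspace X" "F p \<in> fst d"
  shows "holomorphic_at A (snd d \<circ> F) p"
proof -
  obtain c where c: "c \<in> A" "p \<in> fst c" using ex_chart assms by blast
  have "in_chart c (snd d \<circ> F) holomorphic_on snd c ` (fst c \<inter> F -` fst d)"
    using holomorphic_F assms c by (simp add: holomorphic_map_def)
  moreover have "fst c \<inter> F -` fst d = fst c \<inter> (topspace X \<inter> F -` fst d)"
    using complex_chart_facts(2)[OF chart[OF c(1)]] by auto
  moreover have "open (snd c ` (fst c \<inter> (topspace X \<inter> F -` fst d)))"
    by (rule open_chart_image[OF chart[OF c(1)] openin_vimage_chart[OF assms(1)]])
  ultimately have "in_chart c (snd d \<circ> F) analytic_on {snd c p}"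
    using assms c by (subst analytic_at) (metis IntI imageI vimageI)
  then show ?thesis by (rule holomorphic_atI[OF c])
qed

lemma chart_deriv_coordinate_change:
  assumes "d \<in> sphere_atlas" "e \<in> sphere_atlas" "F p \<in> fst d" "F p \<in> fst e" "c \<in> A" "p \<in> fst c"
  shows "chart_deriv c (snd d \<circ> F) p = chart_deriv e (snd d) (F p) * chart_deriv c (snd e \<circ> F) p"
proof -
  have p: "p \<in> topspace X" using assms in_topspace by blast
  have "chart_deriv c (snd d \<circ> F) p = chart_deriv c (\<lambda>x. in_chart e (snd d) (snd e (F x))) p"
    using eventually_in_chart[OF assms(2) p assms(4)]
    by (intro chart_deriv_cong assms) (auto elim!: eventually_mono simp: in_sphere_chart_apply[OF assms(2)])
  also have "\<dots> = deriv (in_chart e (snd d) \<circ> in_chart c (snd e \<circ> F)) (snd c p)"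
    by (simp add: chart_deriv_def in_chart_def o_def)
  also have "\<dots> = deriv (in_chart e (snd d)) (in_chart c (snd e \<circ> F) (snd c p)) *
      deriv (in_chart c (snd e \<circ> F)) (snd c p)"
    using coordinate_holomorphic[OF assms(2) p assms(4)] sphere_transition_deriv(2)[OF assms(1-4)]
      in_chart_apply[OF chart[OF assms(5)] assms(6), of "snd e \<circ> F"] assms
    by (intro deriv_chain) (auto simp: holomorphic_at_def intro: analytic_on_imp_differentiable_at)
  finally show ?thesis
    using in_chart_apply[OF chart[OF assms(5)] assms(6), of "snd e \<circ> F"] by (simp add: chart_deriv_def)
qed

lemma tangent_transition_pullback:
  assumes "d \<in> sphere_atlas" "e \<in> sphere_atlas" "p \<in> topspace X" "F p \<in> fst d" "F p \<in> fst e"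
  shows "holomorphic_at A (\<lambda>x. chart_deriv e (snd d) (F x)) p" "chart_deriv e (snd d) (F p) \<noteq> 0"
proof -
  have nz: "snd e (F p) \<noteq> 0" if "d \<noteq> e"
    using sphere_chart_product[OF assms(1,2) that assms(4,5)] by auto
  then show "chart_deriv e (snd d) (F p) \<noteq> 0"
    using sphere_transition_deriv(1)[OF assms(1,2,4,5)] by simp
  define h where "h = (\<lambda>x. if d = e then 1 else - 1 / (snd e (F x) * snd e (F x)))"
  have "holomorphic_at A (\<lambda>x. - 1 / ((snd e \<circ> F) x * (snd e \<circ> F) x)) p" if "d \<noteq> e"
    using nz[OF that] by (intro holomorphic_at_divide holomorphic_at_const holomorphic_at_algebra
        coordinate_holomorphic assms) auto
  then have h: "holomorphic_at A h p"
    by (cases "d = e") (auto simp: h_def holomorphic_at_const)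
  have "\<forall>\<^sub>F x in nhdsin X p. chart_deriv e (snd d) (F x) = h x"
    using eventually_in_chart[OF assms(1,3,4)] eventually_in_chart[OF assms(2,3,5)]
    by eventually_elim (simp add: h_def sphere_transition_deriv(1)[OF assms(1,2)] power2_eq_square)
  with h show "holomorphic_at A (\<lambda>x. chart_deriv e (snd d) (F x)) p"
    by (rule holomorphic_at_cong)
qed

end

lemma tangent_transition_cocycle:
  assumes "d \<in> sphere_atlas" "e \<in> sphere_atlas" "k \<in> sphere_atlas" "y \<in> fst d" "y \<in> fst e" "y \<in> fst k"
  shows "chart_deriv k (snd d) y = chart_deriv e (snd d) y * chart_deriv k (snd e) y"
proof (cases "d = e \<or> e = k")
  case False
  then have "k = d" using assms by (auto simp: sphere_atlas_def)
  moreover have "snd d y * snd e y = 1" using sphere_chart_product assms False by blast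
  then have "1 = (- 1 / (snd e y)\<^sup>2) * (- 1 / (snd d y)\<^sup>2)"
    by (auto simp: field_simps simp flip: power_mult_distrib)
  ultimately show ?thesis using False assms by (simp add: sphere_transition_deriv(1))
qed (use assms in \<open>auto simp: sphere_transition_deriv(1)\<close>)

locale nonconstant_sphere_map = compact_surface + sphere_map +
  assumes nonconstant_F: "nonconstant_on (topspace X) F"
begin

text \<open>
  In a coordinate around \<open>F p\<close> the germ of \<open>F\<close> at \<open>p\<close> either is constant or avoids \<open>y\<close> near \<open>p\<close>.
  On a connected surface the first alternative for one point forces \<open>F\<close> to be constant.
\<close>

lemma eventually_neq_value:
  assumes "p \<in> topspace X"
  shows "\<forall>\<^sub>F x in atin X p. F x \<noteq> y"
proof -
  have "(\<forall>\<^sub>F x in atin X p. F x = y) \<or> (\<forall>\<^sub>F x in atin X p. F x \<noteq> y)" if p: "p \<in> topspace X" for p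
  proof -
    obtain d where d: "d \<in> sphere_atlas" "F p \<in> fst d" using sphere_chart_cover by blast
    note ev = eventually_nhdsin_imp_atin[OF eventually_in_chart[OF d(1) p d(2)]]
    show ?thesis
    proof (cases "y \<in> fst d")
      case True
      have "meromorphic_at A (\<lambda>x. (snd d \<circ> F) x - snd d y) p"
        by (intro meromorphic_at_algebra meromorphic_at_const holomorphic_imp_meromorphic_at
            coordinate_holomorphic d p)
      from meromorphic_at_cases[OF this p] show ?thesis
      proof (elim disj_forward)
        assume "\<forall>\<^sub>F x in atin X p. (snd d \<circ> F) x - snd d y = 0"
        with ev show "\<forall>\<^sub>F x in atin X p. F x = y"
          by eventually_elim (use True inj_on_sphere_chart[OF d(1)] in \<open>auto dest: inj_onD\<close>)
      next
        assume "\<forall>\<^sub>F x in atin X p. (snd d \<circ> F) x - snd d y \<noteq> 0"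
        then show "\<forall>\<^sub>F x in atin X p. F x \<noteq> y" by (auto elim: eventually_mono)
      qed
    next
      case False
      have "\<forall>\<^sub>F x in atin X p. F x \<noteq> y" using ev by eventually_elim (use False in auto)
      then show ?thesis by blast
    qed
  qed
  then consider "\<forall>p\<in>topspace X. \<forall>\<^sub>F x in atin X p. F x = y" | "\<forall>p\<in>topspace X. \<forall>\<^sub>F x in atin X p. F x \<noteq> y"
    using connected_dichotomy[OF connected, of "\<lambda>x. F x = y"] by blast
  then show ?thesis
  proof cases
    case 1
    have "F p = y" if p: "p \<in> topspace X" for p
    proof -
      obtain d where d: "d \<in> sphere_atlas" "F p \<in> fst d" using sphere_chart_cover by blast
      note ev = eventually_nhdsin_imp_atin[OF eventually_in_chart[OF d(1) p d(2)]]
      have "\<forall>\<^sub>F x in atin X p. F x = y" using 1 p by blast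
      then have "\<forall>\<^sub>F x in atin X p. y \<in> fst d" and evc: "\<forall>\<^sub>F x in atin X p. (snd d \<circ> F) x = snd d y"
        using ev by (eventually_elim; simp)+
      then have y: "y \<in> fst d" using atin_nontrivial[OF p] by simp
      have "((snd d \<circ> F) \<longlongrightarrow> (snd d \<circ> F) p) (atin X p)"
        by (intro holomorphic_at_tendsto coordinate_holomorphic d p)
      moreover have "((snd d \<circ> F) \<longlongrightarrow> snd d y) (atin X p)" using evc by (rule tendsto_eventually)
      ultimately have "snd d (F p) = snd d y"
        using tendsto_unique[OF atin_nontrivial[OF p]] by fastforce
      then show ?thesis using inj_on_sphere_chart[OF d(1)] d(2) y by (auto dest: inj_onD)
    qed
    then show ?thesis using nonconstant_F by (auto simp: nonconstant_on_def)
  qed (use assms in blast)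
qed

lemma finite_fiber: "finite {p \<in> topspace X. F p = y}"
  using eventually_neq_value by (intro compact_finite_exceptions[OF compact])

lemma coordinate_eventually_neq:
  assumes "d \<in> sphere_atlas" "p \<in> topspace X" "F p \<in> fst d"
  shows "\<forall>\<^sub>F x in atin X p. snd d (F x) \<noteq> a"
proof (cases "a \<in> snd d ` fst d")
  case True
  then obtain y where y: "y \<in> fst d" "a = snd d y" by blast
  show ?thesis
    using eventually_neq_value[OF assms(2), of y] eventually_nhdsin_imp_atin[OF eventually_in_chart[OF assms]]
    by eventually_elim (use y inj_on_sphere_chart[OF assms(1)] in \<open>auto dest: inj_onD\<close>)
next
  case False
  show ?thesis
    using eventually_nhdsin_imp_atin[OF eventually_in_chart[OF assms]]
    by eventually_elim (use False in auto)
qed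

text \<open>
  If \<open>u v = 1\<close> and \<open>u\<^sub>0 v\<^sub>0 = 1\<close>, then \<open>v - v\<^sub>0 = - v\<^sub>0 v (u - u\<^sub>0)\<close>, so the two coordinates
  of the sphere give the same multiplicity.
\<close>

lemma map_multiplicity_eq:
  assumes d: "d \<in> sphere_atlas" "F p \<in> fst d" and p: "p \<in> topspace X"
  shows "map_multiplicity A sphere_atlas F p = order_at A (\<lambda>x. snd d (F x) - snd d (F p)) p"
proof -
  define u where "u = (\<lambda>(e :: complex option chart) x. snd e (F x) - snd e (F p))"
  have hol: "holomorphic_at A (\<lambda>x. snd e (F x)) p" if "e \<in> sphere_atlas" "F p \<in> fst e" for e
    using coordinate_holomorphic[OF that(1) p that(2)] by (simp add: o_def)
  have mu: "meromorphic_at A (u e) p" "\<forall>\<^sub>F x in atin X p. u e x \<noteq> 0"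
    if "e \<in> sphere_atlas" "F p \<in> fst e" for e
  proof -
    show "meromorphic_at A (u e) p"
      unfolding u_def using hol[OF that]
      by (intro meromorphic_at_algebra meromorphic_at_const holomorphic_imp_meromorphic_at)
    show "\<forall>\<^sub>F x in atin X p. u e x \<noteq> 0"
      using coordinate_eventually_neq[OF that(1) p that(2), of "snd e (F p)"] by (simp add: u_def)
  qed
  have indep: "order_at A (u e) p = order_at A (u d) p" if e: "e \<in> sphere_atlas" "F p \<in> fst e" for e
  proof (cases "e = d")
    case False
    have nz: "snd d (F p) * snd e (F p) = 1" using sphere_chart_product d e False by blast
    define h where "h = (\<lambda>x. - snd e (F p) * snd e (F x))"
    have h: "holomorphic_at A h p" "h p \<noteq> 0"
    proof -
      show "holomorphic_at A h p"
        unfolding h_def by (rule holomorphic_at_algebra(2)[OF holomorphic_at_const hol[OF e]])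
    qed (use nz in \<open>auto simp: h_def\<close>)
    have "\<forall>\<^sub>F x in atin X p. u e x = h x * u d x"
      using eventually_nhdsin_imp_atin[OF eventually_in_chart[OF d(1) p d(2)]]
        eventually_nhdsin_imp_atin[OF eventually_in_chart[OF e(1) p e(2)]]
    proof eventually_elim
      case (elim x)
      have 1: "snd d (F x) * snd e (F x) = 1" using sphere_chart_product d e False elim by blast
      have "h x * u d x = snd e (F x) * (snd d (F p) * snd e (F p)) - snd e (F p) * (snd d (F x) * snd e (F x))"
        unfolding h_def u_def by (simp add: algebra_simps)
      also have "\<dots> = u e x" using 1 nz by (simp add: u_def)
      finally show ?case by simp
    qed
    then have "order_at A (u e) p = order_at A (\<lambda>x. h x * u d x) p" using p by (rule order_at_cong)
    also have "\<dots> = order_at A h p + order_at A (u d) p"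
      by (intro order_at_algebra holomorphic_imp_meromorphic_at h order_at_nonvanishing(2) mu d p)
    finally show ?thesis using order_at_nonvanishing(1)[OF h p] by simp
  qed simp
  have z: "zorder (\<lambda>w. in_chart c (snd e \<circ> F) w - snd e (F p)) (snd c p) = order_at A (u d) p"
    if "c \<in> A" "p \<in> fst c" "e \<in> sphere_atlas" "F p \<in> fst e" for c e
    using order_at_eq[OF mu[OF that(3,4)] that(1,2)] indep[OF that(3,4)]
    by (simp add: u_def in_chart_def o_def)
  obtain c where c: "c \<in> A" "p \<in> fst c" using ex_chart p by blast
  have "map_multiplicity A sphere_atlas F p = order_at A (u d) p"
    unfolding map_multiplicity_def
  proof (rule the_equality)
    fix n
    assume "\<forall>c\<in>A. \<forall>d\<in>sphere_atlas. p \<in> fst c \<and> F p \<in> fst d \<longrightarrow>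
      zorder (\<lambda>w. in_chart c (snd d \<circ> F) w - snd d (F p)) (snd c p) = n"
    then have "zorder (\<lambda>w. in_chart c (snd d \<circ> F) w - snd d (F p)) (snd c p) = n"
      using c d by blast
    then show "n = order_at A (u d) p" using z[OF c d] by simp
  qed (use z in blast)
  then show ?thesis by (simp add: u_def)
qed

lemma affine_coordinate_meromorphic:
  assumes p: "p \<in> topspace X"
  shows "meromorphic_at A (\<lambda>x. the (F x)) p"
proof (cases "F p")
  case (Some a)
  then have "holomorphic_at A (snd affine_chart \<circ> F) p" using p by (intro coordinate_holomorphic) auto
  then show ?thesis by (intro holomorphic_imp_meromorphic_at) (simp add: o_def)
next
  case None
  have m: "meromorphic_at A (\<lambda>x. 1 / (snd infinity_chart \<circ> F) x) p"
    using None p by (intro meromorphic_at_algebra meromorphic_at_const holomorphic_imp_meromorphic_at 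
        coordinate_holomorphic) auto
  have "\<forall>\<^sub>F x in atin X p. the (F x) = 1 / (snd infinity_chart \<circ> F) x"
    using eventually_neq_value[OF p, of None] by eventually_elim (auto simp: inverse_eq_divide)
  then show ?thesis by (rule iffD2[OF meromorphic_at_cong m])
qed

lemma affine_coordinate_eventually_neq:
  assumes p: "p \<in> topspace X"
  shows "\<forall>\<^sub>F x in atin X p. the (F x) \<noteq> a"
  using eventually_neq_value[OF p, of None] eventually_neq_value[OF p, of "Some a"]
proof eventually_elim
  case (elim x)
  then show ?case by (cases "F x") auto
qed

text \<open>
  The divisor of the meromorphic function \<open>F - a\<close> is the fibre of \<open>F\<close> over \<open>a\<close> minus the fibre over
  infinity.
\<close>

lemma order_affine_coordinate:
  assumes p: "p \<in> topspace X"
  shows "order_at A (\<lambda>x. the (F x) - a) p = (case F p of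
    None \<Rightarrow> - map_multiplicity A sphere_atlas F p |
    Some b \<Rightarrow> if b = a then map_multiplicity A sphere_atlas F p else 0)"
proof (cases "F p")
  case (Some b)
  show ?thesis
  proof (cases "b = a")
    case True
    then show ?thesis using map_multiplicity_eq[of affine_chart, OF _ _ p] Some by simp
  next
    case False
    have "holomorphic_at A (\<lambda>x. the (F x)) p"
      using coordinate_holomorphic[of affine_chart, OF _ p] Some by (simp add: o_def)
    then have "holomorphic_at A (\<lambda>x. the (F x) - a) p"
      by (intro holomorphic_at_algebra holomorphic_at_const)
    then have "order_at A (\<lambda>x. the (F x) - a) p = 0"
      using Some False by (intro order_at_nonvanishing p) auto
    then show ?thesis using Some False by simp
  qed
next
  case None
  \<comment> \<open>Near a pole \<open>F - a = (1 - a v) / v\<close>, where \<open>v\<close> is the coordinate \<open>1 / F\<close>.\<close>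
  define v where "v = (\<lambda>x. snd infinity_chart (F x))"
  have v: "holomorphic_at A v p" "v p = 0"
    using coordinate_holomorphic[of infinity_chart, OF _ p] None by (simp_all add: o_def v_def)
  have vnz: "\<forall>\<^sub>F x in atin X p. v x \<noteq> 0"
    using coordinate_eventually_neq[of infinity_chart p 0] p None by (simp add: v_def)
  have h: "holomorphic_at A (\<lambda>x. 1 - a * v x) p"
    by (intro holomorphic_at_algebra holomorphic_at_const v)
  have "\<forall>\<^sub>F x in atin X p. the (F x) - a = (1 - a * v x) / v x"
    using vnz eventually_neq_value[OF p, of None] by eventually_elim (auto simp: v_def field_simps)
  then have "order_at A (\<lambda>x. the (F x) - a) p = order_at A (\<lambda>x. (1 - a * v x) / v x) p"
    using p by (rule order_at_cong)
  also have "\<dots> = order_at A (\<lambda>x. 1 - a * v x) p - order_at A v p"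
    using v h by (intro order_at_algebra holomorphic_imp_meromorphic_at vnz order_at_nonvanishing(2) p) auto
  also have "order_at A (\<lambda>x. 1 - a * v x) p = 0"
    using v by (intro order_at_nonvanishing h p) auto
  also have "order_at A v p = map_multiplicity A sphere_atlas F p"
    using map_multiplicity_eq[of infinity_chart, OF _ _ p] None by (simp add: v_def)
  finally show ?thesis using None by simp
qed

text \<open>
  This is the vanishing of the degree of the divisor of \<open>F - a\<close>. It shows that the degree of \<open>F\<close> is
  well defined.
\<close>

lemma fiber_sum_constant:
  "(\<Sum>p | p \<in> topspace X \<and> F p = Some a. map_multiplicity A sphere_atlas F p) =
   (\<Sum>p | p \<in> topspace X \<and> F p = None. map_multiplicity A sphere_atlas F p)"
proof -
  let ?g = "\<lambda>x. the (F x) - a" and ?m = "map_multiplicity A sphere_atlas F"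
  let ?P = "{p \<in> topspace X. F p = Some a}" and ?Q = "{p \<in> topspace X. F p = None}"
  have "0 = (\<Sum>p | p \<in> topspace X \<and> order_at A ?g p \<noteq> 0. order_at A ?g p)"
  proof (rule sum_orders_eq_0[symmetric])
    fix p assume p: "p \<in> topspace X"
    show "meromorphic_at A ?g p"
      by (rule meromorphic_at_algebra(2)[OF affine_coordinate_meromorphic[OF p] meromorphic_at_const])
    show "\<forall>\<^sub>F x in atin X p. ?g x \<noteq> 0"
      using affine_coordinate_eventually_neq[OF p, of a] by simp
  qed
  also have "\<dots> = (\<Sum>p \<in> ?P \<union> ?Q. order_at A ?g p)"
  proof (rule sum.mono_neutral_left)
    have "order_at A ?g p = 0" if "p \<in> topspace X" "F p \<noteq> Some a" "F p \<noteq> None" for p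
      using order_affine_coordinate[OF that(1), of a] that by auto
    then show "{p \<in> topspace X. order_at A ?g p \<noteq> 0} \<subseteq> ?P \<union> ?Q" by blast
  qed (use finite_fiber in auto)
  also have "\<dots> = (\<Sum>p \<in> ?P. order_at A ?g p) + (\<Sum>p \<in> ?Q. order_at A ?g p)"
    using finite_fiber by (intro sum.union_disjoint) auto
  also have "(\<Sum>p \<in> ?P. order_at A ?g p) = (\<Sum>p \<in> ?P. ?m p)"
    using order_affine_coordinate[of _ a] by (intro sum.cong) auto
  also have "(\<Sum>p \<in> ?Q. order_at A ?g p) = (\<Sum>p \<in> ?Q. - ?m p)"
    using order_affine_coordinate[of _ a] by (intro sum.cong) auto
  finally show ?thesis unfolding sum_negf by linarith
qed

lemma map_degree_eq:
  "map_degree X A riemann_sphere sphere_atlas F =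
    (\<Sum>p | p \<in> topspace X \<and> F p = None. map_multiplicity A sphere_atlas F p)"
  unfolding map_degree_def
proof (rule the_equality)
  show "\<forall>y\<in>topspace riemann_sphere. (\<Sum>p | p \<in> topspace X \<and> F p = y. map_multiplicity A sphere_atlas F p) =
    (\<Sum>p | p \<in> topspace X \<and> F p = None. map_multiplicity A sphere_atlas F p)"
  proof
    fix y show "(\<Sum>p | p \<in> topspace X \<and> F p = y. map_multiplicity A sphere_atlas F p) =
      (\<Sum>p | p \<in> topspace X \<and> F p = None. map_multiplicity A sphere_atlas F p)"
    proof (cases y)
      case (Some a)
      then show ?thesis using fiber_sum_constant[of a] by (simp only:)
    qed (simp only:)
  qed
next
  fix r assume "\<forall>y\<in>topspace riemann_sphere. (\<Sum>p | p \<in> topspace X \<and> F p = y. map_multiplicity A sphere_atlas F p) = r"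
  then show "r = (\<Sum>p | p \<in> topspace X \<and> F p = None. map_multiplicity A sphere_atlas F p)"
    by (metis UNIV_I topspace_riemann_sphere)
qed

text \<open>
  The derivative of \<open>F\<close> in a chart is holomorphic. If it vanished near \<open>p\<close>, then \<open>F\<close> would be
  constant there.
\<close>

lemma chart_deriv_eventually_nonzero:
  assumes d: "d \<in> sphere_atlas" "F p \<in> fst d" and c: "c \<in> A" "p \<in> fst c"
  shows "\<forall>\<^sub>F x in atin X p. chart_deriv c (snd d \<circ> F) x \<noteq> 0"
proof -
  have p: "p \<in> topspace X" using c in_topspace by blast
  define h where "h = in_chart c (snd d \<circ> F)"
  have h: "h analytic_on {snd c p}"
    using coordinate_holomorphic[OF d(1) p d(2)] c by (simp add: holomorphic_at_def h_def)
  then have "deriv h meromorphic_on {snd c p}" "deriv h analytic_on {snd c p}"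
    by (auto intro!: analytic_on_imp_meromorphic_on analytic_intros)
  then have "(\<forall>\<^sub>F w in at (snd c p). deriv h w = 0) \<or> (\<forall>\<^sub>F w in at (snd c p). deriv h w \<noteq> 0)"
    by (intro meromorphic_at_dichotomy)
  moreover have False if ev: "\<forall>\<^sub>F w in at (snd c p). deriv h w = 0"
  proof -
    have "deriv h \<midarrow>snd c p\<rightarrow> deriv h (snd c p)"
      using \<open>deriv h analytic_on {snd c p}\<close> analytic_at_imp_isCont isContD by blast
    moreover have "deriv h \<midarrow>snd c p\<rightarrow> 0" using ev by (rule tendsto_eventually)
    ultimately have "deriv h (snd c p) = 0" using LIM_unique by blast
    with ev have "\<forall>\<^sub>F w in nhds (snd c p). deriv h w = 0"
      by (auto simp: eventually_at_filter elim: eventually_mono)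
    moreover obtain S where "open S" "snd c p \<in> S" "h holomorphic_on S" using h analytic_at by blast
    ultimately have "\<forall>\<^sub>F w in nhds (snd c p). w \<in> S \<and> deriv h w = 0"
      by (intro eventually_conj eventually_nhds_in_open)
    then obtain r where r: "r > 0" "\<And>w. w \<in> ball (snd c p) r \<Longrightarrow> w \<in> S \<and> deriv h w = 0"
      by (auto simp: eventually_nhds_metric dist_commute)
    have hol: "h holomorphic_on ball (snd c p) r"
      by (rule holomorphic_on_subset[OF \<open>h holomorphic_on S\<close>]) (use r(2) in blast)
    have "(h has_field_derivative 0) (at w within ball (snd c p) r)" if "w \<in> ball (snd c p) r" for w
      using holomorphic_derivI[OF hol open_ball that, of "ball (snd c p) r"] r(2)[OF that] by metis
    then obtain a where a: "\<And>w. w \<in> ball (snd c p) r \<Longrightarrow> h w = a"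
      using has_field_derivative_zero_constant[of "ball (snd c p) r" h] by (metis convex_ball)
    have "\<forall>\<^sub>F w in at (snd c p). h w = a"
      by (rule eventually_mono[OF eventually_at_in_open'[OF open_ball, of "snd c p" "snd c p" r]])
        (use r(1) a in auto)
    then have "\<forall>\<^sub>F x in atin X p. snd d (F x) = a"
      unfolding eventually_atin_chart[OF chart[OF c(1)] c(2)] by (simp add: h_def in_chart_eq)
    with coordinate_eventually_neq[OF d(1) p d(2), of a] have "\<forall>\<^sub>F x in atin X p. False"
      by eventually_elim simp
    then show False using atin_nontrivial[OF p] by simp
  qed
  ultimately have "\<forall>\<^sub>F w in at (snd c p). deriv h w \<noteq> 0" by blast
  moreover have "\<forall>\<^sub>F w in at (snd c p). w \<in> snd c ` fst c"
    using complex_chart_facts(3)[OF chart[OF c(1)]] c by (intro eventually_at_in_open') auto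
  ultimately show ?thesis
    unfolding eventually_atin_chart[OF chart[OF c(1)] c(2)]
    by eventually_elim (use chart[OF c(1)] in \<open>auto simp: h_def chart_deriv_def\<close>)
qed

end

section \<open>The relative differential\<close>

context surface
begin

lemma holomorphic_at_chart_deriv:
  assumes "c \<in> A" "p \<in> fst c" "holomorphic_at A f p"
  shows "holomorphic_at A (chart_deriv c f) p"
proof (rule holomorphic_atI[OF assms(1,2)])
  have "\<forall>\<^sub>F w in nhds (snd c p). w \<in> snd c ` fst c"
    using complex_chart_facts(3)[OF chart[OF assms(1)]] assms(2) by (intro eventually_nhds_in_open) auto
  then have "\<forall>\<^sub>F w in nhds (snd c p). in_chart c (chart_deriv c f) w = deriv (in_chart c f) w"
    by eventually_elim (use chart[OF assms(1)] in \<open>auto simp: in_chart_eq chart_deriv_def\<close>)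
  moreover have "deriv (in_chart c f) analytic_on {snd c p}"
    using assms by (auto simp: holomorphic_at_def intro: analytic_intros)
  ultimately show "in_chart c (chart_deriv c f) analytic_on {snd c p}"
    using analytic_at_cong[OF _ refl] by blast
qed

end

locale two_sphere_maps = compact_surface X A + q: nonconstant_sphere_map X A q + z: nonconstant_sphere_map X A z
  for X :: "'a topology" and A :: "'a chart set" and q z :: "'a \<Rightarrow> complex option"
begin

lemma relative_bundle_simps [simp]:
  "frames (relative_bundle X q z) = sphere_atlas \<times> sphere_atlas"
  "p \<in> patch (relative_bundle X q z) (i, k) \<longleftrightarrow> p \<in> topspace X \<and> q p \<in> fst i \<and> z p \<in> fst k"
  "trans (relative_bundle X q z) (i, k) (i', k') p =
    chart_deriv k' (snd k) (z p) / chart_deriv i' (snd i) (q p)"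
  by (auto simp: relative_bundle_def hom_bundle_def pullback_bundle_def tangent_bundle_def)

lemma relative_bundle_holomorphic: "holomorphic_line_bundle X A (relative_bundle X q z)"
  unfolding holomorphic_line_bundle_def
proof (intro conjI ballI)
  fix a assume "a \<in> frames (relative_bundle X q z)"
  then obtain i k where a: "a = (i, k)" "i \<in> sphere_atlas" "k \<in> sphere_atlas" by auto
  have "patch (relative_bundle X q z) a = (topspace X \<inter> q -` fst i) \<inter> (topspace X \<inter> z -` fst k)"
    unfolding a(1) by auto
  then show "openin X (patch (relative_bundle X q z) a)"
    using openin_Int[OF q.openin_vimage_chart[OF a(2)] z.openin_vimage_chart[OF a(3)]] by (simp only:)
next
  fix p assume p: "p \<in> topspace X"
  obtain i k where "i \<in> sphere_atlas" "q p \<in> fst i" "k \<in> sphere_atlas" "z p \<in> fst k"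
    using sphere_chart_cover by blast
  then show "\<exists>a\<in>frames (relative_bundle X q z). p \<in> patch (relative_bundle X q z) a"
    using p by (intro bexI[of _ "(i, k)"]) simp_all
next
  fix a b p assume a: "a \<in> frames (relative_bundle X q z)" and b: "b \<in> frames (relative_bundle X q z)"
    and p: "p \<in> patch (relative_bundle X q z) a \<inter> patch (relative_bundle X q z) b"
  obtain i k i' k' where ab: "a = (i, k)" "b = (i', k')" by (cases a, cases b)
  have t: "trans (relative_bundle X q z) a b =
      (\<lambda>x. chart_deriv k' (snd k) (z x) / chart_deriv i' (snd i) (q x))"
    unfolding ab by (rule ext) simp
  have m: "i \<in> sphere_atlas" "k \<in> sphere_atlas" "i' \<in> sphere_atlas" "k' \<in> sphere_atlas"
    "p \<in> topspace X" "q p \<in> fst i" "q p \<in> fst i'" "z p \<in> fst k" "z p \<in> fst k'"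
    using a b p unfolding ab by simp_all
  note tq = q.tangent_transition_pullback[OF m(1,3,5,6,7)]
  note tz = z.tangent_transition_pullback[OF m(2,4,5,8,9)]
  show "holomorphic_at A (trans (relative_bundle X q z) a b) p"
    unfolding t by (rule holomorphic_at_divide[OF tz(1) tq])
  show "trans (relative_bundle X q z) a b p \<noteq> 0" unfolding t using tz(2) tq(2) by simp
next
  fix a b c p assume fr: "a \<in> frames (relative_bundle X q z)" "b \<in> frames (relative_bundle X q z)"
      "c \<in> frames (relative_bundle X q z)"
    and p: "p \<in> patch (relative_bundle X q z) a \<inter> patch (relative_bundle X q z) b \<inter> patch (relative_bundle X q z) c"
  obtain i k i' k' i'' k'' where abc: "a = (i, k)" "b = (i', k')" "c = (i'', k'')"
    by (cases a, cases b, cases c)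
  have m: "i \<in> sphere_atlas" "i' \<in> sphere_atlas" "i'' \<in> sphere_atlas" "q p \<in> fst i" "q p \<in> fst i'" "q p \<in> fst i''"
    and n: "k \<in> sphere_atlas" "k' \<in> sphere_atlas" "k'' \<in> sphere_atlas" "z p \<in> fst k" "z p \<in> fst k'" "z p \<in> fst k''"
    using fr p unfolding abc by simp_all
  show "trans (relative_bundle X q z) a c p =
      trans (relative_bundle X q z) a b p * trans (relative_bundle X q z) b c p"
    unfolding abc using tangent_transition_cocycle[OF m] tangent_transition_cocycle[OF n] by simp
qed

sublocale compact_bundle_surface X A "relative_bundle X q z"
  by unfold_locales (rule relative_bundle_holomorphic)

text \<open>
  A change of the coordinate on the surface multiplies both derivatives by the same nonzero factor.
  Hence the equation holds also at branch points of \<open>q\<close>, where both sides have the value zero.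
\<close>

lemma relative_differential_eq:
  assumes c: "c \<in> A" "p \<in> fst c" and d: "i \<in> sphere_atlas" "k \<in> sphere_atlas" "q p \<in> fst i" "z p \<in> fst k"
  shows "relative_differential A q z (i, k) p = chart_deriv c (snd k \<circ> z) p / chart_deriv c (snd i \<circ> q) p"
proof -
  have p: "p \<in> topspace X" using c in_topspace by blast
  define j where "j = (SOME j. j \<in> A \<and> p \<in> fst j)"
  have j: "j \<in> A" "p \<in> fst j" using someI[of "\<lambda>j. j \<in> A \<and> p \<in> fst j" c] c unfolding j_def by blast+
  have "relative_differential A q z (i, k) p = chart_deriv j (snd k \<circ> z) p / chart_deriv j (snd i \<circ> q) p"
    by (simp add: relative_differential_def compose_morphism_def inverse_morphism_def map_differential_def
        tangent_bundle_def Let_def j_def divide_inverse)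
  moreover have "chart_deriv j (snd k \<circ> z) p = chart_deriv c (snd k \<circ> z) p * chart_deriv j (snd c) p"
    by (intro chart_deriv_change c j z.coordinate_holomorphic d p)
  moreover have "chart_deriv j (snd i \<circ> q) p = chart_deriv c (snd i \<circ> q) p * chart_deriv j (snd c) p"
    by (intro chart_deriv_change c j q.coordinate_holomorphic d p)
  moreover have "chart_deriv j (snd c) p \<noteq> 0"
    using chart_change(2)[OF c(1) j(1) c(2) j(2)] by (simp add: chart_deriv_def)
  ultimately show ?thesis by simp
qed

lemma eventually_relative_differential_eq:
  assumes "c \<in> A" "p \<in> fst c" "i \<in> sphere_atlas" "k \<in> sphere_atlas" "q p \<in> fst i" "z p \<in> fst k"
  shows "\<forall>\<^sub>F x in nhdsin X p.
    relative_differential A q z (i, k) x = chart_deriv c (snd k \<circ> z) x / chart_deriv c (snd i \<circ> q) x"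
proof -
  have p: "p \<in> topspace X" using assms in_topspace by blast
  show ?thesis
    using eventually_nhdsin_in_open[OF complex_chart_facts(1)[OF chart[OF assms(1)]] assms(2)]
      q.eventually_in_chart[OF assms(3) p assms(5)] z.eventually_in_chart[OF assms(4) p assms(6)]
    by eventually_elim (rule relative_differential_eq[OF assms(1) _ assms(3,4)])
qed

lemma relative_differential_section:
  "meromorphic_section X A (relative_bundle X q z) (relative_differential A q z)"
  "nonzero_section X (relative_bundle X q z) (relative_differential A q z)"
proof -
  let ?L = "relative_bundle X q z" and ?s = "relative_differential A q z"
  have mero: "meromorphic_at A (?s (i, k)) p" and nz: "\<forall>\<^sub>F x in atin X p. ?s (i, k) x \<noteq> 0"
    if p: "p \<in> topspace X" and d: "i \<in> sphere_atlas" "k \<in> sphere_atlas" "q p \<in> fst i" "z p \<in> fst k" for i k p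
  proof -
    obtain c where c: "c \<in> A" "p \<in> fst c" using ex_chart p by blast
    note ev = eventually_nhdsin_imp_atin[OF eventually_relative_differential_eq[OF c d]]
    have "meromorphic_at A (\<lambda>x. chart_deriv c (snd k \<circ> z) x / chart_deriv c (snd i \<circ> q) x) p"
      by (intro meromorphic_at_algebra holomorphic_imp_meromorphic_at holomorphic_at_chart_deriv c
          q.coordinate_holomorphic z.coordinate_holomorphic d p)
    then show "meromorphic_at A (?s (i, k)) p" by (rule iffD2[OF meromorphic_at_cong[OF ev]])
    show "\<forall>\<^sub>F x in atin X p. ?s (i, k) x \<noteq> 0"
      using ev q.chart_deriv_eventually_nonzero[OF d(1,3) c] z.chart_deriv_eventually_nonzero[OF d(2,4) c]
      by eventually_elim simp
  qed
  show "meromorphic_section X A ?L ?s"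
    unfolding meromorphic_section_def meromorphic_fun_iff
  proof (intro conjI ballI)
    fix a p assume "a \<in> frames ?L" "p \<in> patch ?L a"
    then show "meromorphic_at A (?s a) p" by (cases a) (auto intro: mero)
  next
    fix a b p assume a: "a \<in> frames ?L" and b: "b \<in> frames ?L" and p: "p \<in> patch ?L a \<inter> patch ?L b"
    obtain i k i' k' where ab: "a = (i, k)" "b = (i', k')" by (cases a, cases b)
    have m: "i \<in> sphere_atlas" "k \<in> sphere_atlas" "i' \<in> sphere_atlas" "k' \<in> sphere_atlas"
      using a b unfolding ab by simp_all
    show "\<forall>\<^sub>F x in atin X p. ?s a x = trans ?L a b x * ?s b x"
      using eventually_patch[OF a IntD1[OF p]] eventually_patch[OF b IntD2[OF p]]
    proof eventually_elim
      case (elim x)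
      then have x: "x \<in> topspace X" "q x \<in> fst i" "q x \<in> fst i'" "z x \<in> fst k" "z x \<in> fst k'"
        unfolding ab by simp_all
      obtain c where c: "c \<in> A" "x \<in> fst c" using ex_chart x by blast
      show ?case
        unfolding ab relative_bundle_simps
        using relative_differential_eq[OF c m(1,2) x(2,4)] relative_differential_eq[OF c m(3,4) x(3,5)]
          q.chart_deriv_coordinate_change[OF m(1,3) x(2,3) c] z.chart_deriv_coordinate_change[OF m(2,4) x(4,5) c]
        by simp
    qed
  qed
  show "nonzero_section X ?L ?s"
    unfolding nonzero_section_def
  proof (intro ballI)
    fix a p assume "a \<in> frames ?L" "p \<in> patch ?L a"
    then show "\<exists>\<^sub>F x in atin X p. ?s a x \<noteq> 0"
      by (cases a) (auto intro!: eventually_frequently_atin nz)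
  qed
qed

text \<open>
  Let \<open>w\<close> be the affine coordinate of the sphere and \<open>u = 1 / w\<close>. Then \<open>\<partial>/\<partial>u = - w\<^sup>2 \<partial>/\<partial>w\<close>, so the
  coefficient pulled back here is \<open>- 1 / u\<^sup>2\<close> at the poles of \<open>F\<close>. In other words \<open>\<partial>/\<partial>w\<close> has a double
  zero at infinity.
\<close>

lemma (in nonconstant_sphere_map) order_tangent_transition:
  assumes p: "p \<in> topspace X"
  defines "d \<equiv> if F p = None then infinity_chart else affine_chart"
  shows "meromorphic_at A (\<lambda>x. chart_deriv d the (F x)) p" "\<forall>\<^sub>F x in atin X p. chart_deriv d the (F x) \<noteq> 0"
    "order_at A (\<lambda>x. chart_deriv d the (F x)) p =
      (if F p = None then - 2 * map_multiplicity A sphere_atlas F p else 0)"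
proof -
  have aff: "\<forall>\<^sub>F x in atin X p. F x \<in> fst affine_chart"
    using eventually_neq_value[OF p, of None] by eventually_elim auto
  have d: "d \<in> sphere_atlas" "F p \<in> fst d" by (auto simp: d_def)
  note evd = eventually_nhdsin_imp_atin[OF eventually_in_chart[OF d(1) p d(2)]]
  have "meromorphic_at A (\<lambda>x. chart_deriv d the (F x)) p \<and> (\<forall>\<^sub>F x in atin X p. chart_deriv d the (F x) \<noteq> 0) \<and>
    order_at A (\<lambda>x. chart_deriv d the (F x)) p =
      (if F p = None then - 2 * map_multiplicity A sphere_atlas F p else 0)"
  proof (cases "F p = None")
    case False
    then have d: "d = affine_chart" by (simp add: d_def)
    have ev: "\<forall>\<^sub>F x in atin X p. chart_deriv d the (F x) = 1"
      using aff by eventually_elim (use sphere_transition_deriv(1)[of affine_chart affine_chart] d in simp)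
    have "order_at A (\<lambda>x. chart_deriv d the (F x)) p = order_at A (\<lambda>_. 1) p"
      using ev p by (rule order_at_cong)
    also have "\<dots> = 0" by (intro order_at_nonvanishing holomorphic_at_const p) simp
    finally show ?thesis
      using False iffD2[OF meromorphic_at_cong[OF ev] meromorphic_at_const] ev by (auto elim: eventually_mono)
  next
    case True
    then have d': "d = infinity_chart" by (simp add: d_def)
    define v where "v = (\<lambda>x. snd infinity_chart (F x))"
    have v: "meromorphic_at A v p"
      using coordinate_holomorphic[OF d(1) p d(2)] d'
      by (intro holomorphic_imp_meromorphic_at) (simp add: o_def v_def)
    have vnz: "\<forall>\<^sub>F x in atin X p. v x \<noteq> 0"
      using coordinate_eventually_neq[OF d(1) p d(2), of 0] d' by (simp add: v_def)
    have ev: "\<forall>\<^sub>F x in atin X p. chart_deriv d the (F x) = -1 / (v x * v x)"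
      using aff evd
    proof eventually_elim
      case (elim x)
      then show ?case
        using sphere_transition_deriv(1)[of affine_chart infinity_chart "F x"] d'
        by (simp add: v_def power2_eq_square)
    qed
    have m: "meromorphic_at A (\<lambda>x. -1 / (v x * v x)) p"
      by (intro meromorphic_at_algebra meromorphic_at_const v)
    have vv: "meromorphic_at A (\<lambda>x. v x * v x) p" "\<forall>\<^sub>F x in atin X p. v x * v x \<noteq> 0"
      using vnz by (auto intro: meromorphic_at_algebra v elim: eventually_mono)
    have nz: "\<forall>\<^sub>F x in atin X p. chart_deriv d the (F x) \<noteq> 0"
      using ev vnz by eventually_elim simp
    have "order_at A (\<lambda>x. chart_deriv d the (F x)) p = order_at A (\<lambda>x. -1 / (v x * v x)) p"
      using ev p by (rule order_at_cong)
    also have "\<dots> = order_at A (\<lambda>_. -1) p - order_at A (\<lambda>x. v x * v x) p"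
      by (intro order_at_algebra meromorphic_at_const vv p) simp
    also have "order_at A (\<lambda>_. -1) p = 0"
      by (intro order_at_nonvanishing holomorphic_at_const p) simp
    also have "order_at A (\<lambda>x. v x * v x) p = order_at A v p + order_at A v p"
      by (rule order_at_algebra(1)[OF v vnz v vnz p])
    also have "order_at A v p = map_multiplicity A sphere_atlas F p"
      using map_multiplicity_eq[OF d(1,2) p] True d' by (simp add: v_def)
    finally show ?thesis using True iffD2[OF meromorphic_at_cong[OF ev] m] nz by simp
  qed
  then show "meromorphic_at A (\<lambda>x. chart_deriv d the (F x)) p" "\<forall>\<^sub>F x in atin X p. chart_deriv d the (F x) \<noteq> 0"
    "order_at A (\<lambda>x. chart_deriv d the (F x)) p =
      (if F p = None then - 2 * map_multiplicity A sphere_atlas F p else 0)" by auto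
qed

text \<open>
  The divisor of the coordinate frame \<open>\<partial>/\<partial>z \<otimes> dq\<close> is twice the polar divisor of \<open>z\<close> minus twice
  the polar divisor of \<open>q\<close>, and every nonzero meromorphic section has a divisor of the same degree.
\<close>

theorem sum_orders_relative_section:
  assumes "meromorphic_section X A (relative_bundle X q z) s" "nonzero_section X (relative_bundle X q z) s"
  shows "finite {p \<in> topspace X. section_order A (relative_bundle X q z) s p \<noteq> 0}"
    and "(\<Sum>p | p \<in> topspace X \<and> section_order A (relative_bundle X q z) s p \<noteq> 0.
        section_order A (relative_bundle X q z) s p)
      = 2 * (map_degree X A riemann_sphere sphere_atlas z - map_degree X A riemann_sphere sphere_atlas q)"
proof -
  let ?L = "relative_bundle X q z"
  define mz where "mz = (\<lambda>p. if z p = None then 2 * map_multiplicity A sphere_atlas z p else 0)"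
  define mq where "mq = (\<lambda>p. if q p = None then 2 * map_multiplicity A sphere_atlas q p else 0)"
  define m where "m = (\<lambda>p. mz p - mq p)"
  have k: "(affine_chart, affine_chart) \<in> frames ?L" by simp
  have dense: "\<forall>\<^sub>F x in atin X p. x \<in> patch ?L (affine_chart, affine_chart)" if p: "p \<in> topspace X" for p
    using q.eventually_neq_value[OF p, of None] z.eventually_neq_value[OF p, of None]
      eventually_atin_in_open[OF openin_topspace p]
    by eventually_elim auto
  have frame: "\<exists>j\<in>frames ?L. p \<in> patch ?L j \<and> meromorphic_at A (trans ?L (affine_chart, affine_chart) j) p \<and>
      order_at A (trans ?L (affine_chart, affine_chart) j) p = - m p" if p: "p \<in> topspace X" for p
  proof -
    define i where "i = (if q p = None then infinity_chart else affine_chart)"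
    define k where "k = (if z p = None then infinity_chart else affine_chart)"
    note tq = q.order_tangent_transition[OF p, folded i_def]
    note tz = z.order_tangent_transition[OF p, folded k_def]
    have t: "trans ?L (affine_chart, affine_chart) (i, k) = (\<lambda>x. chart_deriv k the (z x) / chart_deriv i the (q x))"
      by (rule ext) simp
    have "order_at A (trans ?L (affine_chart, affine_chart) (i, k)) p = - m p"
      unfolding t using order_at_algebra(2)[OF tz(1,2) tq(1,2) p] tz(3) tq(3) by (simp add: m_def mz_def mq_def)
    moreover have "meromorphic_at A (trans ?L (affine_chart, affine_chart) (i, k)) p"
      unfolding t by (rule meromorphic_at_algebra(4)[OF tz(1) tq(1)])
    moreover have "(i, k) \<in> frames ?L" "p \<in> patch ?L (i, k)" using p by (auto simp: i_def k_def)
    ultimately show ?thesis by blast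
  qed
  note res = sum_section_orders[OF assms k dense frame]
  show "finite {p \<in> topspace X. section_order A ?L s p \<noteq> 0}" by (rule res(1))
  define T where "T = {p \<in> topspace X. z p = None} \<union> {p \<in> topspace X. q p = None}"
  have T: "finite T" using q.finite_fiber z.finite_fiber by (auto simp: T_def)
  have "(\<Sum>p | p \<in> topspace X \<and> m p \<noteq> 0. m p) = (\<Sum>p\<in>T. m p)"
    by (rule sum.mono_neutral_left[OF T]) (auto simp: T_def m_def mz_def mq_def split: if_splits)
  also have "\<dots> = (\<Sum>p\<in>T. mz p) - (\<Sum>p\<in>T. mq p)" by (simp add: m_def sum_subtractf)
  also have "(\<Sum>p\<in>T. mz p) = (\<Sum>p | p \<in> topspace X \<and> z p = None. mz p)"
    by (rule sum.mono_neutral_right[OF T]) (auto simp: T_def mz_def)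
  also have "\<dots> = 2 * map_degree X A riemann_sphere sphere_atlas z"
    unfolding z.map_degree_eq sum_distrib_left by (rule sum.cong) (auto simp: mz_def)
  also have "(\<Sum>p\<in>T. mq p) = (\<Sum>p | p \<in> topspace X \<and> q p = None. mq p)"
    by (rule sum.mono_neutral_right[OF T]) (auto simp: T_def mq_def)
  also have "\<dots> = 2 * map_degree X A riemann_sphere sphere_atlas q"
    unfolding q.map_degree_eq sum_distrib_left by (rule sum.cong) (auto simp: mq_def)
  finally show "(\<Sum>p | p \<in> topspace X \<and> section_order A ?L s p \<noteq> 0. section_order A ?L s p)
      = 2 * (map_degree X A riemann_sphere sphere_atlas z - map_degree X A riemann_sphere sphere_atlas q)"
    using res(2) by simp
qed

lemma bundle_degree_eq:
  "bundle_degree X A (relative_bundle X q z) =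
    2 * (map_degree X A riemann_sphere sphere_atlas z - map_degree X A riemann_sphere sphere_atlas q)"
  unfolding bundle_degree_def
  by (rule the_equality) (use sum_orders_relative_section relative_differential_section in blast)+

lemma residue_sum:
  defines "R \<equiv> normalized_residue X A (relative_bundle X q z) (section_connection (relative_differential A q z))"
  shows "finite {p \<in> topspace X. R p \<noteq> 0}"
    and "(\<Sum>p | p \<in> topspace X \<and> R p \<noteq> 0. R p) = 2 * \<i> * of_int (bundle_degree X A (relative_bundle X q z))"
proof -
  let ?o = "section_order A (relative_bundle X q z) (relative_differential A q z)"
  have R: "R p = 2 * \<i> * of_int (?o p)" if "p \<in> topspace X" for p
    unfolding R_def using relative_differential_section that by (rule normalized_residue_section_connection)
  then have S: "{p \<in> topspace X. R p \<noteq> 0} = {p \<in> topspace X. ?o p \<noteq> 0}" by auto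
  note sums = sum_orders_relative_section[OF relative_differential_section]
  show "finite {p \<in> topspace X. R p \<noteq> 0}" unfolding S by (rule sums(1))
  have "(\<Sum>p | p \<in> topspace X \<and> R p \<noteq> 0. R p) = (\<Sum>p | p \<in> topspace X \<and> ?o p \<noteq> 0. 2 * \<i> * of_int (?o p))"
    unfolding S using R by (intro sum.cong) auto
  also have "\<dots> = 2 * \<i> * of_int (\<Sum>p | p \<in> topspace X \<and> ?o p \<noteq> 0. ?o p)"
    by (simp add: sum_distrib_left)
  finally show "(\<Sum>p | p \<in> topspace X \<and> R p \<noteq> 0. R p) = 2 * \<i> * of_int (bundle_degree X A (relative_bundle X q z))"
    unfolding sums(2) bundle_degree_eq .
qed

end

section \<open>Dual conformal nets\<close>

text \<open>
  Each half of the net form contributes \<open>\<i> d log (dz/dq)\<close>: the function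
  \<open>log H\<close> is the real part of a branch of \<open>log (dz/dq)\<close>, so its
  \<open>\<partial>\<^sub>q\<close>-derivative is half of the complex logarithmic derivative.
\<close>

lemma dual_net_coefficients:
  assumes "deriv f analytic_on {w}" "deriv f w \<noteq> 0"
  shows "1 / of_real (net_factor f w) * dual_net_omega f w * (deriv f w * a)
      - of_real (net_factor f w) * net_omega f w * a = 2 * \<i> * (deriv (deriv f) w * a / deriv f w)"
proof -
  have H: "net_factor f w \<noteq> 0" using assms(2) by (simp add: net_factor_def)
  have w1: "wirtinger (\<lambda>v. of_real (ln (net_factor f v))) w = deriv (deriv f) w / (2 * deriv f w)"
    unfolding net_factor_def using assms by (rule wirtinger_ln_cmod)
  have "wirtinger (\<lambda>v. of_real (ln (cmod (inverse (deriv f v))))) w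
      = deriv (\<lambda>v. inverse (deriv f v)) w / (2 * inverse (deriv f w))"
    using assms by (intro wirtinger_ln_cmod) (auto intro!: analytic_on_inverse)
  moreover have "deriv (\<lambda>v. inverse (deriv f v)) w = - deriv (deriv f) w / (deriv f w)\<^sup>2"
  proof (rule DERIV_imp_deriv)
    have "(deriv f has_field_derivative deriv (deriv f) w) (at w)"
      using assms(1) analytic_on_imp_differentiable_at DERIV_deriv_iff_field_differentiable by blast
    then show "((\<lambda>v. inverse (deriv f v)) has_field_derivative - deriv (deriv f) w / (deriv f w)\<^sup>2) (at w)"
      using assms(2) by (auto intro!: derivative_eq_intros simp: power2_eq_square divide_inverse)
  qed
  ultimately have w2: "wirtinger (\<lambda>v. of_real (ln (dual_net_factor f v))) w
      = - deriv (deriv f) w / (2 * deriv f w)"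
    using assms(2) by (simp add: dual_net_factor_def net_factor_def norm_inverse power2_eq_square)
  have d: "dual_net_omega f w = - (2 * \<i> * of_real (net_factor f w)) *
      (inverse (deriv f w) * (- deriv (deriv f) w / (2 * deriv f w)))"
  proof -
    have "2 * \<i> / complex_of_real (dual_net_factor f w) = 2 * \<i> * of_real (net_factor f w)"
      by (simp add: dual_net_factor_def divide_inverse)
    then show ?thesis unfolding dual_net_omega_def w2 by (simp only:)
  qed
  have H': "complex_of_real (net_factor f w) \<noteq> 0" using H by simp
  have cancel: "1 / h * (- (2 * \<i> * h) * (inverse u * (- v / (2 * u)))) * (u * a) = \<i> * (v * a / u)"
    "h * (- (2 * \<i> / h) * (v / (2 * u))) * a = - (\<i> * (v * a / u))"
    if "h \<noteq> 0" "u \<noteq> 0" for h u v :: complex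
    using that by (simp_all add: divide_simps)
  have "1 / of_real (net_factor f w) * dual_net_omega f w * (deriv f w * a) = \<i> * (deriv (deriv f) w * a / deriv f w)"
    unfolding d by (rule cancel(1)[OF H' assms(2)])
  moreover have "of_real (net_factor f w) * net_omega f w * a = - (\<i> * (deriv (deriv f) w * a / deriv f w))"
    unfolding net_omega_def w1 by (rule cancel(2)[OF H' assms(2)])
  ultimately show ?thesis by simp
qed

context two_sphere_maps
begin

lemma net_domain_chart:
  assumes "net_domain X A q z U"
  defines "c0 \<equiv> (U, the \<circ> q)"
  shows "complex_chart X c0" "\<And>d. d \<in> A \<Longrightarrow> holomorphic_transition c0 d \<and> holomorphic_transition d c0"
  using assms by (auto simp: net_domain_def compatible_chart_def)

text \<open>
  On a net domain \<open>q\<close> is itself a coordinate, so \<open>dq\<close> has no zeros there and the relative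
  differential in the frame \<open>\<partial>/\<partial>z \<otimes> dq\<close> is the function \<open>dz/dq\<close>.
\<close>

lemma net_derivative:
  assumes U: "net_domain X A q z U" and c: "c \<in> A" "p \<in> fst c" and p: "p \<in> U"
  defines "f \<equiv> net_function q z U" and "w \<equiv> the (q p)"
  shows "chart_deriv c (the \<circ> z) p = deriv f w * chart_deriv c (the \<circ> q) p"
    and "chart_deriv c (the \<circ> q) p \<noteq> 0" and "f analytic_on {w}" and "deriv f w \<noteq> 0"
    and "relative_differential A q z (affine_chart, affine_chart) p = deriv f w"
proof -
  define c0 where "c0 = (U, the \<circ> q)"
  note c0 = net_domain_chart[OF U, folded c0_def]
  have [simp]: "fst c0 = U" "snd c0 = the \<circ> q" by (simp_all add: c0_def)
  have f: "f = in_chart c0 (the \<circ> z)" by (simp add: f_def net_function_def c0_def)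
  have op: "open ((the \<circ> q) ` U)" using complex_chart_facts(3)[OF c0(1)] by simp
  have hol: "f holomorphic_on (the \<circ> q) ` U" and nz: "\<forall>w\<in>(the \<circ> q) ` U. deriv f w \<noteq> 0"
    and vals: "None \<notin> q ` U" "None \<notin> z ` U"
    using U unfolding net_domain_def f_def by blast+
  have w: "w \<in> (the \<circ> q) ` U" using p by (simp add: w_def)
  show an: "f analytic_on {w}" using hol op w analytic_at by blast
  show dnz: "deriv f w \<noteq> 0" using nz w by blast
  note tr = transition_facts[OF c0(1) chart[OF c(1)] _ _ _ c(2), simplified, OF c0(2)[OF c(1), THEN conjunct1]
      c0(2)[OF c(1), THEN conjunct2] p]
  show qnz: "chart_deriv c (the \<circ> q) p \<noteq> 0" using tr(2) by (simp add: chart_deriv_def)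
  have val: "in_chart c (the \<circ> q) (snd c p) = w"
    using in_chart_apply[OF chart[OF c(1)] c(2), of "the \<circ> q"] by (simp add: w_def)
  have "chart_deriv c (the \<circ> z) p = deriv (f \<circ> in_chart c (the \<circ> q)) (snd c p)"
    unfolding chart_deriv_def f o_def[of "in_chart c0 (the \<circ> z)"]
    by (rule deriv_cong_ev[OF tr(3) refl])
  also have "\<dots> = deriv f (in_chart c (the \<circ> q) (snd c p)) * deriv (in_chart c (the \<circ> q)) (snd c p)"
    by (rule deriv_chain) (use an tr(1) val analytic_on_imp_differentiable_at in auto)
  finally show der: "chart_deriv c (the \<circ> z) p = deriv f w * chart_deriv c (the \<circ> q) p"
    by (simp add: val chart_deriv_def)
  have "q p \<in> range Some" "z p \<in> range Some" using vals p by (metis image_eqI not_None_eq rangeI)+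
  then show "relative_differential A q z (affine_chart, affine_chart) p = deriv f w"
    using relative_differential_eq[OF c, of affine_chart affine_chart] der qnz by simp
qed

lemma normalized_connection_eq_net_form:
  assumes U: "net_domain X A q z U" and c: "c \<in> A" "p \<in> fst c" and p: "p \<in> U"
  shows "normalized (section_connection (relative_differential A q z) (affine_chart, affine_chart)) c p =
    net_form q z U c p"
proof -
  define f where "f = net_function q z U"
  define g where "g = relative_differential A q z (affine_chart, affine_chart)"
  define w where "w = the (q p)"
  note nd = net_derivative[OF U c p, folded f_def w_def]
  have an: "deriv f analytic_on {w}" using nd(3) by (rule analytic_deriv)
  have "openin X U" using complex_chart_facts(1)[OF net_domain_chart(1)[OF U]] by simp
  then have ev: "\<forall>\<^sub>F x in nhdsin X p. x \<in> U \<inter> fst c"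
    using p c complex_chart_facts(1)[OF chart[OF c(1)]] by (intro eventually_nhdsin_in_open openin_Int) auto
  have "\<forall>\<^sub>F x in nhdsin X p. g x = deriv f (the (q x))"
    using ev by eventually_elim (use net_derivative(5)[OF U c(1)] in \<open>auto simp: g_def f_def\<close>)
  then have "chart_deriv c g p = chart_deriv c (\<lambda>x. deriv f (the (q x))) p"
    by (rule chart_deriv_cong[OF c])
  also have "\<dots> = deriv (deriv f \<circ> in_chart c (the \<circ> q)) (snd c p)"
    by (simp add: chart_deriv_def in_chart_def o_def)
  also have "\<dots> = deriv (deriv f) (in_chart c (the \<circ> q) (snd c p)) * deriv (in_chart c (the \<circ> q)) (snd c p)"
  proof (rule deriv_chain)
    have "(q p) \<in> range Some" using U p unfolding net_domain_def by (metis image_eqI not_None_eq rangeI)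
    then have "holomorphic_at A (the \<circ> q) p"
      using q.coordinate_holomorphic[of affine_chart p] in_topspace[OF c] by simp
    then show "in_chart c (the \<circ> q) field_differentiable at (snd c p)"
      using c by (auto simp: holomorphic_at_def intro: analytic_on_imp_differentiable_at)
    show "deriv f field_differentiable at (in_chart c (the \<circ> q) (snd c p))"
      using an in_chart_apply[OF chart[OF c(1)] c(2), of "the \<circ> q"]
      by (simp add: w_def analytic_on_imp_differentiable_at)
  qed
  also have "\<dots> = deriv (deriv f) w * chart_deriv c (the \<circ> q) p"
    using in_chart_apply[OF chart[OF c(1)] c(2), of "the \<circ> q"] by (simp add: w_def chart_deriv_def)
  finally have "normalized (section_connection (relative_differential A q z) (affine_chart, affine_chart)) c p
      = 2 * \<i> * (deriv (deriv f) w * chart_deriv c (the \<circ> q) p / deriv f w)"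
    using nd(5) by (simp add: normalized_def section_connection_def dlog_def differential_form_def g_def)
  also have "\<dots> = net_form q z U c p"
    using dual_net_coefficients[OF an nd(4), of "chart_deriv c (the \<circ> q) p"] nd(1)
    by (simp add: net_form_def Let_def differential_form_def f_def w_def)
  finally show ?thesis .
qed

lemma extends_net_form_section_connection:
  "extends_net_form X A q z S (section_connection (relative_differential A q z))"
  unfolding extends_net_form_def
proof (intro conjI allI impI ballI)
  show "logarithmic_connection X A (relative_bundle X q z) (section_connection (relative_differential A q z))"
    by (rule section_connection_logarithmic[OF relative_differential_section])
  fix U p c
  assume "U \<subseteq> topspace X - S \<and> net_domain X A q z U" "p \<in> U" "c \<in> A" "p \<in> fst c"
  then show "normalized (section_connection (relative_differential A q z) (affine_chart, affine_chart)) c p =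
      net_form q z U c p"
    by (intro normalized_connection_eq_net_form) auto
qed

text \<open>
  The net domains cover the complement of the finite set \<open>S\<close>, where the net form prescribes the
  connection in the coordinate frame; this determines the connection near every point of the
  surface.
\<close>

lemma residue_of_net_extension:
  assumes S: "net_realization X A q z S" and \<beta>: "extends_net_form X A q z S \<beta>"
  shows "normalized_residue X A (relative_bundle X q z) \<beta> p =
    normalized_residue X A (relative_bundle X q z) (section_connection (relative_differential A q z)) p"
proof (rule normalized_residue_cong)
  fix a c assume a: "a \<in> frames (relative_bundle X q z)" "p \<in> patch (relative_bundle X q z) a"
    and c: "c \<in> A" "p \<in> fst c"
  have fin: "finite S" using S by (simp add: net_realization_def)
  have cov: "\<exists>U. x \<in> U \<and> U \<subseteq> topspace X - S \<and> net_domain X A q z U" if "x \<in> topspace X" "x \<notin> S" for x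
    using S that unfolding net_realization_def by blast
  have log: "logarithmic_connection X A (relative_bundle X q z) \<beta>"
    using \<beta> unfolding extends_net_form_def by blast
  have patch: "topspace X - S \<subseteq> patch (relative_bundle X q z) (affine_chart, affine_chart)"
  proof
    fix x assume x: "x \<in> topspace X - S"
    then obtain U where "x \<in> U" "net_domain X A q z U" using cov by blast
    then have "q x \<in> range Some" "z x \<in> range Some"
      unfolding net_domain_def by (metis image_eqI not_None_eq rangeI)+
    then show "x \<in> patch (relative_bundle X q z) (affine_chart, affine_chart)" using x by simp
  qed
  have eq: "\<beta> (affine_chart, affine_chart) c x =
      section_connection (relative_differential A q z) (affine_chart, affine_chart) c x"
    if cx: "c \<in> A" "x \<in> fst c" "x \<notin> S" for c x
  proof -
    obtain U where U: "x \<in> U" "U \<subseteq> topspace X - S" "net_domain X A q z U"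
      using cov[OF in_topspace[OF cx(1,2)] cx(3)] by blast
    have "normalized (\<beta> (affine_chart, affine_chart)) c x = net_form q z U c x"
      using \<beta> U cx unfolding extends_net_form_def by blast
    then have "2 * \<i> * \<beta> (affine_chart, affine_chart) c x =
        2 * \<i> * section_connection (relative_differential A q z) (affine_chart, affine_chart) c x"
      using normalized_connection_eq_net_form[OF U(3) cx(1,2) U(1)] unfolding normalized_def by (simp only:)
    then show ?thesis by simp
  qed
  show "\<forall>\<^sub>F x in atin X p. \<beta> a c x = section_connection (relative_differential A q z) a c x"
    by (rule logarithmic_connection_determined[OF log
          section_connection_logarithmic[OF relative_differential_section] _ fin patch eq a c]) simp
qed

end

section \<open>The residue formula\<close>

theorem corollary10p5:
  fixes X :: "'a topology" and A :: "'a chart set" and q z :: "'a \<Rightarrow> complex option"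
  assumes "riemann_surface X A" and "compact_space X" and "connected_space X"
    and "holomorphic_map X A riemann_sphere sphere_atlas q" and "nonconstant_on (topspace X) q"
    and "holomorphic_map X A riemann_sphere sphere_atlas z" and "nonconstant_on (topspace X) z"
  shows
    "(let L = relative_bundle X q z;
          \<alpha> = section_connection (relative_differential A q z);
          deg = map_degree X A riemann_sphere sphere_atlas;
          Res = normalized_residue X A L
      in
        meromorphic_section X A L (relative_differential A q z) \<and>
        nonzero_section X L (relative_differential A q z) \<and>
        logarithmic_connection X A L \<alpha> \<and>
        finite {p \<in> topspace X. Res \<alpha> p \<noteq> 0} \<and>
        (\<Sum>p | p \<in> topspace X \<and> Res \<alpha> p \<noteq> 0. Res \<alpha> p) = 2 * \<i> * of_int (bundle_degree X A L) \<and>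
        2 * \<i> * of_int (bundle_degree X A L) = 4 * \<i> * (of_int (deg z) - of_int (deg q)) \<and>
        (\<forall>S. net_realization X A q z S \<longrightarrow>
           extends_net_form X A q z S \<alpha> \<and>
           (\<forall>\<beta>. extends_net_form X A q z S \<beta> \<longrightarrow>
              finite {p \<in> topspace X. Res \<beta> p \<noteq> 0} \<and>
              (\<Sum>p | p \<in> topspace X \<and> Res \<beta> p \<noteq> 0. Res \<beta> p)
                = 4 * \<i> * (of_int (deg z) - of_int (deg q)))))"
proof -
  interpret two_sphere_maps X A q z
    by unfold_locales (rule assms)+
  have degree: "2 * \<i> * of_int (bundle_degree X A (relative_bundle X q z)) =
      4 * \<i> * (of_int (map_degree X A riemann_sphere sphere_atlas z)
        - of_int (map_degree X A riemann_sphere sphere_atlas q))"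
    unfolding bundle_degree_eq by simp
  have net: "finite {p \<in> topspace X. normalized_residue X A (relative_bundle X q z) \<beta> p \<noteq> 0}"
    "(\<Sum>p | p \<in> topspace X \<and> normalized_residue X A (relative_bundle X q z) \<beta> p \<noteq> 0.
        normalized_residue X A (relative_bundle X q z) \<beta> p) =
      4 * \<i> * (of_int (map_degree X A riemann_sphere sphere_atlas z)
        - of_int (map_degree X A riemann_sphere sphere_atlas q))"
    if "net_realization X A q z S" "extends_net_form X A q z S \<beta>" for S \<beta>
    unfolding residue_of_net_extension[OF that] using residue_sum degree by (simp_all only:)
  show ?thesis
    unfolding Let_def
    by (intro conjI allI impI relative_differential_section residue_sum degree net
        section_connection_logarithmic[OF relative_differential_section]
        extends_net_form_section_connection) assumption+
qed

end
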